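(* Let $k$ be an even integer and let $s,s'\in\mathbb{C}$ satisfy $s+s'\in 2\mathbb{Z}+1$, $\mathrm{Re}\, s>\mathrm{Re}\, s'+1$, $1< s+s'<k-1$, $1<\mathrm{Re}\, s<k-1$ and $1<\mathrm{Re}\, s'<k-1$. Then \begin{align*} \gamma_k(s)^{-1}\int_0^{\infty}R_{s,k}(it)\,t^{s'-1}\,dt &= i^{-k}\frac{(2\pi i)^{k-s}}{(2\pi)^{k-s'}}\zeta(s-s'+1)\frac{\Gamma(k-s')}{\Gamma(k-s)}+i^{-k}\frac{(-2\pi i)^{s}}{(2\pi)^{k-s'}}\zeta(k-s'-s+1)\frac{\Gamma(k-s')}{\Gamma(s)}\\ &\quad+2\pi e^{\pi i (s'-1)/2}\frac{(-s'+1)_{k-1}}{(k-1)!}\sum_{\substack{a,b,c,d>0\\ ad-bc=1}}a^{-s}c^{s-s'}d^{s'-k}\,{}_2F_1\!\left(s,-s'+k;k;\tfrac{1}{ad}\right)\\ &\quad+\zeta(s-s')\left(e^{-\pi i s'/2}-e^{3\pi i s'/2}\right)\frac{\Gamma(s')\Gamma(s-s')}{\Gamma(s)}. \end{align*}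
   Context: For $z\in\mathbb{C}\setminus\{0\}$ and $w\in\mathbb{C}$, $z^w:=e^{w\log z}$ with the principal branch $-\pi<\arg z\le\pi$. For $s\in\mathbb{C}$ with $1<\mathrm{Re}\, s<k-1$ and $z$ in the upper half plane, the kernel function is $R_{s,k}(z):=\gamma_k(s)\sum_{V}(cz+d)^{-k}\left(\frac{az+b}{cz+d}\right)^{-s}$, where the sum runs over all $V=\begin{pmatrix}a&b\\c&d\end{pmatrix}\in PSL_2(\mathbb{Z})$, and $\gamma_k(s)=e^{\pi i s/2}\Gamma(s)\Gamma(k-s)$. Here $\zeta$ is the Riemann zeta function, $(x)_m=x(x+1)\cdots(x+m-1)$ is the rising Pochhammer symbol, and ${}_2F_1(\alpha,\beta;\gamma;z)=\sum_{l\ge0}\frac{(\alpha)_l(\beta)_l}{(\gamma)_l\, l!}z^l$ is the Gauss hypergeometric series. The sum over $a,b,c,d$ runs over all quadruples of positive integers with $ad-bc=1$. *)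

theory Defs
  imports "HOL-Analysis.Analysis"
begin

definition SL2Z :: "(int^2^2) set" where
  "SL2Z = {A. det A = 1}"

definition PSL2Z :: "(int^2^2) set set" where
  "PSL2Z = SL2Z // {(A, B). A \<in> SL2Z \<and> B \<in> SL2Z \<and> (B = A \<or> B = - A)}"

definition gamma_factor :: "int \<Rightarrow> complex \<Rightarrow> complex" where
  "gamma_factor k s = exp (of_real pi * \<i> * s / 2) * Gamma s * Gamma (of_int k - s)"

definition kernel_term :: "int \<Rightarrow> complex \<Rightarrow> complex \<Rightarrow> int^2^2 \<Rightarrow> complex" where
  "kernel_term k s z A =
     (of_int (A$2$1) * z + of_int (A$2$2)) powi (- k) *
     ((of_int (A$1$1) * z + of_int (A$1$2)) / (of_int (A$2$1) * z + of_int (A$2$2))) powr (- s)"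

lemma kernel_term_uminus:
  assumes "even k"
  shows "kernel_term k s z (- A) = kernel_term k s z A"
proof -
  have neg: "of_int (- m) * z + of_int (- n) = - (of_int m * z + of_int n)" for m n :: int
    by simp
  have div: "(- x) / (- y) = x / y" for x y :: complex
    by simp
  have pow: "(- x) powi (- k) = x powi (- k)" for x :: complex
    using assms by (simp add: power_int_minus_left)
  show ?thesis
    unfolding kernel_term_def vector_uminus_component neg div pow ..
qed

text \<open>
  By the previous lemma, for even \<open>k\<close> the terms take a single value on each class
  \<open>{A, - A}\<close>, and \<open>the_elem\<close> picks that value.
\<close>

definition kernel_R :: "int \<Rightarrow> complex \<Rightarrow> complex \<Rightarrow> complex" where
  "kernel_R k s z = gamma_factor k s * (\<Sum>\<^sub>\<infinity>V\<in>PSL2Z. the_elem (kernel_term k s z ` V))"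

text \<open>The Riemann zeta function on the half-plane \<open>Re s > 1\<close>, by its Dirichlet series.\<close>

definition riemann_zeta :: "complex \<Rightarrow> complex" where
  "riemann_zeta s = (\<Sum>n. of_nat (Suc n) powr (- s))"

definition hypergeo_2F1 :: "complex \<Rightarrow> complex \<Rightarrow> complex \<Rightarrow> complex \<Rightarrow> complex" where
  "hypergeo_2F1 \<alpha> \<beta> \<gamma> z =
     (\<Sum>l. pochhammer \<alpha> l * pochhammer \<beta> l / (pochhammer \<gamma> l * fact l) * z ^ l)"

definition pos_det1 :: "(int \<times> int \<times> int \<times> int) set" where
  "pos_det1 = {(a, b, c, d). a > 0 \<and> b > 0 \<and> c > 0 \<and> d > 0 \<and> a * d - b * c = 1}"

definition hypergeo_term :: "int \<Rightarrow> complex \<Rightarrow> complex \<Rightarrow> int \<times> int \<times> int \<times> int \<Rightarrow> complex" where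
  "hypergeo_term k s s' = (\<lambda>(a, b, c, d).
     of_int a powr (- s) * of_int c powr (s - s') * of_int d powr (s' - of_int k) *
     hypergeo_2F1 s (- s' + of_int k) (of_int k) (1 / (of_int a * of_int d)))"

end

theory Submission
  imports Defs "HOL-Complex_Analysis.Cauchy_Integral_Theorem"
begin

text \<open>
  A matrix contributes \<open>\<integral> (c i t + d)\<^sup>-\<^sup>k ((a i t + b) / (c i t + d))\<^sup>-\<^sup>s t\<^bsup>s'-1\<^esup> dt\<close>. This diverges
  at \<open>t = 0\<close> when \<open>b = 0\<close> or \<open>d = 0\<close>, so the terms with \<open>b = 0\<close>, and likewise those with \<open>d = 0\<close>, are
  first summed at \<open>u = 1/t\<close> by the Lipschitz formula
  \<open>\<Sum> (u + i n)\<^sup>-\<^sup>q = (2 \<pi>)\<^sup>q / \<Gamma>(q) \<Sum> m\<^bsup>q-1\<^esup> exp (- 2 \<pi> m u)\<close>; the decay of the right-hand side makes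
  the sums integrable and gives the first two terms of the theorem.

  All other terms are integrated one at a time. Rotating the ray \<open>i t\<close> to the positive axis shows that
  matrices which differ only in the signs of the entries lead to the same real integral, up to a factor
  \<open>exp (\<plusminus> \<pi> i s' / 2)\<close> from the rotation and possibly \<open>exp (- \<pi> i s)\<close> from the branch of the power. As
  \<open>s + s'\<close> is odd, the two sign patterns with \<open>a d < 0\<close> cancel, and so do those with \<open>a = 0\<close>; the
  two patterns with \<open>a d > 0\<close> add up to the factor \<open>exp (- \<pi> i s' / 2) - exp (3 \<pi> i s' / 2)\<close>. The real
  integral is a Beta value when \<open>c = 0\<close> and a hypergeometric value when no entry vanishes.
\<close>

section \<open>Absolutely convergent integrals over the positive ray\<close>

text \<open>The inequalities Re s' > 1, Re (s - s') > 1 and k - Re s > 1 are convergence conditions.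
  With \<open>P = Re s'\<close>, \<open>S = Re s\<close> and \<open>K = k\<close>, the term of a
  positive quadruple has a majorant whose integral is a constant times
  \<open>a powr - S * c powr (S - P) * d powr (P - K)\<close>. As c is of size a d / b, this is of
  size \<open>a powr - P * b powr - (S - P) * d powr - (K - S)\<close>. The terms with a = 0 lead to
  zeta (k - s - s'), hence Re (s + s') < k - 1; this value cancels from the result.

  Removing the signs turns a matrix with a d < 0 into a positive quadruple with a d - b c = -1. Its
  real integral is never computed: with E = exp (- \<i> \<pi> s) = - exp (\<i> \<pi> s'), its
  coefficient is E exp (- \<i> \<pi> s' / 2) + exp (\<i> \<pi> s' / 2) = 0. The surviving
  coefficient exp (- \<i> \<pi> s' / 2) + E exp (\<i> \<pi> s' / 2) equals 2 exp (\<i> \<pi> (s' -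
  1) / 2) sin (\<pi> s'), and the reflection formula turns sin (\<pi> s') times the Beta value of s'
  and k - s' into the Pochhammer quotient of the third term.\<close>

definition has_ray_integral :: "(real \<Rightarrow> 'a::{banach, second_countable_topology}) \<Rightarrow> 'a \<Rightarrow> bool" where
  "has_ray_integral f I \<longleftrightarrow>
     set_integrable lborel {0<..} f \<and> (LBINT t:{0<..}. f t) = I"

lemma has_ray_integralI:
  "set_integrable lborel {0<..} f \<Longrightarrow> has_ray_integral f (LBINT t:{0<..}. f t)"
  by (simp add: has_ray_integral_def)

lemma has_ray_integral_unique:
  "has_ray_integral f I \<Longrightarrow> has_ray_integral f J \<Longrightarrow> I = J"
  by (simp add: has_ray_integral_def)

lemma has_ray_integral_cong:
  assumes "\<And>t. t > 0 \<Longrightarrow> f t = g t"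
  shows "has_ray_integral f I \<longleftrightarrow> has_ray_integral g I"
proof -
  have "set_integrable lborel {0<..} f \<longleftrightarrow> set_integrable lborel {0<..} g"
    by (intro set_integrable_cong) (use assms in auto)
  moreover have "(LBINT t:{0<..}. f t) = (LBINT t:{0<..}. g t)"
    by (intro set_lebesgue_integral_cong) (use assms in auto)
  ultimately show ?thesis by (simp add: has_ray_integral_def)
qed

lemma has_ray_integral_cmult:
  fixes f :: "real \<Rightarrow> 'a::{real_normed_field, banach, second_countable_topology}"
  shows "has_ray_integral f I \<Longrightarrow> has_ray_integral (\<lambda>t. c * f t) (c * I)"
  by (auto simp: has_ray_integral_def)

lemma has_ray_integral_add:
  "has_ray_integral f I \<Longrightarrow> has_ray_integral g J \<Longrightarrow>
     has_ray_integral (\<lambda>t. f t + g t) (I + J)"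
  by (auto simp: has_ray_integral_def)

lemma has_ray_integral_norm:
  fixes f :: "real \<Rightarrow> 'a::{banach, second_countable_topology}"
  assumes "set_integrable lborel {0<..} f"
  shows "has_ray_integral (\<lambda>t. norm (f t)) (LBINT t:{0<..}. norm (f t))"
  using set_integrable_norm[OF assms] by (rule has_ray_integralI)

lemma ray_integral_mono:
  fixes f g :: "real \<Rightarrow> real"
  assumes "has_ray_integral f I" "has_ray_integral g J" "\<And>t. t > 0 \<Longrightarrow> f t \<le> g t"
  shows "I \<le> J"
  using assms set_integral_mono[of lborel "{0<..}" f g] unfolding has_ray_integral_def by auto

lemma set_integrable_ray_bound:
  fixes f :: "real \<Rightarrow> 'a::{banach, second_countable_topology}" and g :: "real \<Rightarrow> real"
  assumes "continuous_on {0<..} f" "set_integrable lborel {0<..} g"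
    and "\<And>t. t > 0 \<Longrightarrow> norm (f t) \<le> g t"
  shows "set_integrable lborel {0<..} f"
proof (rule set_integrable_bound[OF assms(2)])
  show "set_borel_measurable lborel {0<..} f"
    unfolding set_borel_measurable_def
    using borel_measurable_continuous_on_indicator[OF _ assms(1)] by simp
  show "AE x in lborel. x \<in> {0<..} \<longrightarrow> norm (f x) \<le> norm (g x)"
    using assms(3) by (intro AE_I2) (fastforce intro: order_trans)
qed

text \<open>Change of variables and the Gamma integral speak of the completed measure. For a Borel
  function, completion changes neither integrability nor the value, so facts can be carried over in
  both directions.\<close>

lemma has_ray_integral_iff_lebesgue:
  fixes f :: "real \<Rightarrow> 'a::euclidean_space"
  assumes "set_borel_measurable borel {0<..} f"
  shows "has_ray_integral f I \<longleftrightarrow>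
           f absolutely_integrable_on {0<..} \<and> integral {0<..} f = I"
proof -
  have m: "(\<lambda>x. indicator {0<..} x *\<^sub>R f x) \<in> borel_measurable lborel"
    using assms by (simp add: set_borel_measurable_def)
  have i: "set_integrable lborel {0<..} f \<longleftrightarrow> set_integrable lebesgue {0<..} f"
    unfolding set_integrable_def by (rule integrable_completion[symmetric, OF m])
  have e: "(LBINT t:{0<..}. f t) = (LINT t:{0<..}|lebesgue. f t)"
    unfolding set_lebesgue_integral_def by (rule integral_completion[symmetric, OF m])
  show ?thesis
    unfolding has_ray_integral_def i e
    using set_lebesgue_integral_eq_integral(2)[of "{0<..}" f] by metis
qed

section \<open>Substitutions in the ray integral\<close>

lemma has_ray_integral_substitution:
  fixes f :: "real \<Rightarrow> 'a::euclidean_space"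
  assumes f: "has_ray_integral f I"
    and der: "\<And>x. x > 0 \<Longrightarrow> (g has_field_derivative h x) (at x)"
    and inj: "inj_on g {0<..}" and img: "g ` {0<..} = {0<..}"
    and h: "continuous_on {0<..} h"
  shows "has_ray_integral (\<lambda>x. \<bar>h x\<bar> *\<^sub>R f (g x)) I"
proof -
  have m: "set_borel_measurable borel {0<..} f"
    using f borel_measurable_integrable
    unfolding has_ray_integral_def set_integrable_def set_borel_measurable_def by force
  have cg: "continuous_on {0<..} g"
    using der by (auto intro!: DERIV_isCont continuous_at_imp_continuous_on)
  \<comment> \<open>Off the ray \<open>g\<close> and \<open>h\<close> are replaced by 0, which makes
    them Borel measurable on the whole line; the indicator of the ray hides the change.\<close>
  have "(\<lambda>x. if x \<in> {0<..} then g x else 0) \<in> borel_measurable borel"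
    using cg by (intro borel_measurable_continuous_on_if) auto
  then have "(\<lambda>x. indicator {0<..} (if x \<in> {0<..} then g x else 0) *\<^sub>R
                f (if x \<in> {0<..} then g x else 0)) \<in> borel_measurable borel"
    by (rule measurable_compose[OF _ m[unfolded set_borel_measurable_def]])
  moreover have "(\<lambda>x. indicator {0<..} x *\<^sub>R h x) \<in> borel_measurable borel"
    using h by (intro borel_measurable_continuous_on_indicator) auto
  ultimately have "(\<lambda>x. \<bar>indicator {0<..} x *\<^sub>R h x\<bar> *\<^sub>R
             (indicator {0<..} (if x \<in> {0<..} then g x else 0) *\<^sub>R
                f (if x \<in> {0<..} then g x else 0))) \<in> borel_measurable borel"
    by measurable
  also have "(\<lambda>x. \<bar>indicator {0<..} x *\<^sub>R h x\<bar> *\<^sub>R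
             (indicator {0<..} (if x \<in> {0<..} then g x else 0) *\<^sub>R
                f (if x \<in> {0<..} then g x else 0))) =
             (\<lambda>x. indicator {0<..} x *\<^sub>R (\<bar>h x\<bar> *\<^sub>R f (g x)))"
    using img by (intro ext) (auto simp: indicator_def)
  finally have m': "set_borel_measurable borel {0<..} (\<lambda>x. \<bar>h x\<bar> *\<^sub>R f (g x))"
    by (simp add: set_borel_measurable_def)
  have "f absolutely_integrable_on g ` {0<..} \<and> integral (g ` {0<..}) f = I"
    using f unfolding img has_ray_integral_iff_lebesgue[OF m] .
  then show ?thesis
    unfolding has_ray_integral_iff_lebesgue[OF m']
    using has_absolute_integral_change_of_variables_real[of "{0<..}" g h f I]
      der inj by (auto intro: has_field_derivative_at_within)
qed

lemma has_ray_integral_scale: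
  fixes f :: "real \<Rightarrow> 'a::euclidean_space"
  assumes "has_ray_integral f I" "c > 0"
  shows "has_ray_integral (\<lambda>x. f (c * x)) (I /\<^sub>R c)"
proof -
  have "y \<in> (*) c ` {0<..}" if "y > 0" for y
    using that assms(2) by (intro image_eqI[of _ _ "y / c"]) auto
  then have img: "(*) c ` {0<..} = {0<..}" using assms(2) by auto
  have "has_ray_integral (\<lambda>x. \<bar>c\<bar> *\<^sub>R f (c * x)) I"
    using assms(2) img
    by (intro has_ray_integral_substitution[OF assms(1)])
       (auto intro!: derivative_eq_intros inj_onI)
  then have "has_ray_integral (\<lambda>x. (1/c) *\<^sub>R (c *\<^sub>R f (c * x))) ((1/c) *\<^sub>R I)"
    using assms(2) unfolding has_ray_integral_def by (auto simp del: scaleR_scaleR)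
  then show ?thesis using assms(2) by (simp add: divide_inverse)
qed

lemma has_ray_integral_inverse:
  fixes f :: "real \<Rightarrow> 'a::euclidean_space"
  assumes "has_ray_integral f I"
  shows "has_ray_integral (\<lambda>x. (1 / x\<^sup>2) *\<^sub>R f (1 / x)) I"
proof -
  have "y \<in> (\<lambda>x. 1 / x) ` {0<..}" if "y > 0" for y :: real
    using that by (intro image_eqI[of _ _ "1 / y"]) auto
  then have img: "(\<lambda>x::real. 1 / x) ` {0<..} = {0<..}" by auto
  have "has_ray_integral (\<lambda>x. \<bar>- 1 / x\<^sup>2\<bar> *\<^sub>R f (1 / x)) I"
    using img
    by (intro has_ray_integral_substitution[OF assms])
       (auto intro!: derivative_eq_intros inj_onI continuous_intros simp: power2_eq_square)
  then show ?thesis by simp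
qed

text \<open>Interchange of sum and integral. The majorants come with explicit integrals
  \<open>G i\<close>, so the main condition is the summability of a family of real numbers.
  Pointwise summability is asked for at every \<open>t > 0\<close>, so no exceptional null set has
  to be tracked.\<close>

lemma has_ray_integral_infsum:
  fixes f :: "'i \<Rightarrow> real \<Rightarrow> 'a::{banach, second_countable_topology}"
  assumes A: "countable A"
    and f: "\<And>i. i \<in> A \<Longrightarrow> has_ray_integral (f i) (I i)"
    and g: "\<And>i. i \<in> A \<Longrightarrow> has_ray_integral (g i) (G i)"
    and le: "\<And>i t. i \<in> A \<Longrightarrow> t > 0 \<Longrightarrow> norm (f i t) \<le> g i t"
    and G: "G summable_on A"
    and pt: "\<And>t. t > 0 \<Longrightarrow> (\<lambda>i. g i t) summable_on A"
  shows "has_ray_integral (\<lambda>t. \<Sum>\<^sub>\<infinity>i\<in>A. f i t) (\<Sum>\<^sub>\<infinity>i\<in>A. I i)"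
    and "(\<lambda>i. norm (I i)) summable_on A"
proof -
  have nI: "norm (I i) \<le> G i" if "i \<in> A" for i
  proof -
    have fi: "set_integrable lborel {0<..} (f i)" using f[OF that] by (simp add: has_ray_integral_def)
    have "norm (I i) \<le> (LBINT t:{0<..}. norm (f i t))"
      using set_integral_norm_bound[OF fi] f[OF that] by (simp add: has_ray_integral_def)
    also have "\<dots> \<le> G i"
      by (rule ray_integral_mono[OF has_ray_integral_norm[OF fi] g[OF that]])
         (use le[OF that] in auto)
    finally show ?thesis .
  qed
  show abs: "(\<lambda>i. norm (I i)) summable_on A"
    by (rule summable_on_comparison_test[OF G]) (use nI in auto)
  \<comment> \<open>The index set is embedded into the natural numbers, where the theorems on
    integrating series apply. Indices outside the range \<open>B\<close> get the term 0, since
    \<open>A\<close> may be finite.\<close>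
  define B where "B = to_nat_on A ` A"
  define e where "e = from_nat_into A"
  have inj: "inj_on (to_nat_on A) A" using A by (rule inj_on_to_nat_on)
  have e: "e (to_nat_on A i) = i" if "i \<in> A" for i
    using that A by (simp add: e_def)
  have sum_nat: "(\<lambda>n. if n \<in> B then h (e n) else 0) sums infsum h A"
    if "(\<lambda>i. norm (h i)) summable_on A" for h :: "'i \<Rightarrow> 'b::banach"
  proof -
    have "(h has_sum infsum h A) A"
      using abs_summable_summable[OF that] by simp
    then have "((\<lambda>i. (\<lambda>n. h (e n)) (to_nat_on A i)) has_sum infsum h A) A"
      by (subst has_sum_cong[where g = h]) (auto simp: e)
    then have "((\<lambda>n. h (e n)) has_sum infsum h A) B"
      unfolding B_def using has_sum_reindex[OF inj, of "\<lambda>n. h (e n)"] by (simp add: o_def)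
    then have "((\<lambda>n. if n \<in> B then h (e n) else 0) has_sum infsum h A) UNIV"
      by (subst has_sum_cong_neutral[where T = B and g = "\<lambda>n. h (e n)"]) auto
    then show ?thesis by (rule has_sum_imp_sums)
  qed
  define F where "F n t = (if n \<in> B then indicator {0<..} t *\<^sub>R f (e n) t else 0)" for n t
  have eA: "e n \<in> A" if "n \<in> B" for n using that e by (auto simp: B_def)
  have intF: "integrable lborel (F n)" for n
    using f[OF eA[of n]] by (cases "n \<in> B") (auto simp: F_def[abs_def] has_ray_integral_def set_integrable_def)
  have ptf: "(\<lambda>i. norm (f i t)) summable_on A" if "t > 0" for t
    by (rule summable_on_comparison_test[OF pt[OF that]]) (use le that in auto)
  have s1: "AE x in lborel. summable (\<lambda>n. norm (F n x))"
  proof (rule AE_I2)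
    fix x
    show "summable (\<lambda>n. norm (F n x))"
    proof (cases "x > 0")
      case True
      have "(\<lambda>n. norm (F n x)) = (\<lambda>n. if n \<in> B then norm (f (e n) x) else 0)"
        using True by (auto simp: F_def fun_eq_iff)
      then show ?thesis using sum_nat[of "\<lambda>i. norm (f i x)"] ptf[OF True] by (auto simp: sums_iff)
    next
      case False
      then have "(\<lambda>n. norm (F n x)) = (\<lambda>n. 0)" by (auto simp: F_def fun_eq_iff)
      then show ?thesis by simp
    qed
  qed
  have s2: "summable (\<lambda>n. \<integral>x. norm (F n x) \<partial>lborel)"
  proof (rule summable_comparison_test')
    have "0 \<le> G i" if "i \<in> A" for i using nI[OF that] norm_ge_zero order_trans by blast
    then have "(\<lambda>i. norm (G i)) summable_on A"
      by (subst summable_on_cong[where g = G]) (auto simp: G)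
    then show "summable (\<lambda>n. if n \<in> B then G (e n) else 0)"
      using sum_nat[of G] by (auto simp: sums_iff)
    fix n
    show "norm (\<integral>x. norm (F n x) \<partial>lborel) \<le> (if n \<in> B then G (e n) else 0)"
    proof (cases "n \<in> B")
      case True
      have fi: "set_integrable lborel {0<..} (f (e n))"
        using f[OF eA[OF True]] by (simp add: has_ray_integral_def)
      have "(\<integral>x. norm (F n x) \<partial>lborel) = (LBINT t:{0<..}. norm (f (e n) t))"
        unfolding set_lebesgue_integral_def F_def using True by (intro Bochner_Integration.integral_cong) auto
      also have "\<dots> \<le> G (e n)"
        by (rule ray_integral_mono[OF has_ray_integral_norm[OF fi] g[OF eA[OF True]]])
           (use le[OF eA[OF True]] in auto)
      finally show ?thesis using True by simp
    qed (simp add: F_def)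
  qed
  have sumF: "(\<Sum>n. F n t) = indicator {0<..} t *\<^sub>R (\<Sum>\<^sub>\<infinity>i\<in>A. f i t)" for t
  proof (cases "t > 0")
    case True
    then have "(\<lambda>n. F n t) = (\<lambda>n. if n \<in> B then f (e n) t else 0)"
      by (auto simp: F_def fun_eq_iff)
    then show ?thesis using sum_nat[of "\<lambda>i. f i t"] ptf[OF True] True by (auto simp: sums_iff)
  next
    case False
    then have "(\<lambda>n. F n t) = (\<lambda>n. 0)" by (auto simp: F_def fun_eq_iff)
    then show ?thesis using False by simp
  qed
  have "integrable lborel (\<lambda>t. \<Sum>n. F n t)"
    by (rule integrable_suminf[OF intF s1 s2])
  moreover have "(\<integral>t. (\<Sum>n. F n t) \<partial>lborel) = (\<Sum>n. \<integral>t. F n t \<partial>lborel)"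
    by (rule integral_suminf[OF intF s1 s2])
  moreover have "(\<integral>t. F n t \<partial>lborel) = (if n \<in> B then I (e n) else 0)" for n
    using f[OF eA[of n]] by (auto simp: F_def[abs_def] has_ray_integral_def set_lebesgue_integral_def)
  ultimately show "has_ray_integral (\<lambda>t. \<Sum>\<^sub>\<infinity>i\<in>A. f i t) (\<Sum>\<^sub>\<infinity>i\<in>A. I i)"
    using sum_nat[OF abs] unfolding sumF
    by (simp add: has_ray_integral_def set_integrable_def set_lebesgue_integral_def sums_iff)
qed

section \<open>Gamma and Beta integrals\<close>

lemma has_ray_integral_Gamma:
  assumes z: "Re z > 0" and c: "c > 0"
  shows "has_ray_integral (\<lambda>t. of_real t powr (z - 1) * of_real (exp (- (c * t))))
           (Gamma z * of_real c powr (- z))"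
proof -
  have "continuous_on {0<..} (\<lambda>t. complex_of_real t powr (z - 1) / of_real (exp t))"
    by (auto intro!: continuous_intros)
  then have m: "set_borel_measurable borel {0<..} (\<lambda>t. complex_of_real t powr (z - 1) / of_real (exp t))"
    unfolding set_borel_measurable_def by (intro borel_measurable_continuous_on_indicator) auto
  have "has_ray_integral (\<lambda>t. of_real t powr (z - 1) / of_real (exp t)) (Gamma z)"
    unfolding has_ray_integral_iff_lebesgue[OF m]
    using absolutely_integrable_Gamma_integral'[OF z] Gamma_integral_complex'[OF z]
    by (simp add: has_integral_iff)
  \<comment> \<open>Scaling puts a factor \<open>c powr (z - 1)\<close> into the integrand; the
    constant takes it out again.\<close>
  from has_ray_integral_cmult[OF has_ray_integral_scale[OF this c], of "of_real c powr (1 - z)"]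
  have "has_ray_integral
          (\<lambda>t. of_real c powr (1 - z) * (of_real (c * t) powr (z - 1) / of_real (exp (c * t))))
          (of_real c powr (1 - z) * (Gamma z /\<^sub>R c))" .
  also have "of_real c powr (1 - z) * (Gamma z /\<^sub>R c) = Gamma z * of_real c powr (- z)"
    using c by (simp add: powr_diff powr_minus scaleR_conv_of_real field_simps)
  finally show ?thesis
    by (rule has_ray_integral_cong[THEN iffD1, rotated])
       (use c in \<open>auto simp: powr_times_real powr_diff exp_minus field_simps\<close>)
qed

lemma has_ray_integral_Re:
  "has_ray_integral f I \<Longrightarrow> has_ray_integral (\<lambda>t. Re (f t)) (Re I)"
proof -
  assume f: "has_ray_integral f I"
  then have i: "integrable lborel (\<lambda>t. indicator {0<..} t *\<^sub>R f t)"
    by (simp add: has_ray_integral_def set_integrable_def)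
  show ?thesis
    using f integrable_Re[OF i] integral_Re[OF i]
    by (simp add: has_ray_integral_def set_integrable_def set_lebesgue_integral_def)
qed

lemma has_ray_integral_Gamma_real:
  assumes "x > 0" "c > 0"
  shows "has_ray_integral (\<lambda>t. t powr (x - 1) * exp (- (c * t))) (Gamma x * c powr (- x))"
proof -
  have "has_ray_integral (\<lambda>t. Re (of_real t powr (of_real x - 1) * of_real (exp (- (c * t)))))
          (Re (Gamma (of_real x) * of_real c powr (- of_real x)))"
    using assms by (intro has_ray_integral_Re has_ray_integral_Gamma) auto
  also have "Re (Gamma (of_real x) * of_real c powr (- of_real x)) = Gamma x * c powr (- x)"
    using assms powr_of_real[of c "- x"] by (simp add: Gamma_complex_of_real)
  finally show ?thesis
    by (rule has_ray_integral_cong[THEN iffD1, rotated])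
       (use powr_of_real[of _ "x - 1"] in simp)
qed

text \<open>Fubini with both inner integrals known beforehand: the integral of \<open>J\<close> is
  read off from that of \<open>I\<close>. Continuity on the open quadrant supplies joint
  measurability, and \<open>G0\<close> the absolute integrability in two variables.\<close>

lemma has_ray_integral_swap:
  fixes f :: "real \<Rightarrow> real \<Rightarrow> 'a::{banach, second_countable_topology}"
  assumes cont: "continuous_on ({0<..} \<times> {0<..}) (\<lambda>(x, y). f x y)"
    and I: "\<And>x. x > 0 \<Longrightarrow> has_ray_integral (f x) (I x)"
    and G: "\<And>x. x > 0 \<Longrightarrow> has_ray_integral (\<lambda>y. norm (f x y)) (G x)"
    and G0: "set_integrable lborel {0<..} G"
    and J: "\<And>y. y > 0 \<Longrightarrow> has_ray_integral (\<lambda>x. f x y) (J y)"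
    and K: "has_ray_integral I K"
  shows "has_ray_integral J K"
proof -
  define F where "F = (\<lambda>x y. indicator {0<..} x *\<^sub>R (indicator {0<..} y *\<^sub>R f x y))"
  have "(\<lambda>p. indicator ({0<..} \<times> {0<..}) p *\<^sub>R (\<lambda>(x, y). f x y) p) \<in> borel_measurable borel"
    using cont by (intro borel_measurable_continuous_on_indicator) (auto simp: borel_prod[symmetric])
  also have "(\<lambda>p. indicator ({0<..} \<times> {0<..}) p *\<^sub>R (\<lambda>(x, y). f x y) p) = case_prod F"
    by (auto simp: F_def indicator_def fun_eq_iff)
  finally have m: "case_prod F \<in> borel_measurable (lborel \<Otimes>\<^sub>M lborel)"
    by (simp add: lborel_prod)
  have "integrable lborel (F x)" for x
    using I[of x] by (cases "x > 0") (auto simp: F_def has_ray_integral_def set_integrable_def)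
  moreover have "(\<integral>y. norm (F x y) \<partial>lborel) = indicator {0<..} x *\<^sub>R G x" for x
  proof (cases "x > 0")
    case True
    then have "(\<integral>y. norm (F x y) \<partial>lborel) = (LBINT y:{0<..}. norm (f x y))"
      unfolding set_lebesgue_integral_def F_def by (intro Bochner_Integration.integral_cong) auto
    then show ?thesis using True G[OF True] by (simp add: has_ray_integral_def)
  qed (auto simp: F_def)
  ultimately have int: "integrable (lborel \<Otimes>\<^sub>M lborel) (case_prod F)"
    using G0 by (intro lborel_pair.Fubini_integrable[OF m]) (auto simp: set_integrable_def)
  have 1: "(\<integral>x. F x y \<partial>lborel) = indicator {0<..} y *\<^sub>R J y" for y
    using J[of y] unfolding F_def has_ray_integral_def set_lebesgue_integral_def
    by (cases "y > 0") (simp_all add: indicator_def)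
  have 2: "(\<integral>y. F x y \<partial>lborel) = indicator {0<..} x *\<^sub>R I x" for x
    using I[of x] unfolding F_def has_ray_integral_def set_lebesgue_integral_def
    by (cases "x > 0") simp_all
  have "integrable lborel (\<lambda>y. indicator {0<..} y *\<^sub>R J y)"
    using lborel_pair.integrable_snd[OF int] by (simp add: 1)
  moreover have "(\<integral>y. indicator {0<..} y *\<^sub>R J y \<partial>lborel) = (\<integral>x. indicator {0<..} x *\<^sub>R I x \<partial>lborel)"
    using lborel_pair.Fubini_integral[OF int] by (simp add: 1 2)
  ultimately show ?thesis
    using K by (simp add: has_ray_integral_def set_integrable_def set_lebesgue_integral_def)
qed

text \<open>Fubini for \<open>y\<^sup>p\<^sup>-\<^sup>1 x\<^sup>N\<^sup>-\<^sup>1 exp (- x (1 + y))\<close>, both inner integrals being Gamma integrals.\<close>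

lemma has_ray_integral_Beta:
  assumes p: "0 < Re p" "Re p < Re N"
  shows "has_ray_integral (\<lambda>t. of_real t powr (p - 1) * of_real (1 + t) powr (- N))
           (Gamma p * Gamma (N - p) / Gamma N)"
proof -
  define f :: "real \<Rightarrow> real \<Rightarrow> complex" where
    "f x y = of_real y powr (p - 1) * of_real x powr (N - 1) * of_real (exp (- (x * (1 + y))))" for x y
  have nz: "Gamma N \<noteq> 0" using p by (auto simp: Gamma_eq_zero_iff elim!: nonpos_Ints_cases)
  have I: "has_ray_integral (f x)
             (of_real x powr (N - 1) * of_real (exp (- x)) * (Gamma p * of_real x powr (- p)))"
    if "x > 0" for x
    by (rule has_ray_integral_cong[THEN iffD1, rotated,
          OF has_ray_integral_cmult[OF has_ray_integral_Gamma[OF p(1) that]]])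
       (simp add: f_def distrib_left exp_add exp_diff exp_minus field_simps)
  have G: "has_ray_integral (\<lambda>y. norm (f x y))
             (x powr (Re N - 1) * exp (- x) * (Gamma (Re p) * x powr (- Re p)))" if "x > 0" for x
    by (rule has_ray_integral_cong[THEN iffD1, rotated,
          OF has_ray_integral_cmult[OF has_ray_integral_Gamma_real[OF p(1) that]]])
       (use that in \<open>simp add: f_def norm_mult norm_divide norm_powr_real_powr distrib_left
          exp_add exp_diff exp_minus field_simps\<close>)
  have "has_ray_integral (\<lambda>x. x powr (Re N - 1) * exp (- x) * (Gamma (Re p) * x powr (- Re p)))
          (Gamma (Re p) * (Gamma (Re N - Re p) * 1 powr (- (Re N - Re p))))"
    using p
    by (intro has_ray_integral_cong[THEN iffD1, rotated,
          OF has_ray_integral_cmult[OF has_ray_integral_Gamma_real[of "Re N - Re p" 1]]])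
       (auto simp: powr_diff powr_minus powr_add field_simps)
  then have G0: "set_integrable lborel {0<..}
      (\<lambda>x. x powr (Re N - 1) * exp (- x) * (Gamma (Re p) * x powr (- Re p)))"
    by (simp add: has_ray_integral_def)
  have J: "has_ray_integral (\<lambda>x. f x y)
             (of_real y powr (p - 1) * (Gamma N * of_real (1 + y) powr (- N)))"
    if y: "y > 0" for y
    using p y
    by (intro has_ray_integral_cong[THEN iffD1, rotated,
          OF has_ray_integral_cmult[OF has_ray_integral_Gamma[of N "1 + y"]]])
       (auto simp: f_def mult_ac)
  have K: "has_ray_integral
     (\<lambda>x. of_real x powr (N - 1) * of_real (exp (- x)) * (Gamma p * of_real x powr (- p)))
     (Gamma p * (Gamma (N - p) * of_real 1 powr (- (N - p))))"
    using p
    by (intro has_ray_integral_cong[THEN iffD1, rotated,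
          OF has_ray_integral_cmult[OF has_ray_integral_Gamma[of "N - p" 1]]])
       (auto simp: powr_diff powr_minus powr_add field_simps)
  have cont: "continuous_on ({0<..} \<times> {0<..}) (\<lambda>(x, y). f x y)"
    unfolding f_def case_prod_unfold
    by (auto intro!: continuous_intros)
  have "has_ray_integral (\<lambda>y. of_real y powr (p - 1) * (Gamma N * of_real (1 + y) powr (- N)))
          (Gamma p * (Gamma (N - p) * of_real 1 powr (- (N - p))))"
    by (rule has_ray_integral_swap[OF cont I G G0 J K])
  from has_ray_integral_cmult[OF this, of "inverse (Gamma N)"] nz
  show ?thesis by (simp add: field_simps)
qed

text \<open>No contour with arcs is used. On the slit plane \<open>F\<close> has a primitive
  \<open>P\<close>, and \<open>D t = P (t \<zeta>) - P t\<close> has derivative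
  \<open>\<zeta> F (t \<zeta>) - F t\<close>. The mean value bound on the segment from
  \<open>t\<close> to \<open>t \<zeta>\<close> gives
  \<open>norm (D t) \<le> norm (\<zeta> - 1) * (t * \<beta> t)\<close>, so \<open>D\<close> tends to
  0 at both ends and its derivative integrates to 0.\<close>

lemma has_ray_integral_rotate:
  fixes F :: "complex \<Rightarrow> complex"
  assumes holo: "F holomorphic_on (- \<real>\<^sub>\<le>\<^sub>0)"
    and \<zeta>: "Re \<zeta> \<ge> 0" "\<zeta> \<noteq> 0"
    and int1: "has_ray_integral (\<lambda>t. F (of_real t)) I"
    and int2: "set_integrable lborel {0<..} (\<lambda>t. F (of_real t * \<zeta>))"
    and bound: "\<And>t z. t > 0 \<Longrightarrow> z \<in> closed_segment 1 \<zeta> \<Longrightarrow> norm (F (of_real t * z)) \<le> \<beta> t"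
    and lim0: "((\<lambda>t. t * \<beta> t) \<longlongrightarrow> 0) (at_right 0)"
    and limi: "((\<lambda>t. t * \<beta> t) \<longlongrightarrow> 0) at_top"
  shows "has_ray_integral (\<lambda>t. F (of_real t * \<zeta>)) (I / \<zeta>)"
proof -
  have eq: "\<real>\<^sub>\<le>\<^sub>0 = complex_of_real ` {..0}"
    by (auto simp: nonpos_Reals_def)
  have st: "starlike (- \<real>\<^sub>\<le>\<^sub>0 :: complex set)"
    unfolding eq by (rule starlike_slotted_complex_plane_left)
  have op: "open (- \<real>\<^sub>\<le>\<^sub>0 :: complex set)" by (simp add: open_Compl)
  have "\<exists>P. \<forall>z\<in>- \<real>\<^sub>\<le>\<^sub>0. (P has_field_derivative F z) (at z)"
    by (rule holomorphic_starlike_primitive[where k = "{}", OF _ st op])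
       (use holo op in \<open>auto simp: holomorphic_on_imp_continuous_on holomorphic_on_imp_differentiable_at\<close>)
  then obtain P where P: "\<And>z. z \<notin> \<real>\<^sub>\<le>\<^sub>0 \<Longrightarrow> (P has_field_derivative F z) (at z)" by auto
  have seg: "of_real t * z \<notin> \<real>\<^sub>\<le>\<^sub>0" if t: "t > 0" and z: "z \<in> closed_segment 1 \<zeta>" for t :: real and z
  proof -
    obtain u where u: "0 \<le> u" "u \<le> 1" "z = (1 - u) *\<^sub>R 1 + u *\<^sub>R \<zeta>"
      using z by (auto simp: in_segment)
    \<comment> \<open>Before the endpoint, the share \<open>1 - u\<close> of the point 1 makes the
      real part positive. The endpoint \<open>\<zeta>\<close> is nonzero with
      \<open>Re \<zeta> \<ge> 0\<close>, so it avoids the slit as well.\<close>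
    have "Re z > 0 \<or> Im z \<noteq> 0"
    proof (cases "u = 1")
      case True
      then show ?thesis using \<zeta> u by (auto simp: complex_eq_iff)
    next
      case False
      then have "Re z > 0" using u \<zeta> by (auto intro!: add_pos_nonneg)
      then show ?thesis ..
    qed
    then show ?thesis using t by (auto simp: complex_nonpos_Reals_iff mult_le_0_iff)
  qed
  have s1: "of_real t \<notin> (\<real>\<^sub>\<le>\<^sub>0 :: complex set)" and s2: "of_real t * \<zeta> \<notin> \<real>\<^sub>\<le>\<^sub>0" if "t > 0" for t :: real
    using seg[OF that, of 1] seg[OF that, of \<zeta>] by auto
  define D where "D t = P (of_real t * \<zeta>) - P (of_real t)" for t :: real
  have D: "(D has_vector_derivative (F (of_real t * \<zeta>) * \<zeta> - F (of_real t))) (at t)" if t: "t > 0" for t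
  proof -
    have "((\<lambda>t. P (of_real t * \<zeta>)) has_vector_derivative (of_real 1 * \<zeta>) * F (of_real t * \<zeta>)) (at t)"
      by (rule field_vector_diff_chain_at[where g = P, unfolded o_def])
         (use s2[OF t] in \<open>auto intro!: P derivative_eq_intros\<close>)
    moreover have "((\<lambda>t. P (of_real t)) has_vector_derivative of_real 1 * F (of_real t)) (at t)"
      by (rule field_vector_diff_chain_at[where g = P, unfolded o_def])
         (use s1[OF t] in \<open>auto intro!: P derivative_eq_intros\<close>)
    ultimately show ?thesis
      unfolding D_def[abs_def] by (auto intro!: derivative_eq_intros simp: mult_ac)
  qed
  have Dle: "norm (D t) \<le> norm (\<zeta> - 1) * (t * \<beta> t)" if t: "t > 0" for t
  proof -
    have "norm (P (of_real t * \<zeta>) - P (of_real t * 1)) \<le> \<beta> t * norm (of_real t * \<zeta> - of_real t * 1)"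
    proof (rule field_differentiable_bound[where S = "(*) (of_real t) ` closed_segment 1 \<zeta>"])
      show "convex ((*) (complex_of_real t) ` closed_segment 1 \<zeta>)"
        by (intro convex_linear_image) (auto simp: linear_times)
      show "(P has_field_derivative F z) (at z within (*) (of_real t) ` closed_segment 1 \<zeta>)"
        if "z \<in> (*) (of_real t) ` closed_segment 1 \<zeta>" for z
        using that seg[OF t] by (auto intro!: has_field_derivative_at_within P)
      show "norm (F z) \<le> \<beta> t" if "z \<in> (*) (of_real t) ` closed_segment 1 \<zeta>" for z
        using that bound[OF t] by auto
    qed auto
    also have "norm (of_real t * \<zeta> - of_real t * 1) = t * norm (\<zeta> - 1)"
    proof -
      have "of_real t * \<zeta> - of_real t * 1 = of_real t * (\<zeta> - 1)" by (simp add: algebra_simps)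
      then show ?thesis using t by (simp only: norm_mult norm_of_real)
    qed
    finally show ?thesis by (simp add: D_def mult_ac)
  qed
  have "(D \<longlongrightarrow> 0) (at_right 0)"
  proof (rule Lim_null_comparison)
    show "\<forall>\<^sub>F t in at_right 0. norm (D t) \<le> norm (\<zeta> - 1) * (t * \<beta> t)"
      using Dle by (auto simp: eventually_at_right_less intro: eventually_mono[OF eventually_at_right_less])
    show "((\<lambda>t. norm (\<zeta> - 1) * (t * \<beta> t)) \<longlongrightarrow> 0) (at_right 0)"
      using tendsto_mult_left[OF lim0] by force
  qed
  then have l0: "((D \<circ> real_of_ereal) \<longlongrightarrow> 0) (at_right (ereal 0))"
    unfolding ereal_tendsto_simps .
  have "(D \<longlongrightarrow> 0) at_top"
  proof (rule Lim_null_comparison)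
    show "\<forall>\<^sub>F t in at_top. norm (D t) \<le> norm (\<zeta> - 1) * (t * \<beta> t)"
      using Dle by (auto intro: eventually_mono[OF eventually_gt_at_top[of 0]])
    show "((\<lambda>t. norm (\<zeta> - 1) * (t * \<beta> t)) \<longlongrightarrow> 0) at_top"
      using tendsto_mult_left[OF limi] by force
  qed
  then have li: "((D \<circ> real_of_ereal) \<longlongrightarrow> 0) (at_left \<infinity>)"
    unfolding ereal_tendsto_simps .
  have cF: "isCont F z" if "z \<notin> \<real>\<^sub>\<le>\<^sub>0" for z
    using holo op that
    by (auto intro!: field_differentiable_imp_continuous_at holomorphic_on_imp_differentiable_at)
  have int: "set_integrable lborel {0<..} (\<lambda>t. F (of_real t * \<zeta>) * \<zeta> - F (of_real t))"
    using int1 int2 by (intro set_integral_diff set_integrable_mult_left) (auto simp: has_ray_integral_def)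
  have "(LBINT t=ereal 0..\<infinity>. F (of_real t * \<zeta>) * \<zeta> - F (of_real t)) = 0 - 0"
  proof (rule interval_integral_FTC_integrable[OF _ _ _ _ l0 li])
    show "isCont (\<lambda>t. F (of_real t * \<zeta>) * \<zeta> - F (of_real t)) t" if "ereal 0 < ereal t" for t
    proof -
      have t: "t > 0" using that by simp
      have "isCont (\<lambda>t. F (of_real t * \<zeta>)) t"
        by (rule isCont_o2[where g = F, OF _ cF]) (use s2[OF t] in \<open>auto intro!: continuous_intros\<close>)
      moreover have "isCont (\<lambda>t. F (of_real t)) t"
        by (rule isCont_o2[where g = F, OF _ cF]) (use s1[OF t] in \<open>auto intro!: continuous_intros\<close>)
      ultimately show ?thesis by (intro continuous_intros)
    qed
    have "einterval (ereal 0) \<infinity> = {0<..}" by (auto simp: einterval_def)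
    with int show "set_integrable lborel (einterval (ereal 0) \<infinity>) (\<lambda>t. F (of_real t * \<zeta>) * \<zeta> - F (of_real t))"
      by simp
  qed (use D in auto)
  then have "(LBINT t:{0<..}. F (of_real t * \<zeta>) * \<zeta> - F (of_real t)) = 0"
    unfolding zero_ereal_def[symmetric] interval_lebesgue_integral_0_infty by simp
  then have "(LBINT t:{0<..}. F (of_real t * \<zeta>) * \<zeta>) = I"
    using int1 int2 by (subst (asm) set_integral_diff) (auto simp: has_ray_integral_def)
  then show ?thesis
    using int2 \<zeta> by (auto simp: has_ray_integral_def field_simps)
qed

section \<open>Bounds for powers of linear factors, and rotation of their products\<close>

lemma set_integrable_real_Beta:
  fixes P N :: real
  assumes "0 < P" "P < N"
  shows "set_integrable lborel {0<..} (\<lambda>t. t powr (P - 1) * (1 + t) powr (- N))"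
proof -
  have "set_integrable lborel {0<..}
          (\<lambda>t. norm (of_real t powr (of_real P - 1) * complex_of_real (1 + t) powr (- of_real N)))"
    using has_ray_integral_Beta[of "of_real P" "of_real N"] assms
    by (intro set_integrable_norm) (auto simp: has_ray_integral_def)
  moreover have "norm (of_real t powr (of_real P - 1) * complex_of_real (1 + t) powr (- of_real N)) =
                   t powr (P - 1) * (1 + t) powr (- N)" if "t > 0" for t
    using that norm_powr_real_powr[of "complex_of_real (1 + t)" "- of_real N"]
    by (simp add: norm_mult norm_powr_real_powr)
  ultimately show ?thesis
    by (subst set_integrable_cong[OF refl refl, symmetric]) auto
qed

text \<open>The argument of \<open>w\<close> enters the modulus only through
  \<open>exp (Im \<alpha> * Arg w)\<close> and is bounded by \<pi>, which gives a constant uniform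
  in \<open>w\<close>.\<close>

lemma norm_powr_le:
  fixes w :: complex
  shows "norm (w powr - \<alpha>) \<le> exp (pi * \<bar>Im \<alpha>\<bar>) * norm w powr - Re \<alpha>"
proof -
  have "Im \<alpha> * Arg w \<le> \<bar>Im \<alpha>\<bar> * \<bar>Arg w\<bar>"
    using abs_ge_self[of "Im \<alpha> * Arg w"] by (simp only: abs_mult)
  also have "\<dots> \<le> \<bar>Im \<alpha>\<bar> * pi"
    using Arg_bounded[of w] by (intro mult_left_mono) auto
  finally have "exp (Im \<alpha> * Arg w) \<le> exp (pi * \<bar>Im \<alpha>\<bar>)"
    by (simp add: mult.commute)
  then show ?thesis
    unfolding norm_powr_complex using mult_left_mono[of _ _ "norm w powr - Re \<alpha>"]
    by (simp add: mult.commute)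
qed

text \<open>In the right half-plane the cross term \<open>2 * a * b * Re z\<close> of the squared
  modulus is nonnegative, so the two summands cannot cancel.\<close>

lemma norm_affine_ge:
  assumes "Re z \<ge> 0" "a \<ge> 0" "b \<ge> 0"
  shows "(a * norm z + b) / 2 \<le> norm (of_real a * z + of_real b)"
proof (rule power2_le_imp_le)
  have "((a * norm z + b) / 2)\<^sup>2 \<le> a\<^sup>2 * (norm z)\<^sup>2 + b\<^sup>2"
  proof -
    have "x\<^sup>2 + y\<^sup>2 - ((x + y) / 2)\<^sup>2 = ((x - y)\<^sup>2 + 2 * x\<^sup>2 + 2 * y\<^sup>2) / 4" for x y :: real
      by (simp add: power2_eq_square field_simps)
    then have "((x + y) / 2)\<^sup>2 \<le> x\<^sup>2 + y\<^sup>2" for x y :: real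
      by (smt (verit) divide_nonneg_pos zero_le_power2)
    from this[of "a * norm z" b] show ?thesis by (simp only: power_mult_distrib)
  qed
  also have "\<dots> \<le> a\<^sup>2 * (norm z)\<^sup>2 + b\<^sup>2 + 2 * (a * b * Re z)"
    using assms by simp
  also have "\<dots> = (norm (of_real a * z + of_real b))\<^sup>2"
    unfolding cmod_power2 by (simp add: power2_eq_square algebra_simps)
  finally show "((a * norm z + b) / 2)\<^sup>2 \<le> (norm (of_real a * z + of_real b))\<^sup>2" .
qed auto

text \<open>The sign of \<open>e\<close> decides which of the two bounds on \<open>x\<close>
  controls the power. Adding the two constants covers both cases, so later estimates need no
  distinction by the sign of an exponent.\<close>

lemma powr_between_le:
  fixes x s l u e :: real
  assumes "0 < l" "0 < s" "l * s \<le> x" "x \<le> u * s"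
  shows "x powr e \<le> (l powr e + u powr e) * s powr e"
proof -
  have x: "x > 0" using mult_pos_pos[OF assms(1,2)] assms(3) by linarith
  then have "0 < u * s" using assms by linarith
  then have u: "u > 0" using assms by (simp add: zero_less_mult_iff)
  show ?thesis
  proof (cases "e \<ge> 0")
    case True
    have "x powr e \<le> (u * s) powr e" using assms x True by (intro powr_mono2) auto
    also have "\<dots> = u powr e * s powr e" using assms u by (simp add: powr_mult)
    finally show ?thesis by (simp add: distrib_right add_increasing)
  next
    case False
    have "x powr e \<le> (l * s) powr e" using assms x False by (intro powr_mono2') auto
    also have "\<dots> = l powr e * s powr e" using assms by (simp add: powr_mult)
    finally show ?thesis by (simp add: distrib_right add_increasing2)
  qed
qed

text \<open>At \<open>z = \<i> t\<close>, with \<open>\<alpha> = s\<close> and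
  \<open>\<beta> = k - s\<close>, this is up to a constant factor the integrand of a matrix with
  positive entries, the power of the quotient being split between numerator and denominator. For
  positive entries it is holomorphic off the slit, so its ray of integration can be rotated.\<close>

definition lin_kernel ::
  "complex \<Rightarrow> complex \<Rightarrow> complex \<Rightarrow> real \<Rightarrow> real \<Rightarrow> real \<Rightarrow> real \<Rightarrow> complex \<Rightarrow> complex" where
  "lin_kernel p \<alpha> \<beta> a b c d z =
     z powr (p - 1) * (of_real a * z + of_real b) powr (- \<alpha>) * (of_real c * z + of_real d) powr (- \<beta>)"

lemma affine_notin_nonpos_Reals:
  fixes z :: complex
  assumes "z \<notin> \<real>\<^sub>\<le>\<^sub>0" "a > 0" "b > 0"
  shows "of_real a * z + of_real b \<notin> \<real>\<^sub>\<le>\<^sub>0"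
proof
  assume "of_real a * z + of_real b \<in> \<real>\<^sub>\<le>\<^sub>0"
  then have h: "a * Re z + b \<le> 0" "Im z = 0" using assms by (auto simp: complex_nonpos_Reals_iff)
  then have "a * Re z < 0" using assms by linarith
  then have "Re z \<le> 0" using assms by (auto simp: mult_less_0_iff)
  then show False using assms h by (auto simp: complex_nonpos_Reals_iff)
qed

lemma holomorphic_lin_kernel:
  assumes "a > 0" "b > 0" "c > 0" "d > 0"
  shows "lin_kernel p \<alpha> \<beta> a b c d holomorphic_on (- \<real>\<^sub>\<le>\<^sub>0)"
  unfolding lin_kernel_def[abs_def]
  using affine_notin_nonpos_Reals assms by (intro holomorphic_intros) auto

lemma zero_notin_closed_segment_right:
  assumes "Re \<zeta> \<ge> 0" "\<zeta> \<noteq> 0"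
  shows "0 \<notin> closed_segment 1 \<zeta>"
proof
  assume "0 \<in> closed_segment 1 \<zeta>"
  then obtain u where u: "0 \<le> u" "u \<le> 1" "0 = (1 - u) *\<^sub>R 1 + u *\<^sub>R \<zeta>" by (auto simp: in_segment)
  have "0 = (1 - u) + u * Re \<zeta>" using arg_cong[OF u(3), of Re] by simp
  moreover have "u * Re \<zeta> \<ge> 0" using u assms by simp
  ultimately have "u = 1" using u by linarith
  then show False using u assms by simp
qed

text \<open>On the segment \<open>norm z\<close> stays between positive bounds \<open>m\<close> and
  \<open>M\<close>, so both linear factors are comparable to \<open>1 + t\<close>. As
  \<open>C\<close> depends on neither \<open>t\<close> nor \<open>z\<close>, one estimate serves
  integrability on the rotated ray and the boundary limits of the rotation.\<close>

lemma lin_kernel_bound: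
  assumes abcd: "a > 0" "b > 0" "c > 0" "d > 0" and \<zeta>: "Re \<zeta> \<ge> 0" "\<zeta> \<noteq> 0"
  obtains C where "\<And>t z. t > 0 \<Longrightarrow> z \<in> closed_segment 1 \<zeta> \<Longrightarrow>
    norm (lin_kernel p \<alpha> \<beta> a b c d (of_real t * z)) \<le>
      C * (t powr (Re p - 1) * (1 + t) powr (- Re (\<alpha> + \<beta>)))"
proof -
  have "\<exists>m>0. \<forall>z\<in>closed_segment 1 \<zeta>. m \<le> dist 0 z"
    by (rule separate_point_closed[OF closed_segment zero_notin_closed_segment_right[OF \<zeta>]])
  then obtain m where m: "m > 0" "\<And>z. z \<in> closed_segment 1 \<zeta> \<Longrightarrow> m \<le> norm z"
    by (metis dist_0_norm)
  obtain M where M: "\<And>z. z \<in> closed_segment 1 \<zeta> \<Longrightarrow> norm z \<le> M"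
    using bounded_closed_segment[of 1 \<zeta>] unfolding bounded_iff by auto
  have aff: "\<exists>K. \<forall>t>0. \<forall>z\<in>closed_segment 1 \<zeta>.
      norm ((of_real a * (of_real t * z) + of_real b) powr (- \<gamma>)) \<le> K * (1 + t) powr (- Re \<gamma>)"
    if ab: "a > 0" "b > 0" for a b \<gamma>
  proof (intro exI allI impI ballI)
    fix t :: real and z assume t: "t > 0" and z: "z \<in> closed_segment 1 \<zeta>"
    let ?w = "of_real a * (of_real t * z) + complex_of_real b"
    obtain u where u: "0 \<le> u" "u \<le> 1" "z = (1 - u) *\<^sub>R 1 + u *\<^sub>R \<zeta>"
      using z by (auto simp: in_segment)
    then have Rz: "Re z \<ge> 0" using \<zeta> by simp
    \<comment> \<open>The largest constant with both \<open>a * m \<ge> l\<close> and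
      \<open>b \<ge> l\<close>, so that \<open>a * m * t + b \<ge> l * (1 + t)\<close>.\<close>
    define l where "l = min (a * m) b"
    have "l * t \<le> a * m * t" using t by (intro mult_right_mono) (auto simp: l_def)
    also have "a * m * t \<le> a * t * norm z" using m(2)[OF z] t ab by (simp add: mult_ac)
    finally have le: "l + l * t \<le> a * t * norm z + b" by (simp add: l_def)
    have e1: "a * norm (of_real t * z) + b = a * t * norm z + b"
      using t by (simp add: norm_mult)
    have e2: "l / 2 * (1 + t) = (l + l * t) / 2"
      by (simp add: distrib_left add_divide_distrib)
    have "min (a * m) b / 2 * (1 + t) \<le> (a * norm (of_real t * z) + b) / 2"
      unfolding l_def[symmetric] e1 e2 by (intro divide_right_mono le) simp
    also have "\<dots> \<le> norm ?w"
      using Rz t ab by (intro norm_affine_ge) auto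
    finally have l: "min (a * m) b / 2 * (1 + t) \<le> norm ?w" .
    have "norm ?w \<le> a * t * norm z + b"
      using t ab by (intro norm_triangle_le) (simp add: norm_mult)
    also have "\<dots> \<le> a * t * M + b" using M[OF z] t ab by simp
    also have "\<dots> \<le> (a * M + b) * (1 + t)"
    proof -
      have "M \<ge> 0" using M[OF z] norm_ge_zero order_trans by blast
      then show ?thesis using t ab by (simp add: algebra_simps)
    qed
    finally have "norm ?w powr (- Re \<gamma>) \<le>
      ((min (a * m) b / 2) powr (- Re \<gamma>) + (a * M + b) powr (- Re \<gamma>)) * (1 + t) powr (- Re \<gamma>)"
      using t m ab l by (intro powr_between_le) auto
    then have "exp (pi * \<bar>Im \<gamma>\<bar>) * norm ?w powr (- Re \<gamma>) \<le> exp (pi * \<bar>Im \<gamma>\<bar>) *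
      (((min (a * m) b / 2) powr (- Re \<gamma>) + (a * M + b) powr (- Re \<gamma>)) * (1 + t) powr (- Re \<gamma>))"
      by (intro mult_left_mono) auto
    then show "norm (?w powr (- \<gamma>)) \<le> (exp (pi * \<bar>Im \<gamma>\<bar>) *
      ((min (a * m) b / 2) powr (- Re \<gamma>) + (a * M + b) powr (- Re \<gamma>))) * (1 + t) powr (- Re \<gamma>)"
      using norm_powr_le[of ?w \<gamma>] unfolding mult.assoc by (rule order_trans[rotated])
  qed
  have pw: "norm ((of_real t * z) powr (p - 1)) \<le>
      (exp (pi * \<bar>Im p\<bar>) * (m powr (Re p - 1) + M powr (Re p - 1))) * t powr (Re p - 1)"
    if t: "t > 0" and z: "z \<in> closed_segment 1 \<zeta>" for t z
  proof -
    have "norm (of_real t * z) powr (Re p - 1) \<le> (m powr (Re p - 1) + M powr (Re p - 1)) * t powr (Re p - 1)"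
      using t m(1) m(2)[OF z] M[OF z] by (intro powr_between_le) (auto simp: norm_mult mult.commute)
    then have "exp (pi * \<bar>Im p\<bar>) * norm (of_real t * z) powr (Re p - 1) \<le>
       exp (pi * \<bar>Im p\<bar>) * ((m powr (Re p - 1) + M powr (Re p - 1)) * t powr (Re p - 1))"
      by (intro mult_left_mono) auto
    moreover have "norm ((of_real t * z) powr (p - 1)) \<le>
        exp (pi * \<bar>Im p\<bar>) * norm (of_real t * z) powr (Re p - 1)"
      using norm_powr_le[of "of_real t * z" "1 - p"] by simp
    ultimately show ?thesis unfolding mult.assoc by (rule order_trans[rotated])
  qed
  obtain K1 where K1: "\<And>t z. t > 0 \<Longrightarrow> z \<in> closed_segment 1 \<zeta> \<Longrightarrow>
      norm ((of_real a * (of_real t * z) + of_real b) powr (- \<alpha>)) \<le> K1 * (1 + t) powr (- Re \<alpha>)"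
    using aff[of a b \<alpha>] abcd by blast
  obtain K2 where K2: "\<And>t z. t > 0 \<Longrightarrow> z \<in> closed_segment 1 \<zeta> \<Longrightarrow>
      norm ((of_real c * (of_real t * z) + of_real d) powr (- \<beta>)) \<le> K2 * (1 + t) powr (- Re \<beta>)"
    using aff[of c d \<beta>] abcd by blast
  define K0 where "K0 = exp (pi * \<bar>Im p\<bar>) * (m powr (Re p - 1) + M powr (Re p - 1))"
  show ?thesis
  proof (rule that[of "K0 * K1 * K2"])
    fix t z assume t: "t > (0::real)" and z: "z \<in> closed_segment 1 \<zeta>"
    have "norm (lin_kernel p \<alpha> \<beta> a b c d (of_real t * z)) \<le>
      (K0 * t powr (Re p - 1)) * (K1 * (1 + t) powr (- Re \<alpha>)) * (K2 * (1 + t) powr (- Re \<beta>))"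
      unfolding lin_kernel_def norm_mult
      using pw[OF t z, folded K0_def] K1[OF t z] K2[OF t z]
      by (intro mult_mono') auto
    also have "\<dots> = K0 * K1 * K2 * (t powr (Re p - 1) * (1 + t) powr (- Re (\<alpha> + \<beta>)))"
    proof -
      have "(1 + t) powr (- Re (\<alpha> + \<beta>)) = (1 + t) powr (- Re \<alpha>) * (1 + t) powr (- Re \<beta>)"
        by (simp add: powr_add[symmetric])
      then show ?thesis by (simp only: mult_ac)
    qed
    finally show "norm (lin_kernel p \<alpha> \<beta> a b c d (of_real t * z)) \<le> \<dots>" .
  qed
qed

lemma set_integrable_lin_kernel:
  assumes abcd: "a > 0" "b > 0" "c > 0" "d > 0" and \<zeta>: "Re \<zeta> \<ge> 0" "\<zeta> \<noteq> 0"
    and p: "0 < Re p" "Re p < Re (\<alpha> + \<beta>)"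
  shows "set_integrable lborel {0<..} (\<lambda>t. lin_kernel p \<alpha> \<beta> a b c d (of_real t * \<zeta>))"
proof -
  obtain C where C: "\<And>t z. t > 0 \<Longrightarrow> z \<in> closed_segment 1 \<zeta> \<Longrightarrow>
    norm (lin_kernel p \<alpha> \<beta> a b c d (of_real t * z)) \<le>
      C * (t powr (Re p - 1) * (1 + t) powr (- Re (\<alpha> + \<beta>)))"
    using lin_kernel_bound[OF abcd \<zeta>] by blast
  have cont: "continuous_on {0<..} (\<lambda>t. lin_kernel p \<alpha> \<beta> a b c d (of_real t * \<zeta>))"
  proof (rule continuous_on_compose2[OF holomorphic_on_imp_continuous_on[OF holomorphic_lin_kernel[OF abcd]]])
    show "(\<lambda>t. complex_of_real t * \<zeta>) ` {0<..} \<subseteq> - \<real>\<^sub>\<le>\<^sub>0"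
      using \<zeta> by (auto simp: complex_nonpos_Reals_iff mult_le_0_iff complex_eq_iff)
  qed (intro continuous_intros)
  show ?thesis
    using C[of _ \<zeta>] p
    by (intro set_integrable_ray_bound[OF cont, of
          "\<lambda>t. C * (t powr (Re p - 1) * (1 + t) powr (- Re (\<alpha> + \<beta>)))"]
        set_integrable_mult_right set_integrable_real_Beta) auto
qed

text \<open>Here \<open>t\<close> times the bound behaves like \<open>t powr P\<close> at 0 and like
  \<open>t powr (P - N)\<close> at infinity, so the condition on \<open>Re p\<close> makes both
  boundary limits vanish.\<close>

lemma has_ray_integral_lin_kernel_rotate:
  assumes abcd: "a > 0" "b > 0" "c > 0" "d > 0" and \<zeta>: "Re \<zeta> \<ge> 0" "\<zeta> \<noteq> 0"
    and p: "0 < Re p" "Re p < Re (\<alpha> + \<beta>)"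
    and J: "has_ray_integral (\<lambda>t. lin_kernel p \<alpha> \<beta> a b c d (of_real t)) J"
  shows "has_ray_integral (\<lambda>t. lin_kernel p \<alpha> \<beta> a b c d (of_real t * \<zeta>)) (J / \<zeta>)"
proof -
  obtain C where C: "\<And>t z. t > 0 \<Longrightarrow> z \<in> closed_segment 1 \<zeta> \<Longrightarrow>
    norm (lin_kernel p \<alpha> \<beta> a b c d (of_real t * z)) \<le>
      C * (t powr (Re p - 1) * (1 + t) powr (- Re (\<alpha> + \<beta>)))"
    using lin_kernel_bound[OF abcd \<zeta>] by blast
  define P N where "P = Re p" and "N = Re (\<alpha> + \<beta>)"
  have PN: "0 < P" "P < N" using p by (auto simp: P_def N_def)
  have eq: "\<forall>\<^sub>F t in F. C * (t powr P * (1 + t) powr (- N)) = t * (C * (t powr (P - 1) * (1 + t) powr (- N)))"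
    if "\<forall>\<^sub>F t in F. t > 0" for F
    using that by eventually_elim (auto simp: powr_diff field_simps)
  have "((\<lambda>t::real. t powr P * (1 + t) powr (- N)) \<longlongrightarrow> 0) (at_right 0)"
  proof (rule tendsto_eq_rhs[OF tendsto_mult])
    show "((\<lambda>t. t powr P) \<longlongrightarrow> 0 powr P) (at_right 0)"
      using PN by (intro tendsto_powr2) (auto intro: tendsto_intros eventually_mono[OF eventually_at_right_less])
    show "((\<lambda>t::real. (1 + t) powr (- N)) \<longlongrightarrow> (1 + 0) powr (- N)) (at_right 0)"
      by (intro tendsto_intros) auto
  qed auto
  from tendsto_mult_right_zero[OF this, of C]
  have lim0: "((\<lambda>t. t * (C * (t powr (P - 1) * (1 + t) powr (- N)))) \<longlongrightarrow> 0) (at_right 0)"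
    by (rule Lim_transform_eventually[OF _ eq]) (rule eventually_at_right_less)
  have "((\<lambda>t::real. t powr P * (1 + t) powr (- N)) \<longlongrightarrow> 0) at_top"
  proof (rule Lim_null_comparison)
    show "\<forall>\<^sub>F t::real in at_top. norm (t powr P * (1 + t) powr (- N)) \<le> t powr (P - N)"
      using eventually_gt_at_top[of 0]
    proof eventually_elim
      case (elim t)
      have "(1 + t) powr (- N) \<le> t powr (- N)" using elim PN by (intro powr_mono2') auto
      then have "t powr P * (1 + t) powr (- N) \<le> t powr P * t powr (- N)" by (intro mult_left_mono) auto
      then show ?case using elim by (simp add: powr_add[symmetric])
    qed
    show "((\<lambda>t::real. t powr (P - N)) \<longlongrightarrow> 0) at_top"
      using PN by (intro tendsto_neg_powr) (auto simp: filterlim_ident)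
  qed
  from tendsto_mult_right_zero[OF this, of C]
  have limi: "((\<lambda>t. t * (C * (t powr (P - 1) * (1 + t) powr (- N)))) \<longlongrightarrow> 0) at_top"
    by (rule Lim_transform_eventually[OF _ eq]) (rule eventually_gt_at_top)
  show ?thesis
    by (rule has_ray_integral_rotate[OF holomorphic_lin_kernel[OF abcd] \<zeta> J
          set_integrable_lin_kernel[OF abcd \<zeta> p] C[folded P_def N_def] lim0 limi])
qed

section \<open>The Lipschitz summation formula\<close>

text \<open>Both sides come from the derivative of
  \<open>Gamma z * Gamma (1 - z) = pi / sin (pi z)\<close>, after division by this nonzero
  function.\<close>

lemma Digamma_reflection:
  fixes z :: complex
  assumes "z \<notin> \<int>"
  shows "Digamma (1 - z) - Digamma z = of_real pi * cot (of_real pi * z)"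
proof -
  have z': "1 - z \<notin> \<int>" using assms Ints_diff[of 1 "1 - z"] by auto
  have nz: "z \<notin> \<int>\<^sub>\<le>\<^sub>0" "1 - z \<notin> \<int>\<^sub>\<le>\<^sub>0" using assms z' nonpos_Ints_subset_Ints by auto
  have s: "sin (of_real pi * z) \<noteq> 0" using assms by (subst sin_eq_0) auto
  have "((\<lambda>z. Gamma z * Gamma (1 - z)) has_field_derivative
          Gamma z * Gamma (1 - z) * (Digamma z - Digamma (1 - z))) (at z)"
    using nz by (auto intro!: derivative_eq_intros simp: algebra_simps)
  moreover have "((\<lambda>z. Gamma z * Gamma (1 - z)) has_field_derivative
          (of_real pi / sin (of_real pi * z)) * (- (of_real pi * cot (of_real pi * z)))) (at z)"
    unfolding Gamma_reflection_complex
    using s by (auto intro!: derivative_eq_intros simp: cot_def power2_eq_square)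
  ultimately have "Gamma z * Gamma (1 - z) * (Digamma z - Digamma (1 - z)) =
       (of_real pi / sin (of_real pi * z)) * (- (of_real pi * cot (of_real pi * z)))"
    by (rule DERIV_unique)
  then have "(of_real pi / sin (of_real pi * z)) * (Digamma z - Digamma (1 - z)) =
       (of_real pi / sin (of_real pi * z)) * (- (of_real pi * cot (of_real pi * z)))"
    unfolding Gamma_reflection_complex .
  then have "Digamma z - Digamma (1 - z) = - (of_real pi * cot (of_real pi * z))"
    by (subst (asm) mult_cancel_left) (use s in auto)
  then show ?thesis by (simp add: algebra_simps)
qed

text \<open>Induction on \<open>n\<close>: the operator that differentiates in \<open>w\<close> and
  multiplies by \<open>w\<close> brings down one factor \<open>m\<close>, and differentiation keeps
  the power series convergent in the unit disc.\<close>

lemma summable_of_nat_power_mult_power: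
  fixes w :: complex
  assumes "norm w < 1"
  shows "summable (\<lambda>m. of_nat m ^ n * w ^ m)"
  using assms
proof (induction n arbitrary: w)
  case (Suc n)
  have "summable (\<lambda>m. diffs (\<lambda>m. of_nat m ^ n) m * w ^ m)"
    by (rule termdiff_converges[OF Suc.prems Suc.IH])
  then have "summable (\<lambda>m. w * (diffs (\<lambda>m. of_nat m ^ n) m * w ^ m))" by (rule summable_mult)
  also have "(\<lambda>m. w * (diffs (\<lambda>m. of_nat m ^ n) m * w ^ m)) = (\<lambda>m. of_nat (Suc m) ^ Suc n * w ^ Suc m)"
    by (auto simp: diffs_def)
  finally show ?case by (subst (asm) summable_Suc_iff)
qed (auto intro: summable_geometric)

text \<open>The exponential series of the Lipschitz formula with exponent \<open>n + 1\<close>. At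
  \<open>n = 0\<close> the term \<open>m = 0\<close> is 1, not 0, because \<open>0 ^ 0 = 1\<close>;
  this fixes the sign of the constant in the cotangent expansion.\<close>

definition power_geom_sum :: "nat \<Rightarrow> complex \<Rightarrow> complex" where
  "power_geom_sum n z = (\<Sum>m. of_nat m ^ n * exp (2 * of_real pi * \<i> * z) ^ m)"

lemma norm_exp_upper_half_plane:
  "Im z > 0 \<Longrightarrow> norm (exp (2 * of_real pi * \<i> * z)) < 1"
  by simp

lemma has_field_derivative_power_geom_sum:
  assumes z: "Im z > 0"
  shows "(power_geom_sum n has_field_derivative 2 * of_real pi * \<i> * power_geom_sum (Suc n) z) (at z)"
proof -
  define w where "w = exp (2 * of_real pi * \<i> * z)"
  have w: "norm w < 1" unfolding w_def by (rule norm_exp_upper_half_plane[OF z])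
  have "w * (\<Sum>m. diffs (\<lambda>m. of_nat m ^ n) m * w ^ m) = (\<Sum>m. of_nat (Suc m) ^ Suc n * w ^ Suc m)"
    using termdiff_converges[OF w summable_of_nat_power_mult_power, of n]
    by (subst suminf_mult[symmetric]) (auto simp: diffs_def intro!: suminf_cong)
  also have "\<dots> = (\<Sum>m. of_nat m ^ Suc n * w ^ m)"
    by (subst suminf_split_head[OF summable_of_nat_power_mult_power[OF w]]) simp
  finally have eq: "w * (\<Sum>m. diffs (\<lambda>m. of_nat m ^ n) m * w ^ m) = power_geom_sum (Suc n) z"
    by (simp add: power_geom_sum_def w_def)
  have "((\<lambda>z. \<Sum>m. of_nat m ^ n * z ^ m) has_field_derivative (\<Sum>m. diffs (\<lambda>m. of_nat m ^ n) m * w ^ m)) (at w)"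
    by (rule termdiffs_strong'[OF summable_of_nat_power_mult_power w])
  moreover have "((\<lambda>z. exp (2 * of_real pi * \<i> * z)) has_field_derivative w * (2 * of_real pi * \<i>)) (at z)"
    unfolding w_def by (auto intro!: derivative_eq_intros)
  ultimately have "((\<lambda>z. \<Sum>m. of_nat m ^ n * exp (2 * of_real pi * \<i> * z) ^ m) has_field_derivative
      (\<Sum>m. diffs (\<lambda>m. of_nat m ^ n) m * w ^ m) * (w * (2 * of_real pi * \<i>))) (at z)"
    unfolding w_def by (rule DERIV_chain2)
  also have "(\<Sum>m. diffs (\<lambda>m. of_nat m ^ n) m * w ^ m) * (w * (2 * of_real pi * \<i>)) =
      2 * of_real pi * \<i> * power_geom_sum (Suc n) z"
    unfolding eq[symmetric] by (simp only: mult_ac)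
  finally show ?thesis unfolding power_geom_sum_def[abs_def] .
qed

lemma pi_cot_eq_power_geom_sum:
  assumes z: "Im z > 0"
  shows "of_real pi * cot (of_real pi * z) = - 2 * of_real pi * \<i> * power_geom_sum 0 z + of_real pi * \<i>"
proof -
  define w where "w = exp (2 * of_real pi * \<i> * z)"
  define e where "e = exp (of_real pi * \<i> * z)"
  have w: "norm w < 1" unfolding w_def by (rule norm_exp_upper_half_plane[OF z])
  have e: "e \<noteq> 0" by (simp add: e_def)
  have we: "w = e * e" unfolding w_def e_def exp_add[symmetric] by (rule arg_cong[of _ _ exp]) simp
  have w1: "w \<noteq> 1" "e * e \<noteq> 1" using w we by auto
  have sc: "sin (of_real pi * z) = - \<i> / 2 * (e - 1 / e)" "cos (of_real pi * z) = (e + 1 / e) / 2"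
    using cis_conv_exp unfolding sin_exp_eq cos_exp_eq e_def exp_minus
    by (auto simp: exp_minus field_simps)
  have "cot (of_real pi * z) = \<i> * (w + 1) / (w - 1)"
    unfolding cot_def sc we using e w1 by (simp add: field_simps)
  moreover have "power_geom_sum 0 z = 1 / (1 - w)"
    using suminf_geometric[OF w] by (simp add: power_geom_sum_def w_def)
  ultimately show ?thesis
    by (simp only:) (use w1 in \<open>simp add: field_simps\<close>)
qed

lemma Im_pos_notin_Ints: "Im z > 0 \<Longrightarrow> z \<notin> \<int>"
  by (auto elim!: Ints_cases)

text \<open>Repeated differentiation of the cotangent expansion. For \<open>n > 0\<close> the two
  Polygamma values are, up to sign and \<open>fact n\<close>, the halves of the sum of
  \<open>1 / (z + j) ^ (n + 1)\<close> over all integers \<open>j\<close>. The constant disappears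
  with the first derivative.\<close>

lemma Polygamma_reflection:
  assumes z: "Im z > 0"
  shows "(-1) ^ Suc n * Polygamma n z + Polygamma n (1 - z) =
           (- 2 * of_real pi * \<i>) ^ Suc n * power_geom_sum n z + (if n = 0 then of_real pi * \<i> else 0)"
  using z
proof (induction n arbitrary: z)
  case 0
  then show ?case
    using Digamma_reflection[OF Im_pos_notin_Ints] pi_cot_eq_power_geom_sum[of z] by simp
next
  case (Suc n)
  have z1: "z \<notin> \<int>" by (rule Im_pos_notin_Ints[OF Suc.prems])
  then have "1 - z \<notin> \<int>" using Ints_diff[of 1 "1 - z"] by auto
  with z1 have nz: "z \<notin> \<int>\<^sub>\<le>\<^sub>0" "1 - z \<notin> \<int>\<^sub>\<le>\<^sub>0" using nonpos_Ints_subset_Ints by auto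
  define c :: complex where "c = (if n = 0 then of_real pi * \<i> else 0)"
  let ?F = "\<lambda>z. (-1) ^ Suc n * Polygamma n z + Polygamma n (1 - z)"
  have "(?F has_field_derivative
          ((-1) ^ Suc n * Polygamma (Suc n) z - Polygamma (Suc n) (1 - z))) (at z)"
    using nz by (auto intro!: derivative_eq_intros DERIV_chain2[OF has_field_derivative_Polygamma])
  moreover have "(?F has_field_derivative
          ((- 2 * of_real pi * \<i>) ^ Suc n * (2 * of_real pi * \<i> * power_geom_sum (Suc n) z))) (at z)"
  proof (rule has_field_derivative_transform_within_open)
    show "((\<lambda>z. (- 2 * of_real pi * \<i>) ^ Suc n * power_geom_sum n z + c) has_field_derivative
          ((- 2 * of_real pi * \<i>) ^ Suc n * (2 * of_real pi * \<i> * power_geom_sum (Suc n) z))) (at z)"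
      using has_field_derivative_power_geom_sum[OF Suc.prems]
      by (auto intro!: derivative_eq_intros)
    show "open {z. Im z > 0}" by (rule open_halfspace_Im_gt)
    show "z \<in> {z. Im z > 0}" using Suc.prems by simp
    show "(- 2 * of_real pi * \<i>) ^ Suc n * power_geom_sum n z + c = ?F z" if "z \<in> {z. Im z > 0}" for z
      using Suc.IH[of z] that by (simp add: c_def)
  qed
  ultimately have "(-1) ^ Suc n * Polygamma (Suc n) z - Polygamma (Suc n) (1 - z) =
     (- 2 * of_real pi * \<i>) ^ Suc n * (2 * of_real pi * \<i> * power_geom_sum (Suc n) z)"
    by (rule DERIV_unique)
  then have "- ((-1) ^ Suc n * Polygamma (Suc n) z - Polygamma (Suc n) (1 - z)) =
     - ((- 2 * of_real pi * \<i>) ^ Suc n * (2 * of_real pi * \<i> * power_geom_sum (Suc n) z))"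
    by (simp only:)
  then show ?case by (simp add: mult_ac add_ac)
qed

section \<open>Series over the integers and the formula for integer exponents\<close>

lemma has_sum_int_split:
  fixes f :: "int \<Rightarrow> 'a::{topological_comm_monoid_add, t2_space}"
  assumes "((\<lambda>n. f (int n)) has_sum a) UNIV" "((\<lambda>n. f (- int (Suc n))) has_sum b) UNIV"
  shows "(f has_sum (a + b)) UNIV"
proof -
  have 1: "(f has_sum a) (range int)"
    using assms(1) by (subst has_sum_reindex) (auto simp: o_def inj_def)
  have 2: "(f has_sum b) (range (\<lambda>n. - int (Suc n)))"
    using assms(2) by (subst has_sum_reindex) (auto simp: o_def inj_def)
  have un: "range int \<union> range (\<lambda>n. - int (Suc n)) = UNIV"
  proof -
    have "x \<in> range int \<union> range (\<lambda>n. - int (Suc n))" for x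
    proof (cases "x \<ge> 0")
      case True
      then have "x = int (nat x)" by simp
      then show ?thesis by blast
    next
      case False
      then have "x = - int (Suc (nat (- x - 1)))" by simp
      then show ?thesis by blast
    qed
    then show ?thesis by blast
  qed
  have "range int \<inter> range (\<lambda>n. - int (Suc n)) = {}" by auto
  from has_sum_Un_disjoint[OF 1 2 this] show ?thesis unfolding un .
qed

lemma summable_on_Suc_powr:
  assumes "\<sigma> > (1::real)"
  shows "(\<lambda>n. real (Suc n) powr - \<sigma>) summable_on UNIV"
proof -
  have "summable (\<lambda>n. real n powr - \<sigma>)" using assms by (subst summable_real_powr_iff) auto
  then have "summable (\<lambda>n. real (Suc n) powr - \<sigma>)" by (subst summable_Suc_iff)
  then show ?thesis by (subst summable_on_UNIV_nonneg_real_iff) auto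
qed

lemma summable_on_int_powr:
  assumes "\<sigma> > (1::real)" "u > 0"
  shows "(\<lambda>n::int. (u + \<bar>of_int n\<bar>) powr - \<sigma>) summable_on UNIV"
proof -
  have s: "(\<lambda>n. (u + real (Suc n)) powr - \<sigma>) summable_on UNIV"
    by (rule summable_on_comparison_test[OF summable_on_Suc_powr[OF assms(1)]])
       (use assms in \<open>auto intro!: powr_mono2'\<close>)
  then have "summable (\<lambda>n. (u + real (Suc n)) powr - \<sigma>)"
    by (rule summable_on_imp_summable)
  then have "summable (\<lambda>n. (u + real n) powr - \<sigma>)" by (subst (asm) summable_Suc_iff)
  then have s0: "(\<lambda>n. (u + real n) powr - \<sigma>) summable_on UNIV"
    by (subst summable_on_UNIV_nonneg_real_iff) auto
  have "((\<lambda>n::int. (u + \<bar>of_int n\<bar>) powr - \<sigma>) has_sum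
          ((\<Sum>\<^sub>\<infinity>n. (u + real n) powr - \<sigma>) + (\<Sum>\<^sub>\<infinity>n. (u + real (Suc n)) powr - \<sigma>))) UNIV"
    using has_sum_infsum[OF s] has_sum_infsum[OF s0]
    by (intro has_sum_int_split) (auto simp: abs_if algebra_simps)
  then show ?thesis by (rule has_sum_imp_summable)
qed

text \<open>With \<open>z = \<i> u\<close>, the Polygamma series at \<open>z\<close> and
  \<open>1 - z\<close> cover the indices \<open>k \<ge> 0\<close> and \<open>k < 0\<close>.
  Multiplication by \<open>\<i> ^ N\<close> turns \<open>1 / (z + k) ^ N\<close> into
  \<open>1 / (u - \<i> k) ^ N\<close>, and reversing the sign of \<open>k\<close> gives the stated
  form.\<close>

lemma Lipschitz_formula_nat:
  assumes u: "u > 0" and N: "N \<ge> 2"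
  shows "((\<lambda>n::int. 1 / (of_real u + \<i> * of_int n) ^ N) has_sum
           ((2 * of_real pi) ^ N / fact (N - 1) * (\<Sum>m. of_nat m ^ (N - 1) * of_real (exp (- 2 * pi * u)) ^ m))) UNIV"
proof -
  obtain n where n: "N = Suc n" "n > 0" using N by (cases N) auto
  define z where "z = \<i> * of_real u"
  have z: "Im z > 0" using u by (simp add: z_def)
  have z1: "z \<noteq> 0" "1 - z \<noteq> 0" using z by auto
  have abs: "summable (\<lambda>k. norm (inverse ((z + of_nat k) ^ N)))" if "z \<noteq> 0" "Re z \<ge> 0" for z :: complex
  proof (rule summable_comparison_test'[where N = 1])
    show "summable (\<lambda>n. real n powr - real N)" using N by (subst summable_real_powr_iff) auto
    show "norm (norm (inverse ((z + of_nat k) ^ N))) \<le> real k powr - real N" if "1 \<le> k" for k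
    proof -
      have "real k \<le> Re (z + of_nat k)" using \<open>Re z \<ge> 0\<close> by simp
      also have "\<dots> \<le> norm (z + of_nat k)" by (rule complex_Re_le_cmod)
      finally have "inverse (norm (z + of_nat k) ^ N) \<le> inverse (real k ^ N)"
        using that by (intro le_imp_inverse_le power_mono) auto
      then show ?thesis using that by (simp add: norm_inverse norm_power powr_minus powr_realpow)
    qed
  qed
  have sums: "((\<lambda>k. inverse ((z + of_nat k) ^ N)) has_sum ((-1) ^ N * Polygamma n z / fact n)) UNIV"
    if "z \<noteq> 0" "Re z \<ge> 0" for z :: complex
    using norm_summable_imp_has_sum[OF abs[OF that] Polygamma_LIMSEQ[of z n, folded n(1)]] that n by auto
  have h1: "((\<lambda>k. 1 / (z + of_nat k) ^ N) has_sum ((-1) ^ N * Polygamma n z / fact n)) UNIV"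
    using sums[of z] z1 by (simp add: z_def divide_inverse)
  have "((\<lambda>k. (-1) ^ N * inverse ((1 - z + of_nat k) ^ N)) has_sum
            ((-1) ^ N * ((-1) ^ N * Polygamma n (1 - z) / fact n))) UNIV"
    using sums[of "1 - z"] z1 by (intro has_sum_cmult_right) (simp add: z_def)
  also have "(\<lambda>k. (-1) ^ N * inverse ((1 - z + of_nat k) ^ N)) = (\<lambda>k. 1 / (z + of_int (- int (Suc k))) ^ N)"
  proof
    fix k
    have "(z + of_int (- int (Suc k))) ^ N = (-1) ^ N * (1 - z + of_nat k) ^ N"
      by (subst power_mult_distrib[symmetric]) (simp add: algebra_simps)
    then show "(-1) ^ N * inverse ((1 - z + of_nat k) ^ N) = 1 / (z + of_int (- int (Suc k))) ^ N"
      by (simp add: divide_inverse flip: power_inverse)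
  qed
  also have "(-1) ^ N * ((-1) ^ N * Polygamma n (1 - z) / fact n) = Polygamma n (1 - z) / fact n"
    by (simp add: power_mult_distrib[symmetric] flip: mult.assoc)
  finally have h2: "((\<lambda>k. 1 / (z + of_int (- int (Suc k))) ^ N) has_sum (Polygamma n (1 - z) / fact n)) UNIV" .
  have "((\<lambda>k. 1 / (z + of_int k) ^ N) has_sum
          ((-1) ^ N * Polygamma n z / fact n + Polygamma n (1 - z) / fact n)) UNIV"
    using h1 h2 by (intro has_sum_int_split) auto
  also have "(-1) ^ N * Polygamma n z / fact n + Polygamma n (1 - z) / fact n =
     (- 2 * of_real pi * \<i>) ^ N / fact n * power_geom_sum n z"
    unfolding add_divide_distrib[symmetric] n(1) Polygamma_reflection[OF z, of n] using n by simp
  finally have "((\<lambda>k. \<i> ^ N * (1 / (z + of_int k) ^ N)) has_sum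
       \<i> ^ N * ((- 2 * of_real pi * \<i>) ^ N / fact n * power_geom_sum n z)) UNIV"
    by (rule has_sum_cmult_right)
  also have "\<i> ^ N * ((- 2 * of_real pi * \<i>) ^ N / fact n * power_geom_sum n z) =
     (\<i> * (- 2 * of_real pi * \<i>)) ^ N / fact n * power_geom_sum n z"
    unfolding power_mult_distrib[of \<i>] by simp
  also have "\<i> * (- 2 * of_real pi * \<i>) = 2 * of_real pi"
    by (simp add: algebra_simps)
  also have "power_geom_sum n z = (\<Sum>m. of_nat m ^ (N - 1) * of_real (exp (- 2 * pi * u)) ^ m)"
    by (simp add: power_geom_sum_def z_def n exp_of_real[symmetric] algebra_simps)
  also have "(\<lambda>k::int. \<i> ^ N * (1 / (z + of_int k) ^ N)) = (\<lambda>k. 1 / (of_real u + \<i> * of_int (- k)) ^ N)"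
  proof
    fix k :: int
    have "z + of_int k = \<i> * (of_real u + \<i> * of_int (- k))"
      by (simp add: z_def algebra_simps)
    then show "\<i> ^ N * (1 / (z + of_int k) ^ N) = 1 / (of_real u + \<i> * of_int (- k)) ^ N"
      by (simp add: power_mult_distrib)
  qed
  finally have "((\<lambda>k::int. 1 / (of_real u + \<i> * of_int (- k)) ^ N) has_sum
     ((2 * of_real pi) ^ N / fact (N - 1) * (\<Sum>m. of_nat m ^ (N - 1) * of_real (exp (- 2 * pi * u)) ^ m))) UNIV"
    using n by simp
  then show ?thesis
    by (subst (asm) has_sum_reindex_bij_witness[of UNIV uminus uminus UNIV "\<lambda>n. 1 / (of_real u + \<i> * of_int n) ^ N"]) auto
qed

section \<open>Beta integrals with affine and complex shifts\<close>

lemma has_ray_integral_Beta_affine: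
  assumes p: "0 < Re p" "Re p < Re N" and ab: "a > 0" "b > 0"
  shows "has_ray_integral (\<lambda>t. of_real t powr (p - 1) * of_real (a * t + b) powr (- N))
           (of_real a powr (- p) * of_real b powr (p - N) * (Gamma p * Gamma (N - p) / Gamma N))"
proof -
  define c where "c = a / b"
  have c: "c > 0" using ab by (simp add: c_def)
  define B where "B = Gamma p * Gamma (N - p) / Gamma N"
  have abc: "of_real a = of_real c * complex_of_real b" using ab by (simp add: c_def)
  from has_ray_integral_cmult[OF has_ray_integral_scale[OF has_ray_integral_Beta[OF p] c],
      of "of_real c powr (1 - p) * of_real b powr (- N)", folded B_def]
  have "has_ray_integral (\<lambda>t. of_real c powr (1 - p) * of_real b powr (- N) *
           (of_real (c * t) powr (p - 1) * of_real (1 + c * t) powr (- N)))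
           (of_real c powr (1 - p) * of_real b powr (- N) * (B /\<^sub>R c))" .
  also have "of_real c powr (1 - p) * of_real b powr (- N) * (B /\<^sub>R c) =
      of_real a powr (- p) * of_real b powr (p - N) * B"
    using ab c unfolding abc
    by (subst powr_times_real) (auto simp: powr_diff powr_minus scaleR_conv_of_real field_simps)
  also have "has_ray_integral (\<lambda>t. of_real c powr (1 - p) * of_real b powr (- N) *
           (of_real (c * t) powr (p - 1) * of_real (1 + c * t) powr (- N)))
              (of_real a powr (- p) * of_real b powr (p - N) * B) \<longleftrightarrow>
         has_ray_integral (\<lambda>t. of_real t powr (p - 1) * of_real (a * t + b) powr (- N))
              (of_real a powr (- p) * of_real b powr (p - N) * B)"
  proof (rule has_ray_integral_cong)
    fix t :: real assume t: "t > 0"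
    have "a * t + b = b * (1 + c * t)" using ab by (simp add: c_def field_simps)
    then have 1: "of_real (a * t + b) powr (- N) = of_real b powr (- N) * complex_of_real (1 + c * t) powr (- N)"
      using ab c t by (subst powr_times_real[symmetric]) auto
    have 2: "complex_of_real (c * t) powr (p - 1) = of_real c powr (p - 1) * of_real t powr (p - 1)"
      using c t by (subst powr_times_real[symmetric]) auto
    have 3: "complex_of_real c powr (1 - p) * of_real c powr (p - 1) = 1"
      using c by (subst powr_add[symmetric]) auto
    show "of_real c powr (1 - p) * of_real b powr (- N) *
           (of_real (c * t) powr (p - 1) * of_real (1 + c * t) powr (- N)) =
          of_real t powr (p - 1) * of_real (a * t + b) powr (- N)"
      unfolding 1 2 using 3 by (simp add: mult_ac)
  qed
  finally show ?thesis unfolding B_def .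
qed

lemma has_ray_integral_Beta_affine_real:
  assumes p: "0 < P" "P < N" and ab: "a > 0" "b > 0"
  shows "has_ray_integral (\<lambda>t. t powr (P - 1) * (a * t + b) powr (- N))
           (a powr (- P) * b powr (P - N) * (Gamma P * Gamma (N - P) / Gamma N))"
proof -
  have "has_ray_integral
     (\<lambda>t. Re (of_real t powr (of_real P - 1) * of_real (a * t + b) powr (- of_real N)))
     (Re (of_real a powr (- of_real P) * of_real b powr (of_real P - of_real N) *
        (Gamma (of_real P) * Gamma (of_real N - of_real P) / Gamma (of_real N))))"
    using assms by (intro has_ray_integral_Re has_ray_integral_Beta_affine) auto
  also have "of_real a powr (- of_real P) * of_real b powr (of_real P - of_real N) *
        (Gamma (of_real P) * Gamma (of_real N - of_real P) / Gamma (of_real N)) =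
      complex_of_real (a powr (- P) * b powr (P - N) * (Gamma P * Gamma (N - P) / Gamma N))"
    using ab powr_of_real[of a "- P"] powr_of_real[of b "P - N"]
    by (simp add: Gamma_complex_of_real flip: of_real_diff)
  finally show ?thesis
    unfolding Re_complex_of_real
  proof (rule has_ray_integral_cong[THEN iffD1, rotated], goal_cases)
    case (1 t)
    have "of_real t powr (of_real P - 1) * of_real (a * t + b) powr (- of_real N) =
        complex_of_real (t powr (P - 1) * (a * t + b) powr (- N))"
      using 1 ab powr_of_real[of t "P - 1"] powr_of_real[of "a * t + b" "- N"] by simp
    then show ?case by simp
  qed
qed

text \<open>Factoring \<open>\<omega>\<close> out of \<open>\<omega> + t\<close> leaves the Beta
  integrand on the ray through \<open>\<zeta> = 1 / \<omega>\<close>, and rotation applies. Since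
  \<open>N\<close> is an integer, this factorization meets no question of branches.\<close>

lemma has_ray_integral_Beta_shift:
  assumes p: "0 < Re p" "Re p < real N" and \<omega>: "Re \<omega> \<ge> 0" "\<omega> \<noteq> 0"
  shows "has_ray_integral (\<lambda>t. of_real t powr (p - 1) / (\<omega> + of_real t) ^ N)
           (\<omega> powr (p - of_nat N) * (Gamma p * Gamma (of_nat N - p) / Gamma (of_nat N)))"
proof -
  define B where "B = Gamma p * Gamma (of_nat N - p) / Gamma (of_nat N)"
  define \<zeta> where "\<zeta> = inverse \<omega>"
  have \<zeta>: "Re \<zeta> \<ge> 0" "\<zeta> \<noteq> 0" using \<omega> by (auto simp: \<zeta>_def)
  have \<omega>': "\<omega> \<notin> \<real>\<^sub>\<le>\<^sub>0" using \<omega> by (auto simp: complex_nonpos_Reals_iff complex_eq_iff)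
  \<comment> \<open>The exponent 0 reduces the last factor of \<open>lin_kernel\<close> to 1; its
    entries 1, 1 keep the base nonzero, as \<open>0 powr 0\<close> would be 0.\<close>
  have "has_ray_integral (\<lambda>t. lin_kernel p (of_nat N) 0 1 1 1 1 (of_real t)) B"
    by (rule has_ray_integral_cong[THEN iffD1, rotated,
          OF has_ray_integral_Beta[of p "of_nat N", folded B_def]])
       (use p in \<open>auto simp: lin_kernel_def add_ac complex_eq_iff\<close>)
  from has_ray_integral_cmult[OF has_ray_integral_lin_kernel_rotate[OF _ _ _ _ \<zeta> _ _ this],
      of "\<zeta> powr (1 - p) * \<zeta> ^ N"]
  have "has_ray_integral (\<lambda>t. \<zeta> powr (1 - p) * \<zeta> ^ N *
          lin_kernel p (of_nat N) 0 1 1 1 1 (of_real t * \<zeta>)) (\<zeta> powr (1 - p) * \<zeta> ^ N * (B / \<zeta>))"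
    using p by simp
  also have "\<zeta> powr (1 - p) * \<zeta> ^ N * (B / \<zeta>) = \<omega> powr (p - of_nat N) * B"
  proof -
    have "\<zeta> powr (1 - p) * \<zeta> ^ N / \<zeta> = \<zeta> powr (of_nat N - p)"
      using \<zeta> by (simp add: powr_diff field_simps)
    also have "\<dots> = \<omega> powr (p - of_nat N)"
      using \<omega> Ln_inverse[OF \<omega>'] unfolding \<zeta>_def powr_def
      by simp (simp add: algebra_simps)
    finally show ?thesis by (metis times_divide_eq_left times_divide_eq_right mult.commute)
  qed
  finally have "has_ray_integral (\<lambda>t. \<zeta> powr (1 - p) * \<zeta> ^ N *
          lin_kernel p (of_nat N) 0 1 1 1 1 (of_real t * \<zeta>)) (\<omega> powr (p - of_nat N) * B)" .
  then show ?thesis unfolding B_def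
  proof (rule has_ray_integral_cong[THEN iffD1, rotated], goal_cases)
    case (1 t)
    have 2: "(of_real t * \<zeta>) powr (p - 1) = of_real t powr (p - 1) * \<zeta> powr (p - 1)"
      using 1 by (intro powr_times_real_left) auto
    have 3: "\<zeta> powr (1 - p) * \<zeta> powr (p - 1) = 1"
      using \<zeta> by (subst powr_add[symmetric]) auto
    have "Re (\<omega> + of_real t) > 0" using 1 \<omega> by simp
    then have nz: "\<omega> + of_real t \<noteq> 0" by (metis less_irrefl zero_complex.sel(1))
    have 4: "of_real t * \<zeta> + 1 = \<zeta> * (\<omega> + of_real t)"
      using \<omega> by (simp add: \<zeta>_def field_simps)
    have nz': "of_real t * \<zeta> + 1 \<noteq> 0" unfolding 4 using nz \<zeta> by simp
    have "(of_real t * \<zeta> + 1) powr (- of_nat N) = 1 / (\<zeta> ^ N * (\<omega> + of_real t) ^ N)"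
      using nz' unfolding powr_minus by (simp add: powr_nat' 4 power_mult_distrib divide_inverse)
    then show ?case
      using 3 \<zeta> nz' unfolding lin_kernel_def 2 by (simp add: field_simps)
  qed
qed

lemma norm_ge_half_Re_Im: "(\<bar>Re w\<bar> + \<bar>Im w\<bar>) / 2 \<le> norm w"
  using add_mono[OF abs_Re_le_cmod[of w] abs_Im_le_cmod[of w]] by simp

lemma summable_on_Suc_power_exp:
  assumes "u > 0"
  shows "(\<lambda>m. real (Suc m) ^ n * exp (- (2 * pi * real (Suc m) * u))) summable_on UNIV"
proof -
  define x where "x = exp (- (2 * pi * u))"
  have x: "0 \<le> x" "x < 1" using assms by (auto simp: x_def)
  have "summable (\<lambda>m. complex_of_real (real m ^ n * x ^ m))"
    using summable_of_nat_power_mult_power[of "of_real x" n] x by simp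
  then have "summable (\<lambda>m. real m ^ n * x ^ m)" by (subst (asm) summable_of_real_iff)
  then have "summable (\<lambda>m. real (Suc m) ^ n * x ^ Suc m)" by (subst summable_Suc_iff)
  also have "(\<lambda>m. real (Suc m) ^ n * x ^ Suc m) = (\<lambda>m. real (Suc m) ^ n * exp (- (2 * pi * real (Suc m) * u)))"
    unfolding x_def exp_of_nat_mult[symmetric] by (simp add: algebra_simps)
  finally show ?thesis by (subst summable_on_UNIV_nonneg_real_iff) auto
qed

lemma Lipschitz_formula_nat':
  assumes u: "u > 0" and N: "N \<ge> 2"
  shows "((\<lambda>n::int. 1 / (of_real u + \<i> * of_int n) ^ N) has_sum
           ((2 * of_real pi) ^ N / fact (N - 1) *
             (\<Sum>\<^sub>\<infinity>m. of_nat (Suc m) ^ (N - 1) * of_real (exp (- (2 * pi * real (Suc m) * u)))))) UNIV"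
proof -
  define x where "x = exp (- 2 * pi * u)"
  have x: "norm (complex_of_real x) < 1" using u by (auto simp: x_def)
  have "(\<Sum>m. of_nat m ^ (N - 1) * complex_of_real x ^ m) =
        (\<Sum>m. of_nat (Suc m) ^ (N - 1) * complex_of_real x ^ Suc m)"
    using N by (subst suminf_split_head[OF summable_of_nat_power_mult_power[OF x]]) simp
  also have "(\<lambda>m. of_nat (Suc m) ^ (N - 1) * complex_of_real x ^ Suc m) =
       (\<lambda>m. of_nat (Suc m) ^ (N - 1) * of_real (exp (- (2 * pi * real (Suc m) * u))))"
    unfolding x_def of_real_power[symmetric] exp_of_nat_mult[symmetric] by (simp add: algebra_simps)
  also have "suminf \<dots> = (\<Sum>\<^sub>\<infinity>m. of_nat (Suc m) ^ (N - 1) * of_real (exp (- (2 * pi * real (Suc m) * u))))"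
  proof -
    have eq: "(\<lambda>m. norm (of_nat (Suc m) ^ (N - 1) * complex_of_real (exp (- (2 * pi * real (Suc m) * u))))) =
      (\<lambda>m. real (Suc m) ^ (N - 1) * exp (- (2 * pi * real (Suc m) * u)))"
      by (simp add: norm_mult norm_power del: of_nat_Suc)
    have "(\<lambda>m. of_nat (Suc m) ^ (N - 1) * complex_of_real (exp (- (2 * pi * real (Suc m) * u)))) summable_on UNIV"
      by (rule abs_summable_summable) (unfold eq, rule summable_on_Suc_power_exp[OF u])
    from has_sum_imp_sums[OF has_sum_infsum[OF this]] show ?thesis by (simp add: sums_iff)
  qed
  finally show ?thesis using Lipschitz_formula_nat[OF assms] by (simp add: x_def)
qed

section \<open>The formula for complex exponents\<close>

lemma powr_mult_Suc:
  "of_real (2 * pi * real (Suc m)) powr z = (2 * of_real pi) powr z * complex_of_real (real (Suc m)) powr z"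
  using powr_times_real[of "complex_of_real (2 * pi)" "complex_of_real (real (Suc m))" z]
  by (simp del: of_nat_Suc)

text \<open>The modulus of the base lies between half of \<open>u + \<bar>y\<bar>\<close> and
  \<open>u + \<bar>y\<bar>\<close>. The factor \<open>2 powr \<bar>Re q\<bar>\<close> covers both
  signs of \<open>Re q\<close>, and the exponential accounts for the imaginary part of the
  exponent.\<close>

lemma norm_powr_shift_le:
  assumes "u > 0"
  shows "norm ((of_real u + \<i> * of_real y) powr (- q)) \<le>
           exp (pi * \<bar>Im q\<bar>) * 2 powr \<bar>Re q\<bar> * (u + \<bar>y\<bar>) powr (- Re q)"
proof -
  let ?w = "of_real u + \<i> * complex_of_real y"
  have "1 / 2 * (u + \<bar>y\<bar>) \<le> norm ?w"
    using norm_ge_half_Re_Im[of ?w] assms by simp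
  moreover have "norm ?w \<le> 1 * (u + \<bar>y\<bar>)"
    using norm_triangle_ineq[of "of_real u" "\<i> * complex_of_real y"] assms by (simp add: norm_mult)
  ultimately have b: "norm ?w powr (- Re q) \<le> 2 powr \<bar>Re q\<bar> * (u + \<bar>y\<bar>) powr (- Re q)"
  proof (cases "Re q \<ge> 0")
    case True
    have "norm ?w powr (- Re q) \<le> (1 / 2 * (u + \<bar>y\<bar>)) powr (- Re q)"
      using True \<open>1 / 2 * _ \<le> _\<close> assms by (intro powr_mono2') auto
    then show ?thesis using True assms by (simp add: powr_mult powr_divide powr_minus field_simps)
  next
    case False
    have "norm ?w powr (- Re q) \<le> (1 * (u + \<bar>y\<bar>)) powr (- Re q)"
      using False \<open>norm ?w \<le> _\<close> by (intro powr_mono2) auto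
    also have "\<dots> \<le> 2 powr \<bar>Re q\<bar> * (u + \<bar>y\<bar>) powr (- Re q)"
      by (simp add: mult_le_cancel_right1 ge_one_powr_ge_zero)
    finally show ?thesis .
  qed
  have "norm (?w powr (- q)) \<le> exp (pi * \<bar>Im q\<bar>) * norm ?w powr (- Re q)"
    by (rule norm_powr_le)
  also have "\<dots> \<le> exp (pi * \<bar>Im q\<bar>) * (2 powr \<bar>Re q\<bar> * (u + \<bar>y\<bar>) powr (- Re q))"
    using b by (intro mult_left_mono) auto
  finally show ?thesis by (simp add: mult_ac)
qed

lemma abs_summable_on_int_shift:
  assumes "u > 0" "Re q > 1"
  shows "(\<lambda>n::int. norm ((of_real u + \<i> * of_int n) powr (- q))) summable_on UNIV"
proof (rule summable_on_comparison_test)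
  show "(\<lambda>n::int. exp (pi * \<bar>Im q\<bar>) * 2 powr \<bar>Re q\<bar> * (u + \<bar>of_int n\<bar>) powr (- Re q)) summable_on UNIV"
    using assms by (intro summable_on_cmult_right summable_on_int_powr) auto
  show "norm ((of_real u + \<i> * of_int n) powr (- q)) \<le>
      exp (pi * \<bar>Im q\<bar>) * 2 powr \<bar>Re q\<bar> * (u + \<bar>of_int n\<bar>) powr (- Re q)" for n :: int
    using norm_powr_shift_le[OF assms(1), of "of_int n" q] by simp
qed auto

text \<open>Integrating the formula for an integer exponent \<open>N > Re q\<close> at \<open>u + v\<close> against
  \<open>v\<^sup>N\<^sup>-\<^sup>q\<^sup>-\<^sup>1 dv\<close> lowers the exponent to \<open>q\<close> on both sides.\<close>

lemma Lipschitz_formula: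
  assumes u: "u > 0" and q: "Re q > 1"
  shows "((\<lambda>n::int. (of_real u + \<i> * of_int n) powr (- q)) has_sum
           ((2 * of_real pi) powr q / Gamma q *
             (\<Sum>\<^sub>\<infinity>m. of_real (real (Suc m)) powr (q - 1) * of_real (exp (- (2 * pi * real (Suc m) * u)))))) UNIV"
proof -
  \<comment> \<open>\<open>N > Re q\<close> gives \<open>Re r > 0\<close>, so
    \<open>v powr (r - 1)\<close> is integrable at 0, and \<open>r - N = - q\<close> is the exponent
    that the Beta integral leaves on \<open>u + \<i> n\<close>.\<close>
  define N where "N = nat \<lceil>Re q\<rceil> + 1"
  have N: "real N > Re q" "N \<ge> 2" using q unfolding N_def by linarith+
  define r where "r = of_nat N - q"
  have r: "0 < Re r" "Re r < real N" "of_nat N - r = q" "r - of_nat N = - q" "Re r - real N = - Re q"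
    using N q by (auto simp: r_def)
  define B where "B = Gamma r * Gamma q / Gamma (of_nat N)"
  define B' where "B' = Gamma (Re r) * Gamma (real N - Re r) / Gamma (real N)"
  define e where "e m v = exp (- (2 * pi * real (Suc m) * v))" for m and v :: real
  have e_add: "e m (v + v') = e m v * e m v'" for m v v' by (simp add: e_def distrib_left exp_add[symmetric])
  define f where "f n v = of_real v powr (r - 1) / ((of_real u + \<i> * of_int n) + of_real v) ^ N" for n :: int and v :: real
  \<comment> \<open>The modulus of \<open>u + \<i> n + v\<close> is at least half of
    \<open>v + u + \<bar>n\<bar>\<close>; this is the source of \<open>2 ^ N\<close>.\<close>
  define g where "g n v = 2 ^ N * (v powr (Re r - 1) * (1 * v + (u + \<bar>of_int n\<bar>)) powr (- real N))" for n :: int and v :: real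
  define h where "h m v = of_nat (Suc m) ^ (N - 1) * of_real (e m u) * (of_real v powr (r - 1) * complex_of_real (e m v))" for m v
  define k where "k m v = real (Suc m) ^ (N - 1) * e m u * (v powr (Re r - 1) * e m v)" for m v
  have A: "has_ray_integral (\<lambda>v. \<Sum>\<^sub>\<infinity>n. f n v) (\<Sum>\<^sub>\<infinity>n::int. (of_real u + \<i> * of_int n) powr (- q) * B)"
  proof (rule has_ray_integral_infsum(1))
    show "has_ray_integral (f n) ((of_real u + \<i> * of_int n) powr (- q) * B)" for n
      using has_ray_integral_Beta_shift[OF r(1,2), of "of_real u + \<i> * of_int n"] u
      unfolding r(3,4) B_def f_def by (auto simp: complex_eq_iff)
    show "has_ray_integral (g n) (2 ^ N * (1 powr (- Re r) * (u + \<bar>of_int n\<bar>) powr (- Re q) * B'))" for n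
      unfolding g_def B'_def r(5)[symmetric] using r u
      by (intro has_ray_integral_cmult has_ray_integral_Beta_affine_real) auto
    show "(\<lambda>n::int. 2 ^ N * (1 powr (- Re r) * (u + \<bar>of_int n\<bar>) powr (- Re q) * B')) summable_on UNIV"
      using u q by (intro summable_on_cmult_right summable_on_cmult_left summable_on_int_powr)
    show "(\<lambda>n. g n v) summable_on UNIV" if "v > 0" for v
    proof -
      have "g n v = 2 ^ N * (v powr (Re r - 1) * ((u + v) + \<bar>of_int n\<bar>) powr (- real N))" for n
        by (simp add: g_def add_ac)
      then show ?thesis
        using u that N by (simp only:) (intro summable_on_cmult_right summable_on_int_powr, auto)
    qed
    show "norm (f n v) \<le> g n v" if "v > 0" for n v
    proof -
      let ?w = "of_real u + \<i> * of_int n + complex_of_real v"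
      have l: "1 / 2 * (v + (u + \<bar>of_int n\<bar>)) \<le> norm ?w"
        using norm_ge_half_Re_Im[of ?w] u that by simp
      have "inverse (norm ?w ^ N) \<le> inverse ((1 / 2 * (v + (u + \<bar>of_int n\<bar>))) ^ N)"
        using l u that by (intro le_imp_inverse_le power_mono) auto
      also have "\<dots> = 2 ^ N * (v + (u + \<bar>of_int n\<bar>)) powr (- real N)"
      proof -
        have "inverse ((1 / 2 * x) ^ N) = 2 ^ N * x powr (- real N)" if "x > 0" for x :: real
        proof -
          have "x powr (- real N) = inverse (x ^ N)" using that by (simp add: powr_minus powr_realpow)
          then show ?thesis by (simp only: power_mult_distrib power_one_over) (simp add: divide_inverse)
        qed
        then show ?thesis using u that by simp
      qed
      finally have "v powr (Re r - 1) * inverse (norm ?w ^ N) \<le>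
          v powr (Re r - 1) * (2 ^ N * (v + (u + \<bar>of_int n\<bar>)) powr (- real N))"
        by (intro mult_left_mono) auto
      moreover have "norm (f n v) = v powr (Re r - 1) * inverse (norm ?w ^ N)"
        unfolding f_def norm_divide norm_power
        using that by (simp only: norm_powr_real_powr Reals_of_real Re_complex_of_real) (simp add: divide_inverse)
      ultimately show ?thesis by (simp add: g_def mult_ac)
    qed
  qed auto
  have ksum: "(\<lambda>m. real (Suc m) ^ (N - 1) * e m u) summable_on UNIV" if "u > 0" for u
    using summable_on_Suc_power_exp[OF that] by (simp add: e_def)
  have C: "has_ray_integral (\<lambda>v. \<Sum>\<^sub>\<infinity>m. h m v)
     (\<Sum>\<^sub>\<infinity>m. of_nat (Suc m) ^ (N - 1) * of_real (e m u) * (Gamma r * of_real (2 * pi * real (Suc m)) powr (- r)))"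
  proof (rule has_ray_integral_infsum(1))
    show "has_ray_integral (h m)
       (of_nat (Suc m) ^ (N - 1) * of_real (e m u) * (Gamma r * of_real (2 * pi * real (Suc m)) powr (- r)))" for m
      unfolding h_def e_def using r
      by (intro has_ray_integral_cmult has_ray_integral_Gamma) auto
    show "has_ray_integral (k m)
       (real (Suc m) ^ (N - 1) * e m u * (Gamma (Re r) * (2 * pi * real (Suc m)) powr (- Re r)))" for m
      unfolding k_def e_def using r
      by (intro has_ray_integral_cmult has_ray_integral_Gamma_real) auto
    show "norm (h m v) \<le> k m v" if "v > 0" for m v
      using that by (simp add: h_def k_def norm_mult norm_power norm_powr_real_powr e_def del: of_nat_Suc)
    show "(\<lambda>m. real (Suc m) ^ (N - 1) * e m u * (Gamma (Re r) * (2 * pi * real (Suc m)) powr (- Re r))) summable_on UNIV"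
    proof (rule summable_on_comparison_test)
      show "(\<lambda>m. real (Suc m) ^ (N - 1) * e m u * Gamma (Re r)) summable_on UNIV"
        by (intro summable_on_cmult_left ksum u)
      have "1 \<le> 2 * pi * real (Suc m)" for m
        using mult_mono[of 1 "2 * pi" 1 "real (Suc m)"] pi_ge_two by simp
      then have "(2 * pi * real (Suc m)) powr (- Re r) \<le> 1" for m
        using r powr_mono2'[of "- Re r" 1 "2 * pi * real (Suc m)"] by simp
      then show "real (Suc m) ^ (N - 1) * e m u * (Gamma (Re r) * (2 * pi * real (Suc m)) powr (- Re r)) \<le>
         real (Suc m) ^ (N - 1) * e m u * Gamma (Re r)" for m
        using Gamma_real_pos[OF r(1)]
        by (intro mult_left_mono mult_left_le) (simp_all add: e_def)
      show "0 \<le> real (Suc m) ^ (N - 1) * e m u * (Gamma (Re r) * (2 * pi * real (Suc m)) powr (- Re r))" for m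
        using r Gamma_real_pos[of "Re r"] by (auto simp: e_def)
    qed
    show "(\<lambda>m. k m v) summable_on UNIV" if "v > 0" for v
    proof -
      have "k m v = v powr (Re r - 1) * (real (Suc m) ^ (N - 1) * e m (u + v))" for m
        by (simp add: k_def e_add mult_ac)
      then show ?thesis using u that by (simp only:) (intro summable_on_cmult_right ksum, auto)
    qed
  qed auto
  \<comment> \<open>The constant of the integer formula, which is now applied at
    \<open>u + v\<close>. There \<open>e m (u + v) = e m u * e m v\<close>, so the
    \<open>m\<close>-th term becomes a Gamma integrand in \<open>v\<close>.\<close>
  define K :: complex where "K = (2 * of_real pi) ^ N / fact (N - 1)"
  have "(\<Sum>\<^sub>\<infinity>n. f n v) = K * (\<Sum>\<^sub>\<infinity>m. h m v)" if "v > 0" for v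
  proof -
    have "((\<lambda>n::int. of_real v powr (r - 1) * (1 / (of_real (u + v) + \<i> * of_int n) ^ N)) has_sum
        of_real v powr (r - 1) * (K * (\<Sum>\<^sub>\<infinity>m. of_nat (Suc m) ^ (N - 1) * of_real (e m (u + v))))) UNIV"
      using Lipschitz_formula_nat'[of "u + v" N] u that N unfolding K_def e_def
      by (intro has_sum_cmult_right) auto
    then have "(\<Sum>\<^sub>\<infinity>n. f n v) = of_real v powr (r - 1) * (K * (\<Sum>\<^sub>\<infinity>m. of_nat (Suc m) ^ (N - 1) * of_real (e m (u + v))))"
      by (intro infsumI) (simp add: f_def add_ac)
    also have "\<dots> = K * (\<Sum>\<^sub>\<infinity>m. of_real v powr (r - 1) * (of_nat (Suc m) ^ (N - 1) * of_real (e m (u + v))))"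
      unfolding infsum_cmult_right' by (simp only: mult.left_commute)
    also have "\<dots> = K * (\<Sum>\<^sub>\<infinity>m. h m v)"
      by (simp add: h_def e_add mult_ac del: of_nat_Suc)
    finally show ?thesis .
  qed
  then have "has_ray_integral (\<lambda>v. \<Sum>\<^sub>\<infinity>n. f n v)
     (K * (\<Sum>\<^sub>\<infinity>m. of_nat (Suc m) ^ (N - 1) * of_real (e m u) * (Gamma r * of_real (2 * pi * real (Suc m)) powr (- r))))"
    using has_ray_integral_cmult[OF C, of K]
    by (subst has_ray_integral_cong) auto
  \<comment> \<open>One integral evaluated on both sides of the integer formula: Beta values on the
    left, Gamma values on the right.\<close>
  from has_ray_integral_unique[OF A this]
  have "(\<Sum>\<^sub>\<infinity>n::int. (of_real u + \<i> * of_int n) powr (- q)) * B =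
     K * (\<Sum>\<^sub>\<infinity>m. of_nat (Suc m) ^ (N - 1) * of_real (e m u) * (Gamma r * of_real (2 * pi * real (Suc m)) powr (- r)))"
    by (simp add: infsum_cmult_left')
  also have "(\<lambda>m. of_nat (Suc m) ^ (N - 1) * of_real (e m u) * (Gamma r * of_real (2 * pi * real (Suc m)) powr (- r))) =
    (\<lambda>m. (Gamma r * (2 * of_real pi) powr (- r)) * (of_real (real (Suc m)) powr (q - 1) * of_real (e m u)))"
  proof
    fix m
    let ?x = "complex_of_real (real (Suc m))"
    have x0: "?x \<noteq> 0" by (simp del: of_nat_Suc)
    have "of_nat (Suc m) ^ (N - 1) * ?x powr (- r) = ?x powr (of_nat (N - 1) + (- r))"
      unfolding powr_add using x0 by (simp add: powr_nat' del: of_nat_Suc)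
    also have "of_nat (N - 1) + (- r) = q - 1" using N by (simp add: r_def of_nat_diff)
    finally show "of_nat (Suc m) ^ (N - 1) * of_real (e m u) * (Gamma r * of_real (2 * pi * real (Suc m)) powr (- r)) =
      (Gamma r * (2 * of_real pi) powr (- r)) * (?x powr (q - 1) * of_real (e m u))"
      unfolding powr_mult_Suc by (simp add: mult_ac)
  qed
  finally have eq: "(\<Sum>\<^sub>\<infinity>n::int. (of_real u + \<i> * of_int n) powr (- q)) * B =
     K * (Gamma r * (2 * of_real pi) powr (- r)) * (\<Sum>\<^sub>\<infinity>m. of_real (real (Suc m)) powr (q - 1) * of_real (e m u))"
    by (simp only: infsum_cmult_right' mult.assoc)
  have nz: "Gamma r \<noteq> 0" "Gamma q \<noteq> 0"
    using r q by (auto simp: Gamma_eq_zero_iff elim!: nonpos_Ints_cases)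
  have fN: "Gamma (of_nat N) = (fact (N - 1) :: complex)"
    using N Gamma_fact[of "N - 1", where 'a = complex] by (simp add: of_nat_diff)
  have "(2 * complex_of_real pi) ^ N * (2 * of_real pi) powr (- r) = (2 * of_real pi) powr (of_nat N + (- r))"
    unfolding powr_add by (simp add: powr_nat')
  then have p2: "(2 * complex_of_real pi) ^ N * (2 * of_real pi) powr (- r) = (2 * of_real pi) powr q"
    using r(3) by simp
  have "(\<Sum>\<^sub>\<infinity>n::int. (of_real u + \<i> * of_int n) powr (- q)) =
     (2 * of_real pi) powr q / Gamma q * (\<Sum>\<^sub>\<infinity>m. of_real (real (Suc m)) powr (q - 1) * of_real (e m u))"
    using eq nz unfolding B_def K_def fN p2[symmetric] by (simp add: field_simps)
  moreover have "(\<lambda>n::int. (of_real u + \<i> * of_int n) powr (- q)) summable_on UNIV"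
    by (rule abs_summable_summable[OF abs_summable_on_int_shift[OF u q]])
  ultimately show ?thesis unfolding e_def by (metis has_sum_infsum)
qed

text \<open>As \<open>Re p > Re q\<close>, a single term of the series over \<open>n\<close> gives
  an integral that diverges at infinity. The exponential series on the other side can be integrated
  term by term: the term of \<open>m\<close> gives a constant times
  \<open>m powr (q - 1) * m powr (- p)\<close>, whence the zeta value at
  \<open>p - q + 1\<close>.\<close>

lemma has_ray_integral_Lipschitz:
  assumes q: "Re q > 1" and p: "Re p > Re q"
  shows "has_ray_integral
           (\<lambda>u. of_real u powr (p - 1) * (\<Sum>\<^sub>\<infinity>n::int. (of_real u + \<i> * of_int n) powr (- q)))
           ((2 * of_real pi) powr (q - p) * (Gamma p / Gamma q) * riemann_zeta (p - q + 1))"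
proof -
  define e where "e m v = exp (- (2 * pi * real (Suc m) * v))" for m and v :: real
  define h where "h m u = of_real (real (Suc m)) powr (q - 1) * (of_real u powr (p - 1) * complex_of_real (e m u))" for m u
  define k where "k m u = real (Suc m) powr (Re q - 1) * (u powr (Re p - 1) * e m u)" for m u
  have p0: "Re p > 0" using assms by simp
  have eqv: "x powr (Re q - 1) * (2 * pi * x) powr (- Re p) = (2 * pi) powr (- Re p) * x powr (- (Re p - Re q + 1))"
    if "x > 0" for x
    using that by (simp add: powr_mult powr_diff powr_minus powr_add field_simps)
  have hI: "has_ray_integral (h m)
       (of_real (real (Suc m)) powr (q - 1) * (Gamma p * of_real (2 * pi * real (Suc m)) powr (- p)))"
    if "m \<in> UNIV" for m
    unfolding h_def e_def using p0
    by (intro has_ray_integral_cmult has_ray_integral_Gamma) auto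
  have kI: "has_ray_integral (k m)
       (real (Suc m) powr (Re q - 1) * (Gamma (Re p) * (2 * pi * real (Suc m)) powr (- Re p)))"
    if "m \<in> UNIV" for m
    unfolding k_def e_def using p0
    by (intro has_ray_integral_cmult has_ray_integral_Gamma_real) auto
  have le: "norm (h m v) \<le> k m v" if "m \<in> UNIV" "v > 0" for m v
    using that by (simp add: h_def k_def norm_mult norm_powr_real_powr e_def del: of_nat_Suc)
  have "(\<lambda>m. Gamma (Re p) * (2 * pi) powr (- Re p) * real (Suc m) powr (- (Re p - Re q + 1))) summable_on UNIV"
    using assms by (intro summable_on_cmult_right summable_on_Suc_powr) auto
  also have "(\<lambda>m. Gamma (Re p) * (2 * pi) powr (- Re p) * real (Suc m) powr (- (Re p - Re q + 1))) =
     (\<lambda>m. real (Suc m) powr (Re q - 1) * (Gamma (Re p) * (2 * pi * real (Suc m)) powr (- Re p)))"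
  proof
    fix m
    show "Gamma (Re p) * (2 * pi) powr (- Re p) * real (Suc m) powr (- (Re p - Re q + 1)) =
       real (Suc m) powr (Re q - 1) * (Gamma (Re p) * (2 * pi * real (Suc m)) powr (- Re p))"
      using eqv[of "real (Suc m)"] by (simp only: mult_ac)
  qed
  finally have s: "(\<lambda>m. real (Suc m) powr (Re q - 1) * (Gamma (Re p) * (2 * pi * real (Suc m)) powr (- Re p))) summable_on UNIV" .
  \<comment> \<open>The real exponent \<open>Re q - 1\<close> is raised to a natural number, for
    which the exponential series is known to converge.\<close>
  have ks: "(\<lambda>m. k m v) summable_on UNIV" if "v > 0" for v
  proof (rule summable_on_comparison_test)
    show "(\<lambda>m. v powr (Re p - 1) * (real (Suc m) ^ nat \<lceil>Re q\<rceil> * exp (- (2 * pi * real (Suc m) * v)))) summable_on UNIV"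
      by (intro summable_on_cmult_right summable_on_Suc_power_exp that)
    show "k m v \<le> v powr (Re p - 1) * (real (Suc m) ^ nat \<lceil>Re q\<rceil> * exp (- (2 * pi * real (Suc m) * v)))" for m
    proof -
      have "real (Suc m) powr (Re q - 1) \<le> real (Suc m) powr (real (nat \<lceil>Re q\<rceil>))"
        using q by (intro powr_mono) linarith+
      also have "\<dots> = real (Suc m) ^ nat \<lceil>Re q\<rceil>" by (subst powr_realpow) auto
      finally have "(v powr (Re p - 1) * e m v) * real (Suc m) powr (Re q - 1) \<le>
          (v powr (Re p - 1) * e m v) * real (Suc m) ^ nat \<lceil>Re q\<rceil>"
        by (intro mult_left_mono) (auto simp: e_def)
      then show ?thesis by (simp add: k_def e_def mult_ac)
    qed
  qed (auto simp: k_def e_def)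
  have cnt: "countable (UNIV :: nat set)" by simp
  note C = has_ray_integral_infsum(1)[OF cnt hI kI le s ks]
  note C' = has_ray_integral_infsum(2)[OF cnt hI kI le s ks]
  define Z where "Z = (2 * of_real pi) powr q / Gamma q"
  have sm: "of_real (real (Suc m)) powr (q - 1) * (Gamma p * of_real (2 * pi * real (Suc m)) powr (- p)) =
      Gamma p * (2 * of_real pi) powr (- p) * of_nat (Suc m) powr (- (p - q + 1))" for m
  proof -
    have "- (p - q + 1) = (q - 1) + (- p)" by simp
    then have "of_nat (Suc m) powr (- (p - q + 1)) = complex_of_nat (Suc m) powr (q - 1) * of_nat (Suc m) powr (- p)"
      by (simp only: powr_add)
    then show ?thesis unfolding powr_mult_Suc by (simp add: mult_ac)
  qed
  have G0: "Gamma p * (2 * of_real pi) powr (- p) \<noteq> 0"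
    using p0 by (auto simp: Gamma_eq_zero_iff elim!: nonpos_Ints_cases)
  have "(\<lambda>m. (Gamma p * (2 * of_real pi) powr (- p)) * of_nat (Suc m) powr (- (p - q + 1))) summable_on UNIV"
    using abs_summable_summable[OF C'] unfolding sm .
  then have "(\<lambda>m. complex_of_nat (Suc m) powr (- (p - q + 1))) summable_on UNIV"
    using G0 by (subst (asm) summable_on_cmult_right') auto
  from has_sum_imp_sums[OF has_sum_infsum[OF this]]
  have "(\<Sum>\<^sub>\<infinity>m. complex_of_nat (Suc m) powr (- (p - q + 1))) = riemann_zeta (p - q + 1)"
    by (simp add: riemann_zeta_def sums_iff)
  then have S: "(\<Sum>\<^sub>\<infinity>m. of_real (real (Suc m)) powr (q - 1) * (Gamma p * of_real (2 * pi * real (Suc m)) powr (- p))) =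
      Gamma p * (2 * of_real pi) powr (- p) * riemann_zeta (p - q + 1)"
    unfolding sm by (simp only: infsum_cmult_right')
  have "has_ray_integral
     (\<lambda>u. of_real u powr (p - 1) * (\<Sum>\<^sub>\<infinity>n::int. (of_real u + \<i> * of_int n) powr (- q)))
     (Z * (Gamma p * (2 * of_real pi) powr (- p) * riemann_zeta (p - q + 1)))"
  proof (rule has_ray_integral_cong[THEN iffD1, rotated, OF has_ray_integral_cmult[OF C, of Z, unfolded S]])
    fix u :: real assume u: "u > 0"
    have "(\<Sum>\<^sub>\<infinity>n::int. (of_real u + \<i> * of_int n) powr (- q)) =
        Z * (\<Sum>\<^sub>\<infinity>m. of_real (real (Suc m)) powr (q - 1) * of_real (e m u))"
      unfolding Z_def e_def using Lipschitz_formula[OF u q] by (rule infsumI)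
    then show "Z * (\<Sum>\<^sub>\<infinity>m. h m u) =
        of_real u powr (p - 1) * (\<Sum>\<^sub>\<infinity>n::int. (of_real u + \<i> * of_int n) powr (- q))"
      by (simp add: h_def infsum_cmult_right'[symmetric] mult_ac del: of_nat_Suc)
  qed
  also have "Z * (Gamma p * (2 * of_real pi) powr (- p) * riemann_zeta (p - q + 1)) =
     (2 * of_real pi) powr (q - p) * (Gamma p / Gamma q) * riemann_zeta (p - q + 1)"
    by (simp add: Z_def powr_diff powr_minus field_simps)
  finally show ?thesis .
qed

section \<open>The terms without vanishing entries\<close>

text \<open>Rotation by \<open>\<zeta> = \<sigma> \<i>\<close>. Removing
  \<open>\<zeta> powr (p - 1)\<close> from the integrand and dividing by \<open>\<zeta>\<close> for
  the rotation combine to the factor \<open>\<zeta> powr (- p)\<close>.\<close>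

lemma has_ray_integral_lin_kernel_imaginary:
  assumes abcd: "a > 0" "b > 0" "c > 0" "d > 0" and \<sigma>: "\<sigma> = 1 \<or> \<sigma> = (-1::real)"
    and p: "0 < Re p" "Re p < Re (\<alpha> + \<beta>)"
    and J: "has_ray_integral (\<lambda>t. lin_kernel p \<alpha> \<beta> a b c d (of_real t)) J"
  shows "has_ray_integral (\<lambda>t. of_real t powr (p - 1) *
            ((of_real b + \<i> * of_real (\<sigma> * a * t)) powr (- \<alpha>) *
             (of_real d + \<i> * of_real (\<sigma> * c * t)) powr (- \<beta>)))
          (exp (- (of_real \<sigma> * \<i> * of_real pi * p / 2)) * J)"
proof -
  define \<zeta> where "\<zeta> = \<i> * complex_of_real \<sigma>"
  have \<zeta>: "Re \<zeta> \<ge> 0" "\<zeta> \<noteq> 0" using \<sigma> by (auto simp: \<zeta>_def)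
  from has_ray_integral_cmult[OF has_ray_integral_lin_kernel_rotate[OF abcd \<zeta> p J],
      of "\<zeta> powr (1 - p)"]
  have "has_ray_integral (\<lambda>t. \<zeta> powr (1 - p) * lin_kernel p \<alpha> \<beta> a b c d (of_real t * \<zeta>))
          (\<zeta> powr (1 - p) * (J / \<zeta>))" .
  also have "\<zeta> powr (1 - p) * (J / \<zeta>) = exp (- (of_real \<sigma> * \<i> * of_real pi * p / 2)) * J"
  proof -
    have "Ln \<zeta> = of_real \<sigma> * \<i> * of_real pi / 2" using \<sigma> by (auto simp: \<zeta>_def)
    then have "\<zeta> powr (- p) = exp (- (of_real \<sigma> * \<i> * of_real pi * p / 2))"
      using \<zeta>(2) by (simp only: powr_def if_False) (simp add: mult_ac)
    moreover have "\<zeta> powr (1 - p) = \<zeta> * \<zeta> powr (- p)"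
      using \<zeta> powr_add[of \<zeta> 1 "- p"] by simp
    ultimately show ?thesis using \<zeta> by simp
  qed
  finally show ?thesis
  proof (rule has_ray_integral_cong[THEN iffD1, rotated], goal_cases)
    case (1 t)
    have 2: "(of_real t * \<zeta>) powr (p - 1) = of_real t powr (p - 1) * \<zeta> powr (p - 1)"
      using 1 by (intro powr_times_real_left) auto
    have 3: "\<zeta> powr (1 - p) * \<zeta> powr (p - 1) = 1"
      using \<zeta> by (subst powr_add[symmetric]) auto
    have 4: "of_real x * (of_real t * \<zeta>) + of_real y = of_real y + \<i> * of_real (\<sigma> * x * t)" for x y
      by (simp add: \<zeta>_def mult_ac)
    have "\<zeta> powr (1 - p) * lin_kernel p \<alpha> \<beta> a b c d (of_real t * \<zeta>) =
       (\<zeta> powr (1 - p) * \<zeta> powr (p - 1)) * (of_real t powr (p - 1) *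
            ((of_real b + \<i> * of_real (\<sigma> * a * t)) powr (- \<alpha>) *
             (of_real d + \<i> * of_real (\<sigma> * c * t)) powr (- \<beta>)))"
      unfolding lin_kernel_def 2 4 by (simp only: mult_ac)
    then show ?case unfolding 3 by simp
  qed
qed

text \<open>Serves the matrices with \<open>c = 0\<close> or \<open>a = 0\<close>, where one linear
  factor is 1 up to sign. The kernel with \<open>\<beta> = 0\<close> models this; its last pair of
  entries repeats \<open>1 b\<close> to keep the base nonzero, so that the zeroth power is
  1.\<close>

lemma has_ray_integral_affine_imaginary:
  assumes b: "b > 0" and \<sigma>: "\<sigma> = 1 \<or> \<sigma> = (-1::real)" and p: "0 < Re p" "Re p < Re \<alpha>"
  shows "has_ray_integral
           (\<lambda>t. of_real t powr (p - 1) * (of_real b + \<i> * of_real (\<sigma> * t)) powr (- \<alpha>))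
           (exp (- (of_real \<sigma> * \<i> * of_real pi * p / 2)) *
              (of_real b powr (p - \<alpha>) * (Gamma p * Gamma (\<alpha> - p) / Gamma \<alpha>)))"
proof -
  have "has_ray_integral (\<lambda>t. lin_kernel p \<alpha> 0 1 b 1 b (of_real t))
      (of_real b powr (p - \<alpha>) * (Gamma p * Gamma (\<alpha> - p) / Gamma \<alpha>))"
  proof (rule has_ray_integral_cong[THEN iffD1])
    show "has_ray_integral (\<lambda>t. of_real t powr (p - 1) * complex_of_real (1 * t + b) powr (- \<alpha>))
      (of_real b powr (p - \<alpha>) * (Gamma p * Gamma (\<alpha> - p) / Gamma \<alpha>))"
      using has_ray_integral_Beta_affine[OF p zero_less_one b] by simp
    show "of_real t powr (p - 1) * complex_of_real (1 * t + b) powr (- \<alpha>) =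
        lin_kernel p \<alpha> 0 1 b 1 b (of_real t)" if "t > 0" for t
    proof -
      have "of_real t + of_real b \<noteq> (0::complex)"
        using that b by (simp flip: of_real_add)
      then show ?thesis by (simp add: lin_kernel_def)
    qed
  qed
  from has_ray_integral_lin_kernel_imaginary[OF _ _ _ _ \<sigma> _ _ this] show ?thesis
  proof (rule has_ray_integral_cong[THEN iffD1, rotated], goal_cases)
    case (7 t)
    have "of_real b + \<i> * complex_of_real (\<sigma> * 1 * t) \<noteq> 0" using b by (auto simp: complex_eq_iff)
    then show ?case by simp
  qed (use p b in auto)
qed

section \<open>Binomial series and the hypergeometric integral\<close>

lemma of_real_powr_minus_of_nat:
  "x > 0 \<Longrightarrow> complex_of_real x powr (- of_nat l) = of_real ((1 / x) ^ l)"
  by (simp add: powr_minus powr_nat' power_one_over) (simp add: divide_inverse power_inverse)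

lemma pochhammer_eq_gbinomial:
  fixes s x :: complex
  shows "pochhammer s l / fact l * x ^ l = ((- s) gchoose l) * (- x) ^ l"
proof -
  have "((-1) ^ l * (-1) ^ l :: complex) = 1" by (simp flip: power_mult_distrib)
  then show ?thesis
    by (simp add: gbinomial_pochhammer power_minus[of x] mult_ac)
qed

lemma binomial_series_pochhammer:
  fixes s x :: complex
  assumes "norm x < 1"
  shows "(\<lambda>l. pochhammer s l / fact l * x ^ l) sums (1 - x) powr (- s)"
  unfolding pochhammer_eq_gbinomial using gen_binomial_complex[of "- x" "- s"] assms by simp

lemma abs_summable_binomial_series:
  fixes s x :: complex
  assumes "norm x < 1"
  shows "summable (\<lambda>l. norm (pochhammer s l / fact l * x ^ l))"
proof -
  define y where "y = complex_of_real ((norm x + 1) / 2)"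
  have "summable (\<lambda>l. pochhammer s l / fact l * y ^ l)"
    by (rule sums_summable[OF binomial_series_pochhammer]) (use assms in \<open>simp add: y_def\<close>)
  then show ?thesis
  proof (rule powser_insidea)
    have "norm y = (norm x + 1) / 2" unfolding y_def norm_of_real by simp
    then show "norm x < norm y" using assms by simp
  qed
qed

lemma Gamma_nonzero_right_half: "Re z > 0 \<Longrightarrow> Gamma (z :: complex) \<noteq> 0"
  by (auto simp: Gamma_eq_zero_iff elim!: nonpos_Ints_cases)

lemma Gamma_pochhammer_right_half:
  "Re z > 0 \<Longrightarrow> Gamma (z + of_nat l) = pochhammer z l * Gamma (z :: complex)"
proof (induction l)
  case (Suc l)
  have "z + of_nat l \<noteq> 0" using Suc.prems by (auto simp: complex_eq_iff)
  moreover have "z + of_nat l \<notin> \<int>\<^sub>\<le>\<^sub>0" using Suc.prems by (auto elim!: nonpos_Ints_cases simp: complex_eq_iff)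
  ultimately have "Gamma (z + of_nat l + 1) = (z + of_nat l) * Gamma (z + of_nat l)"
    by (intro Gamma_plus1)
  then show ?case using Suc by (simp add: pochhammer_Suc add_ac)
qed auto

text \<open>As \<open>a d - b c = 1\<close>, one has \<open>a t + b = (a / c) (c t + d) (1 - 1 / (a (c t + d)))\<close>;
  the binomial series of the last factor integrates term by term to Beta values.\<close>

lemma has_ray_integral_hypergeo:
  assumes abcd: "a > 0" "b > 0" "c > 0" "d > 0" and det: "a * d - b * c = 1"
    and p: "0 < Re p" "Re p < Re \<kappa>"
  shows "has_ray_integral (\<lambda>t. lin_kernel p s (\<kappa> - s) a b c d (of_real t))
           (of_real a powr (- s) * of_real c powr (s - p) * of_real d powr (p - \<kappa>) *
             (Gamma p * Gamma (\<kappa> - p) / Gamma \<kappa>) *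
             hypergeo_2F1 s (\<kappa> - p) \<kappa> (1 / (of_real a * of_real d)))"
proof -
  define x where "x = 1 / (a * d)"
  have ad: "a * d > 1" using abcd det mult_pos_pos[of b c] by linarith
  have x: "0 < x" "x < 1" using ad abcd by (auto simp: x_def)
  define B where "B = Gamma p * Gamma (\<kappa> - p) / Gamma \<kappa>"
  define K where "K = complex_of_real a powr (- s) * of_real c powr s"
  define w where "w l = pochhammer s l / fact l" for l
  \<comment> \<open>The \<open>l\<close>-th binomial term contains
    \<open>1 / (a * (c * t + d)) ^ l\<close>. Its part in \<open>c * t + d\<close> is merged into
    the exponent \<open>\<kappa> + l\<close>, which leaves an affine Beta integrand.\<close>
  define f where "f l t = K * (w l * of_real a powr (- of_nat l)) *
     (of_real t powr (p - 1) * complex_of_real (c * t + d) powr (- (\<kappa> + of_nat l)))" for l t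
  define I where "I l = K * (w l * of_real a powr (- of_nat l)) *
     (of_real c powr (- p) * of_real d powr (p - (\<kappa> + of_nat l)) *
       (Gamma p * Gamma (\<kappa> + of_nat l - p) / Gamma (\<kappa> + of_nat l)))" for l
  \<comment> \<open>As \<open>c * t + d \<ge> d\<close>, the \<open>l\<close>-th term is at most
    \<open>x ^ l\<close> times a power independent of \<open>l\<close>; here \<open>x < 1\<close>
    because \<open>a * d = 1 + b * c > 1\<close>.\<close>
  define g where "g l t = norm K * (norm (w l) * x ^ l) * (t powr (Re p - 1) * (c * t + d) powr (- Re \<kappa>))" for l t
  define G where "G l = norm K * (norm (w l) * x ^ l) *
    (c powr (- Re p) * d powr (Re p - Re \<kappa>) * (Gamma (Re p) * Gamma (Re \<kappa> - Re p) / Gamma (Re \<kappa>)))" for l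
  have cnt: "countable (UNIV :: nat set)" by simp
  have fI: "has_ray_integral (f l) (I l)" if "l \<in> UNIV" for l
    unfolding f_def I_def using p abcd
    by (intro has_ray_integral_cmult has_ray_integral_Beta_affine) auto
  have gG: "has_ray_integral (g l) (G l)" if "l \<in> UNIV" for l
    unfolding g_def G_def using p abcd
    by (intro has_ray_integral_cmult has_ray_integral_Beta_affine_real) auto
  have powa: "complex_of_real a powr (- of_nat l) = of_real ((1 / a) ^ l)" for l
    using abcd by (intro of_real_powr_minus_of_nat) auto
  have le: "norm (f l t) \<le> g l t" if "l \<in> UNIV" "t > 0" for l t
  proof -
    have ct: "c * t + d > 0" using abcd that by (simp add: add_pos_pos)
    have "norm (complex_of_real (c * t + d) powr (- (\<kappa> + of_nat l))) = (c * t + d) powr (- Re \<kappa> - real l)"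
      using ct by (subst norm_powr_real_powr) auto
    also have "\<dots> = (c * t + d) powr (- Re \<kappa>) * (1 / (c * t + d)) ^ l"
      using ct by (simp add: powr_diff powr_realpow power_one_over)
    also have "\<dots> \<le> (c * t + d) powr (- Re \<kappa>) * (1 / d) ^ l"
      using abcd that ct by (intro mult_left_mono power_mono divide_left_mono) auto
    finally have n: "norm (complex_of_real (c * t + d) powr (- (\<kappa> + of_nat l))) \<le> (c * t + d) powr (- Re \<kappa>) * (1 / d) ^ l" .
    have "norm (f l t) = norm K * (norm (w l) * (1 / a) ^ l) * (t powr (Re p - 1) *
       norm (complex_of_real (c * t + d) powr (- (\<kappa> + of_nat l))))"
    proof -
      have "norm (complex_of_real ((1 / a) ^ l)) = (1 / a) ^ l"
        using abcd by (simp only: norm_of_real) simp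
      moreover have "norm (complex_of_real t powr (p - 1)) = t powr (Re p - 1)"
        using that by (simp add: norm_powr_real_powr)
      ultimately show ?thesis unfolding f_def powa norm_mult by (simp only:)
    qed
    also have "\<dots> \<le> norm K * (norm (w l) * (1 / a) ^ l) * (t powr (Re p - 1) *
       ((c * t + d) powr (- Re \<kappa>) * (1 / d) ^ l))"
      using n abcd by (intro mult_left_mono) auto
    also have "\<dots> = g l t"
    proof -
      have "x ^ l = (1 / a) ^ l * (1 / d) ^ l"
        by (simp add: x_def power_mult_distrib[symmetric])
      then show ?thesis by (simp only: g_def mult_ac)
    qed
    finally show ?thesis .
  qed
  have "norm (w l * of_real x ^ l) = norm (w l) * x ^ l" for l
    using x by (simp add: norm_mult norm_power)
  then have "summable (\<lambda>l. norm (w l) * x ^ l)"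
    using abs_summable_binomial_series[of "of_real x" s, folded w_def] x by simp
  then have sx: "(\<lambda>l. norm (w l) * x ^ l) summable_on UNIV"
    using x by (subst summable_on_UNIV_nonneg_real_iff) auto
  have s: "G summable_on UNIV" unfolding G_def
    by (intro summable_on_cmult_left summable_on_cmult_right sx)
  have ks: "(\<lambda>l. g l t) summable_on UNIV" if "t > 0" for t
    unfolding g_def by (intro summable_on_cmult_left summable_on_cmult_right sx)
  note C = has_ray_integral_infsum(1)[OF cnt fI gG le s ks]
  note C' = has_ray_integral_infsum(2)[OF cnt fI gG le s ks]
  have fsum: "(\<Sum>\<^sub>\<infinity>l. f l t) = lin_kernel p s (\<kappa> - s) a b c d (of_real t)" if t: "t > 0" for t
  proof -
    define y where "y = c * t + d"
    have y: "y > 0" "y \<ge> d" using abcd t by (auto simp: y_def add_pos_pos)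
    have ay: "a * y > 1"
    proof -
      have "a * d \<le> a * y" using y abcd by (intro mult_left_mono) auto
      then show ?thesis using ad by linarith
    qed
    have "c * (a * t + b) = a * y - 1" using det by (simp add: y_def algebra_simps)
    then have "a * t + b = (a * y - 1) / c"
      using abcd by (simp add: eq_divide_eq mult.commute)
    also have "\<dots> = (a * y) * (1 / c) * (1 - 1 / (a * y))"
      using abcd y by (simp add: right_diff_distrib diff_divide_distrib)
    finally have atb: "a * t + b = (a * y) * (1 / c) * (1 - 1 / (a * y))" .
    have S: "(\<lambda>l. w l * complex_of_real (1 / (a * y)) ^ l) sums (1 - of_real (1 / (a * y))) powr (- s)"
      unfolding w_def
    proof (rule binomial_series_pochhammer)
      have "norm (complex_of_real (1 / (a * y))) = 1 / (a * y)"
        using y abcd by (simp only: norm_of_real) simp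
      then show "norm (complex_of_real (1 / (a * y))) < 1" using ay by simp
    qed
    have "(\<lambda>l. (K * of_real t powr (p - 1) * of_real y powr (- \<kappa>)) * (w l * complex_of_real (1 / (a * y)) ^ l)) sums
       ((K * of_real t powr (p - 1) * of_real y powr (- \<kappa>)) * (1 - of_real (1 / (a * y))) powr (- s))"
      by (rule sums_mult[OF S])
    also have "(\<lambda>l. (K * of_real t powr (p - 1) * of_real y powr (- \<kappa>)) * (w l * complex_of_real (1 / (a * y)) ^ l)) = (\<lambda>l. f l t)"
    proof
      fix l
      have 1: "complex_of_real y powr (- (\<kappa> + of_nat l)) = of_real y powr (- \<kappa>) * of_real ((1 / y) ^ l)"
      proof -
        have "- (\<kappa> + of_nat l) = - \<kappa> + (- of_nat l)" by simp
        then have "complex_of_real y powr (- (\<kappa> + of_nat l)) = of_real y powr (- \<kappa>) * of_real y powr (- of_nat l)"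
          by (simp only: powr_add)
        moreover have "complex_of_real y powr (- of_nat l) = of_real ((1 / y) ^ l)"
          using y by (intro of_real_powr_minus_of_nat) auto
        ultimately show ?thesis by simp
      qed
      have 2: "complex_of_real (1 / (a * y)) ^ l = of_real ((1 / a) ^ l) * of_real ((1 / y) ^ l)"
        by (simp add: power_mult_distrib[symmetric])
      show "(K * of_real t powr (p - 1) * of_real y powr (- \<kappa>)) * (w l * complex_of_real (1 / (a * y)) ^ l) = f l t"
        unfolding f_def y_def[symmetric] 1 2 powa by (simp only: mult_ac)
    qed
    finally have s1: "(\<lambda>l. f l t) sums
       ((K * of_real t powr (p - 1) * of_real y powr (- \<kappa>)) * (1 - of_real (1 / (a * y))) powr (- s))" .
    have "(\<lambda>l. norm (f l t)) summable_on UNIV"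
      by (rule summable_on_comparison_test[OF ks[OF t]]) (use le t in auto)
    from has_sum_imp_sums[OF has_sum_infsum[OF abs_summable_summable[OF this]]] s1
    have "(\<Sum>\<^sub>\<infinity>l. f l t) = (K * of_real t powr (p - 1) * of_real y powr (- \<kappa>)) * (1 - of_real (1 / (a * y))) powr (- s)"
      by (rule sums_unique2)
    also have "\<dots> = of_real t powr (p - 1) * of_real (a * t + b) powr (- s) * of_real y powr (- (\<kappa> - s))"
    proof -
      have u: "1 - 1 / (a * y) > 0" using ay y abcd by simp
      have "complex_of_real (a * t + b) = of_real a * (of_real y * (of_real (1 / c) * of_real (1 - 1 / (a * y))))"
        unfolding atb by (simp only: of_real_mult mult_ac)
      moreover have "(complex_of_real x * z) powr (- s) = of_real x powr (- s) * z powr (- s)" if "x > 0" for x z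
        using that by (intro powr_times_real_left) auto
      ultimately have "complex_of_real (a * t + b) powr (- s) =
         of_real a powr (- s) * (of_real y powr (- s) * (of_real (1 / c) powr (- s) * of_real (1 - 1 / (a * y)) powr (- s)))"
        using abcd y u by (simp only: zero_less_divide_1_iff)
      moreover have "complex_of_real (1 / c) powr (- s) = of_real c powr s"
        using abcd by (simp add: powr_def ln_div Ln_of_real flip: of_real_inverse of_real_divide)
      moreover have "complex_of_real y powr (- \<kappa>) = of_real y powr (- s) * of_real y powr (- (\<kappa> - s))"
        by (subst powr_add[symmetric]) simp
      ultimately show ?thesis by (simp add: K_def mult_ac)
    qed
    finally show ?thesis by (simp add: lin_kernel_def y_def)
  qed
  have Isum: "(\<Sum>\<^sub>\<infinity>l. I l) = of_real a powr (- s) * of_real c powr (s - p) * of_real d powr (p - \<kappa>) * B *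
             hypergeo_2F1 s (\<kappa> - p) \<kappa> (1 / (of_real a * of_real d))"
  proof -
    define L where "L = of_real a powr (- s) * of_real c powr (s - p) * of_real d powr (p - \<kappa>) * B"
    have gz: "Gamma p \<noteq> 0" "Gamma (\<kappa> - p) \<noteq> 0" "Gamma \<kappa> \<noteq> 0"
      using p by (auto intro!: Gamma_nonzero_right_half)
    have L0: "L \<noteq> 0" using abcd gz by (simp add: L_def B_def)
    \<comment> \<open>The quotient of \<open>Gamma (\<kappa> - p + l)\<close> by
      \<open>Gamma (\<kappa> + l)\<close> supplies two Pochhammer symbols, the binomial coefficient
      the third one together with \<open>fact l\<close>.\<close>
    have IL: "I l = L * (pochhammer s l * pochhammer (\<kappa> - p) l / (pochhammer \<kappa> l * fact l) * (1 / (of_real a * of_real d)) ^ l)" for l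
    proof -
      have 1: "Gamma (\<kappa> + of_nat l - p) = pochhammer (\<kappa> - p) l * Gamma (\<kappa> - p)"
        using Gamma_pochhammer_right_half[of "\<kappa> - p" l] p by (simp add: algebra_simps)
      have 2: "Gamma (\<kappa> + of_nat l) = pochhammer \<kappa> l * Gamma \<kappa>"
        using Gamma_pochhammer_right_half[of "\<kappa>" l] p by simp
      have 3: "complex_of_real d powr (p - (\<kappa> + of_nat l)) = of_real d powr (p - \<kappa>) * of_real ((1 / d) ^ l)"
      proof -
        have "p - (\<kappa> + of_nat l) = (p - \<kappa>) + (- of_nat l)" by simp
        then have "complex_of_real d powr (p - (\<kappa> + of_nat l)) = of_real d powr (p - \<kappa>) * of_real d powr (- of_nat l)"
          by (simp only: powr_add)
        moreover have "complex_of_real d powr (- of_nat l) = of_real ((1 / d) ^ l)"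
          using abcd by (intro of_real_powr_minus_of_nat) auto
        ultimately show ?thesis by simp
      qed
      have 4: "complex_of_real c powr (s - p) = of_real c powr s * of_real c powr (- p)"
        by (subst powr_add[symmetric]) simp
      have 5: "(1 / (of_real a * of_real d)) ^ l = complex_of_real ((1 / a) ^ l) * of_real ((1 / d) ^ l)"
        by (simp add: power_mult_distrib[symmetric])
      show ?thesis
        unfolding I_def L_def B_def K_def w_def powa 1 2 3 4 5 by (simp add: field_simps)
    qed
    have "I summable_on UNIV" by (rule abs_summable_summable[OF C'])
    then have "(\<lambda>l. L * (pochhammer s l * pochhammer (\<kappa> - p) l / (pochhammer \<kappa> l * fact l) * (1 / (of_real a * of_real d)) ^ l)) sums infsum I UNIV"
      using has_sum_imp_sums[OF has_sum_infsum] by (simp only: IL[symmetric])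
    \<comment> \<open>\<open>hypergeo_2F1\<close> is a \<open>suminf\<close>, so its series itself
      has to be shown to converge; dividing by the nonzero \<open>L\<close> gives convergence and
      value together.\<close>
    from sums_mult[OF this, of "inverse L"]
    have "(\<lambda>l. pochhammer s l * pochhammer (\<kappa> - p) l / (pochhammer \<kappa> l * fact l) * (1 / (of_real a * of_real d)) ^ l) sums (inverse L * infsum I UNIV)"
      using L0 by (simp add: mult.assoc[symmetric])
    then have "hypergeo_2F1 s (\<kappa> - p) \<kappa> (1 / (of_real a * of_real d)) = inverse L * infsum I UNIV"
      by (simp add: hypergeo_2F1_def sums_iff)
    then show ?thesis using L0 by (simp add: L_def[symmetric])
  qed
  have "has_ray_integral (\<lambda>t. \<Sum>\<^sub>\<infinity>l. f l t) (infsum I UNIV)"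
    by (rule C)
  then have "has_ray_integral (\<lambda>t. lin_kernel p s (\<kappa> - s) a b c d (of_real t)) (infsum I UNIV)"
    by (rule has_ray_integral_cong[THEN iffD1, rotated]) (rule fsum)
  then show ?thesis unfolding Isum B_def .
qed

text \<open>The absolute values of the entries of a determinant 1 matrix without zero entries:
  \<open>\<epsilon> = 1\<close> if its diagonal product is positive, \<open>\<epsilon> = - 1\<close>
  if it is negative.\<close>

definition pos_quads :: "int \<Rightarrow> (int \<times> int \<times> int \<times> int) set" where
  "pos_quads \<epsilon> = {(a, b, c, d). a > 0 \<and> b > 0 \<and> c > 0 \<and> d > 0 \<and> a * d - b * c = \<epsilon>}"

text \<open>For a matrix with signs removed, \<open>\<sigma>\<close> records the sign of
  \<open>a * b\<close>, which is also that of \<open>c * d\<close>. Both bases lie in the right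
  half-plane when \<open>b\<close> and \<open>d\<close> are positive, so splitting the power of the
  quotient crosses no branch cut.\<close>

definition quad_term :: "real \<Rightarrow> complex \<Rightarrow> complex \<Rightarrow> int \<times> int \<times> int \<times> int \<Rightarrow> real \<Rightarrow> complex" where
  "quad_term \<sigma> s \<kappa> = (\<lambda>(a, b, c, d) t.
     (of_int b + \<i> * of_real (\<sigma> * of_int a * t)) powr (- s) *
     (of_int d + \<i> * of_real (\<sigma> * of_int c * t)) powr (- (\<kappa> - s)))"

section \<open>Domination of the sums over positive quadruples\<close>

lemma greaterThan_0_int_eq: "{0<..} = range (\<lambda>n. int (Suc n))"
proof -
  have "x \<in> range (\<lambda>n. int (Suc n))" if "x > 0" for x
    using that by (intro image_eqI[of _ _ "nat (x - 1)"]) auto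
  then show ?thesis by auto
qed

lemma summable_on_pos_int_powr:
  assumes "\<sigma> > (1::real)"
  shows "(\<lambda>n::int. of_int n powr - \<sigma>) summable_on {0<..}"
  unfolding greaterThan_0_int_eq using summable_on_Suc_powr[OF assms]
  by (subst summable_on_reindex) (auto simp: o_def inj_def)

lemma summable_on_times_nonneg:
  fixes f :: "'a \<Rightarrow> real" and g :: "'b \<Rightarrow> real"
  assumes "f summable_on A" "g summable_on B" "\<And>x. x \<in> A \<Longrightarrow> f x \<ge> 0" "\<And>y. y \<in> B \<Longrightarrow> g y \<ge> 0"
  shows "(\<lambda>(x, y). f x * g y) summable_on A \<times> B"
proof (rule summable_on_SigmaI)
  show "((\<lambda>y. case (x, y) of (x, y) \<Rightarrow> f x * g y) has_sum f x * infsum g B) B" if "x \<in> A" for x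
    using assms(2) by (auto intro!: has_sum_cmult_right)
  show "(\<lambda>x. f x * infsum g B) summable_on A"
    by (rule summable_on_cmult_left[OF assms(1)])
qed (use assms in auto)

text \<open>Given \<open>a\<close>, \<open>b\<close> and \<open>d\<close>, the entry \<open>c = (a d - \<epsilon>) / b \<le> 2 a d / b\<close> is determined, so the sum is
  dominated by a product of three zeta series.\<close>

lemma summable_on_pos_quads:
  fixes P S K :: real
  assumes \<epsilon>: "\<epsilon> = 1 \<or> \<epsilon> = -1" and h: "P > 1" "S - P > 1" "K - S > 1"
  shows "(\<lambda>(a, b, c, d). of_int a powr - S * of_int c powr (S - P) * of_int d powr (P - K)) summable_on pos_quads \<epsilon>"
proof -
  define F :: "int \<Rightarrow> real" where "F n = of_int n powr - P" for n
  define G :: "int \<Rightarrow> real" where "G n = of_int n powr - (S - P)" for n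
  define H :: "int \<Rightarrow> real" where "H n = of_int n powr - (K - S)" for n
  have FGH: "F summable_on {0<..}" "G summable_on {0<..}" "H summable_on {0<..}"
    unfolding F_def G_def H_def
    by (rule summable_on_pos_int_powr[OF h(1)], rule summable_on_pos_int_powr[OF h(2)],
        rule summable_on_pos_int_powr[OF h(3)])
  define GH where "GH = (\<lambda>(b, d). G b * H d)"
  have "GH summable_on {0<..} \<times> {0<..}"
    unfolding GH_def by (rule summable_on_times_nonneg[OF FGH(2,3)]) (auto simp: G_def H_def)
  then have s3: "(\<lambda>(a, bd). F a * GH bd) summable_on {0<..} \<times> ({0<..} \<times> {0<..})"
    by (rule summable_on_times_nonneg[OF FGH(1)]) (auto simp: F_def GH_def G_def H_def)
  define \<phi> :: "int \<times> int \<times> int \<times> int \<Rightarrow> int \<times> int \<times> int" where "\<phi> = (\<lambda>(a, b, c, d). (a, b, d))"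
  have inj: "inj_on \<phi> (pos_quads \<epsilon>)"
  proof (rule inj_onI)
    fix x y assume q: "x \<in> pos_quads \<epsilon>" "y \<in> pos_quads \<epsilon>" and e: "\<phi> x = \<phi> y"
    obtain a b c d where x: "x = (a, b, c, d)" by (cases x)
    obtain c' where y: "y = (a, b, c', d)" using e x by (cases y) (auto simp: \<phi>_def)
    have "b * c = b * c'" "b \<noteq> 0" using q by (auto simp: x y pos_quads_def)
    then show "x = y" by (simp add: x y)
  qed
  have "(\<lambda>(a, bd). F a * GH bd) summable_on \<phi> ` pos_quads \<epsilon>"
    by (rule summable_on_subset_banach[OF s3]) (auto simp: \<phi>_def pos_quads_def)
  then have s4: "(\<lambda>q. 2 powr (S - P) * ((\<lambda>(a, bd). F a * GH bd) \<circ> \<phi>) q) summable_on pos_quads \<epsilon>"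
    unfolding summable_on_reindex[OF inj] by (rule summable_on_cmult_right)
  show ?thesis
  proof (rule summable_on_comparison_test[OF s4])
    fix q assume "q \<in> pos_quads \<epsilon>"
    then obtain a b c d where q: "q = (a, b, c, d)" and p: "a > 0" "b > 0" "c > 0" "d > 0"
      and det: "a * d - b * c = \<epsilon>" by (auto simp: pos_quads_def)
    have "a * d > 0" using p by simp
    \<comment> \<open>\<open>b * c = a * d - \<epsilon>\<close> and \<open>a * d \<ge> 1\<close>;
      the factor 2 absorbs \<open>\<epsilon> = - 1\<close>.\<close>
    then have "b * c \<le> 2 * (a * d)" using det \<epsilon> by linarith
    then have "real_of_int (b * c) \<le> real_of_int (2 * (a * d))" by (simp only: of_int_le_iff)
    then have "of_int c \<le> 2 * (of_int a * of_int d) / (of_int b :: real)"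
      using p by (simp add: field_simps)
    then have "of_int c powr (S - P) \<le> (2 * (of_int a * of_int d) / of_int b) powr (S - P)"
      using p h by (intro powr_mono2) auto
    also have "\<dots> = 2 powr (S - P) * of_int a powr (S - P) * of_int d powr (S - P) * of_int b powr - (S - P)"
    proof -
      have "(2 * (x * y) / z) powr e = 2 powr e * x powr e * y powr e * z powr - e"
        if "x > 0" "y > 0" "z > 0" for x y z e :: real
        using that by (simp add: powr_mult powr_divide powr_minus_divide)
      then show ?thesis using p by simp
    qed
    finally have "of_int a powr - S * of_int c powr (S - P) * of_int d powr (P - K) \<le>
      of_int a powr - S * (2 powr (S - P) * of_int a powr (S - P) * of_int d powr (S - P) * of_int b powr - (S - P)) * of_int d powr (P - K)"
      by (intro mult_right_mono mult_left_mono) auto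
    also have "\<dots> = 2 powr (S - P) * ((of_int a powr - S * of_int a powr (S - P)) *
         (of_int b powr - (S - P) * (of_int d powr (S - P) * of_int d powr (P - K))))"
      by (simp only: mult_ac)
    also have "of_int a powr - S * of_int a powr (S - P) = F a"
      by (simp add: F_def powr_add[symmetric])
    also have "of_int d powr (S - P) * of_int d powr (P - K) = H d"
      by (simp add: H_def powr_add[symmetric])
    finally show "(case q of (a, b, c, d) \<Rightarrow> of_int a powr - S * of_int c powr (S - P) * of_int d powr (P - K)) \<le>
        2 powr (S - P) * ((\<lambda>(a, bd). F a * GH bd) \<circ> \<phi>) q"
      by (simp add: q \<phi>_def GH_def G_def)
  qed (auto simp: pos_quads_def)
qed

text \<open>The values \<open>J\<close> are left open, as only those for
  \<open>\<epsilon> = 1\<close> are ever evaluated. For the majorant, \<open>b + a * t\<close> is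
  bounded below by a multiple of \<open>d + c * t\<close>, so both factors merge into one power of
  \<open>c * t + d\<close>, whose Beta integral is a constant times the weight
  \<open>W\<close>.\<close>

lemma has_ray_integral_pos_quads:
  fixes J :: "int \<times> int \<times> int \<times> int \<Rightarrow> complex"
  assumes \<epsilon>: "\<epsilon> = 1 \<or> \<epsilon> = -1" and \<sigma>: "\<sigma> = 1 \<or> \<sigma> = (-1::real)"
    and h: "Re p > 1" "Re s - Re p > 1" "Re \<kappa> - Re s > 1"
    and J: "\<And>a b c d. (a, b, c, d) \<in> pos_quads \<epsilon> \<Longrightarrow> has_ray_integral
        (\<lambda>t. lin_kernel p s (\<kappa> - s) (of_int a) (of_int b) (of_int c) (of_int d) (of_real t)) (J (a, b, c, d))"
  shows "has_ray_integral (\<lambda>t. of_real t powr (p - 1) * (\<Sum>\<^sub>\<infinity>q\<in>pos_quads \<epsilon>. quad_term \<sigma> s \<kappa> q t))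
           (exp (- (of_real \<sigma> * \<i> * of_real pi * p / 2)) * (\<Sum>\<^sub>\<infinity>q\<in>pos_quads \<epsilon>. J q))"
    and "J summable_on pos_quads \<epsilon>"
    and "\<And>t. t > 0 \<Longrightarrow> (\<lambda>q. quad_term \<sigma> s \<kappa> q t) summable_on pos_quads \<epsilon>"
proof -
  define P S K where "P = Re p" and "S = Re s" and "K = Re \<kappa>"
  have PSK: "P > 1" "S - P > 1" "K - S > 1" using h by (auto simp: P_def S_def K_def)
  define E where "E = exp (- (of_real \<sigma> * \<i> * of_real pi * p / 2))"
  define W :: "int \<times> int \<times> int \<times> int \<Rightarrow> real" where
    "W = (\<lambda>(a, b, c, d). of_int a powr - S * of_int c powr (S - P) * of_int d powr (P - K))"
  have W: "W summable_on pos_quads \<epsilon>"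
    unfolding W_def by (rule summable_on_pos_quads[OF \<epsilon> PSK])
  \<comment> \<open>One factor from the norm estimate of each linear factor, and
    \<open>2 powr S\<close> from comparing the two linear factors.\<close>
  define C where "C = exp (pi * \<bar>Im s\<bar>) * 2 powr \<bar>S\<bar> * (exp (pi * \<bar>Im (\<kappa> - s)\<bar>) * 2 powr \<bar>K - S\<bar>) * 2 powr S"
  have C0: "C \<ge> 0" by (simp add: C_def)
  define f where "f q t = of_real t powr (p - 1) * quad_term \<sigma> s \<kappa> q t" for q t
  define g :: "int \<times> int \<times> int \<times> int \<Rightarrow> real \<Rightarrow> real" where
    "g = (\<lambda>(a, b, c, d) t. C * (of_int a powr - S * of_int c powr S) * (t powr (P - 1) * (of_int c * t + of_int d) powr - K))"
  define B where "B = Gamma P * Gamma (K - P) / Gamma K"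
  have cnt: "countable (pos_quads \<epsilon>)" by simp
  have f: "has_ray_integral (f q) (E * J q)" if "q \<in> pos_quads \<epsilon>" for q
  proof -
    obtain a b c d where q: "q = (a, b, c, d)" by (cases q)
    then have pos: "a > 0" "b > 0" "c > 0" "d > 0" using that by (auto simp: pos_quads_def)
    have "has_ray_integral (\<lambda>t. of_real t powr (p - 1) *
            ((of_real (of_int b) + \<i> * of_real (\<sigma> * of_int a * t)) powr (- s) *
             (of_real (of_int d) + \<i> * of_real (\<sigma> * of_int c * t)) powr (- (\<kappa> - s))))
          (E * J q)"
      unfolding E_def
      by (rule has_ray_integral_lin_kernel_imaginary[OF _ _ _ _ \<sigma>]) (use pos h J that q in auto)
    then show ?thesis by (simp add: f_def[abs_def] quad_term_def q)
  qed
  have g: "has_ray_integral (g q) (C * B * W q)" if "q \<in> pos_quads \<epsilon>" for q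
  proof -
    obtain a b c d where q: "q = (a, b, c, d)" by (cases q)
    then have pos: "a > 0" "b > 0" "c > 0" "d > 0" using that by (auto simp: pos_quads_def)
    have "has_ray_integral (g q) (C * (of_int a powr - S * of_int c powr S) *
        (of_int c powr - P * of_int d powr (P - K) * B))"
      unfolding g_def q prod.case B_def using PSK pos
      by (intro has_ray_integral_cmult has_ray_integral_Beta_affine_real) auto
    also have "C * (of_int a powr - S * of_int c powr S) * (of_int c powr - P * of_int d powr (P - K) * B) =
       C * B * (of_int a powr - S * (of_int c powr S * of_int c powr - P) * of_int d powr (P - K))"
      by (simp only: mult_ac)
    also have "of_int c powr S * of_int c powr - P = of_int c powr (S - P)"
      by (simp add: powr_add[symmetric])
    finally show ?thesis by (simp add: W_def q)
  qed
  have le: "norm (f q t) \<le> g q t" if "q \<in> pos_quads \<epsilon>" "t > 0" for q t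
  proof -
    obtain a b c d where q: "q = (a, b, c, d)" by (cases q)
    then have pos: "a > 0" "b > 0" "c > 0" "d > 0" and det: "a * d - b * c = \<epsilon>"
      using that by (auto simp: pos_quads_def)
    define x y :: real where "x = of_int b + of_int a * t" and "y = of_int d + of_int c * t"
    have xy: "x > 0" "y > 0" using pos that by (auto simp: x_def y_def add_pos_pos)
    have "b * c > 0" using pos by simp
    \<comment> \<open>From \<open>a * d = b * c + \<epsilon>\<close> and
      \<open>b * c \<ge> 1\<close>. It follows that
      \<open>b + a * t \<ge> a / (2 * c) * (d + c * t)\<close>.\<close>
    then have "a * d \<le> 2 * (b * c)" using det \<epsilon> by linarith
    then have "real_of_int (a * d) \<le> real_of_int (2 * (b * c))" by (simp only: of_int_le_iff)
    moreover have "0 \<le> real_of_int a * of_int c * t" using pos that by simp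
    moreover have "of_int a * y = real_of_int (a * d) + of_int a * of_int c * t"
      "2 * of_int c * x = real_of_int (2 * (b * c)) + 2 * (of_int a * of_int c * t)"
      by (simp_all add: x_def y_def algebra_simps)
    ultimately have "of_int a * y \<le> 2 * of_int c * x" by linarith
    then have "of_int a / (2 * of_int c) * y \<le> x"
      using pos by (simp add: field_simps)
    then have "x powr - S \<le> (of_int a / (2 * of_int c) * y) powr - S"
      using pos xy PSK by (intro powr_mono2') auto
    also have "\<dots> = of_int a powr - S * of_int c powr S * 2 powr S * y powr - S"
    proof -
      have "(u / (2 * v) * w) powr - S = u powr - S * v powr S * 2 powr S * w powr - S"
        if "u > 0" "v > 0" "w > 0" for u v w :: real
        using that by (simp add: powr_mult powr_divide powr_minus_divide)
      then show ?thesis using pos xy by simp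
    qed
    finally have xS: "x powr - S \<le> of_int a powr - S * of_int c powr S * 2 powr S * y powr - S" .
    have abs: "\<bar>\<sigma> * of_int n * t\<bar> = of_int n * t" if "n > 0" for n :: int
      using \<sigma> that \<open>t > 0\<close> by (auto simp: abs_mult)
    define C1 C2 where "C1 = exp (pi * \<bar>Im s\<bar>) * 2 powr \<bar>S\<bar>" and "C2 = exp (pi * \<bar>Im (\<kappa> - s)\<bar>) * 2 powr \<bar>K - S\<bar>"
    have n1: "norm ((of_int b + \<i> * of_real (\<sigma> * of_int a * t)) powr (- s)) \<le> C1 * x powr - S"
      using norm_powr_shift_le[of "of_int b" "\<sigma> * of_int a * t" s] pos abs[OF pos(1)]
      by (simp add: C1_def S_def x_def)
    have n2: "norm ((of_int d + \<i> * of_real (\<sigma> * of_int c * t)) powr (- (\<kappa> - s))) \<le> C2 * y powr - (K - S)"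
      using norm_powr_shift_le[of "of_int d" "\<sigma> * of_int c * t" "\<kappa> - s"] pos abs[OF pos(3)]
      by (simp add: C2_def S_def K_def y_def)
    have "norm (quad_term \<sigma> s \<kappa> q t) \<le> (C1 * x powr - S) * (C2 * y powr - (K - S))"
      unfolding quad_term_def q prod.case norm_mult
      using n1 n2 by (intro mult_mono') auto
    also have "\<dots> \<le> (C1 * (of_int a powr - S * of_int c powr S * 2 powr S * y powr - S)) * (C2 * y powr - (K - S))"
      using xS by (intro mult_mono) (auto simp: C1_def C2_def)
    also have "\<dots> = C * (of_int a powr - S * of_int c powr S) * (y powr - S * y powr - (K - S))"
      unfolding C_def C1_def C2_def by (simp only: mult_ac)
    also have "y powr - S * y powr - (K - S) = y powr - K"
      by (simp add: powr_add[symmetric])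
    finally have "norm (quad_term \<sigma> s \<kappa> q t) \<le> C * (of_int a powr - S * of_int c powr S) * y powr - K" .
    then have "t powr (P - 1) * norm (quad_term \<sigma> s \<kappa> q t) \<le>
        t powr (P - 1) * (C * (of_int a powr - S * of_int c powr S) * y powr - K)"
      by (intro mult_left_mono) auto
    moreover have "norm (f q t) = t powr (P - 1) * norm (quad_term \<sigma> s \<kappa> q t)"
      using that by (simp add: f_def norm_mult norm_powr_real_powr P_def)
    moreover have "t powr (P - 1) * (C * (of_int a powr - S * of_int c powr S) * y powr - K) = g q t"
      by (simp add: g_def q y_def mult_ac add_ac)
    ultimately show ?thesis by simp
  qed
  have sum: "(\<lambda>q. C * B * W q) summable_on pos_quads \<epsilon>"
    by (rule summable_on_cmult_right[OF W])
  have pt: "(\<lambda>q. g q t) summable_on pos_quads \<epsilon>" if "t > 0" for t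
  proof (rule summable_on_comparison_test)
    show "(\<lambda>q. C * t powr (P - 1) * t powr - P * W q) summable_on pos_quads \<epsilon>"
      by (rule summable_on_cmult_right[OF W])
    fix q assume "q \<in> pos_quads \<epsilon>"
    then obtain a b c d where q: "q = (a, b, c, d)" and pos: "a > 0" "b > 0" "c > 0" "d > 0"
      by (auto simp: pos_quads_def)
    define y :: real where "y = of_int c * t + of_int d"
    have y: "0 < of_int c * t" "of_int c * t \<le> y" "of_int d \<le> y" "0 < y"
      using pos that by (auto simp: y_def add_pos_pos)
    \<comment> \<open>Bounding \<open>y\<close> below by \<open>c * t\<close> in one part and by
      \<open>d\<close> in the other restores the weight \<open>W\<close>, so pointwise summability
      at a fixed \<open>t\<close> rests on the same series as that of the integrals.\<close>
    have "y powr - K = y powr - P * y powr (P - K)" by (simp add: powr_add[symmetric])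
    also have "\<dots> \<le> (of_int c * t) powr - P * of_int d powr (P - K)"
      using y pos PSK by (intro mult_mono powr_mono2') auto
    also have "(of_int c * t) powr - P = of_int c powr - P * t powr - P"
      using pos that by (simp add: powr_mult)
    finally have "C * (of_int a powr - S * of_int c powr S) * t powr (P - 1) * y powr - K \<le>
       C * (of_int a powr - S * of_int c powr S) * t powr (P - 1) * (of_int c powr - P * t powr - P * of_int d powr (P - K))"
      using C0 by (intro mult_left_mono) auto
    also have "\<dots> = C * t powr (P - 1) * t powr - P * (of_int a powr - S * (of_int c powr S * of_int c powr - P) * of_int d powr (P - K))"
      by (simp only: mult_ac)
    also have "of_int c powr S * of_int c powr - P = of_int c powr (S - P)"
      by (simp add: powr_add[symmetric])
    finally show "g q t \<le> C * t powr (P - 1) * t powr - P * W q"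
      by (simp add: g_def W_def q y_def mult_ac)
    show "0 \<le> g q t" using C0 by (simp add: g_def q)
  qed
  have fsum: "(\<lambda>q. f q t) summable_on pos_quads \<epsilon>" if "t > 0" for t
  proof -
    have "(\<lambda>q. norm (f q t)) summable_on pos_quads \<epsilon>"
      by (rule summable_on_comparison_test[OF pt[OF that]]) (use le that in auto)
    then show ?thesis by (rule abs_summable_summable)
  qed
  show "(\<lambda>q. quad_term \<sigma> s \<kappa> q t) summable_on pos_quads \<epsilon>" if "t > 0" for t
    using fsum[OF that] that unfolding f_def by (subst (asm) summable_on_cmult_right') auto
  have "has_ray_integral (\<lambda>t. \<Sum>\<^sub>\<infinity>q\<in>pos_quads \<epsilon>. f q t) (\<Sum>\<^sub>\<infinity>q\<in>pos_quads \<epsilon>. E * J q)"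
    by (rule has_ray_integral_infsum(1)[OF cnt f g le sum pt])
  then show "has_ray_integral (\<lambda>t. of_real t powr (p - 1) * (\<Sum>\<^sub>\<infinity>q\<in>pos_quads \<epsilon>. quad_term \<sigma> s \<kappa> q t))
           (exp (- (of_real \<sigma> * \<i> * of_real pi * p / 2)) * (\<Sum>\<^sub>\<infinity>q\<in>pos_quads \<epsilon>. J q))"
    unfolding f_def infsum_cmult_right' E_def .
  have "(\<lambda>q. norm (E * J q)) summable_on pos_quads \<epsilon>"
    by (rule has_ray_integral_infsum(2)[OF cnt f g le sum pt])
  from abs_summable_summable[OF this] show "J summable_on pos_quads \<epsilon>"
    by (subst (asm) summable_on_cmult_right') (auto simp: E_def)
qed

section \<open>The terms of the kernel on the imaginary axis\<close>

text \<open>Both arguments lie strictly between -\<pi>/2 and \<pi>/2, so their difference is again a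
  principal argument.\<close>

lemma powr_divide_right_half:
  assumes "Re x > 0" "Re y > 0"
  shows "(x / y) powr w = x powr w / y powr w"
proof -
  have nz: "x \<noteq> 0" "y \<noteq> 0" using assms by auto
  have y: "y \<notin> \<real>\<^sub>\<le>\<^sub>0" using assms by (auto simp: complex_nonpos_Reals_iff)
  have i: "Ln (inverse y) = - Ln y" by (rule Ln_inverse[OF y])
  have "- (pi / 2) < Im (Ln x)" "Im (Ln x) < pi / 2" "- (pi / 2) < Im (Ln y)" "Im (Ln y) < pi / 2"
    using Re_Ln_pos_lt_imp[OF assms(1)] Re_Ln_pos_lt_imp[OF assms(2)] unfolding abs_less_iff by linarith+
  then have "Ln (x * inverse y) = Ln x + Ln (inverse y)"
    using nz by (intro Ln_times_simple) (simp_all add: i)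
  then have "Ln (x / y) = Ln x - Ln y" by (simp only: divide_inverse i) simp
  then show ?thesis using nz by (simp add: powr_def right_diff_distrib exp_diff)
qed

text \<open>Below the real axis \<open>Arg w\<close> is negative, and \<open>- w\<close> has the
  principal argument \<open>Arg w + pi\<close>. This is the source of the branch factor exp (- \<i>
  \<pi> s).\<close>

lemma powr_uminus_lower_half_plane:
  assumes "Im w < 0"
  shows "(- w) powr (- s) = exp (- (of_real pi * \<i> * s)) * w powr (- s)"
proof -
  have nz: "w \<noteq> 0" using assms by auto
  have "Ln (- w) = Ln w + \<i> * of_real pi" using nz assms by (simp add: Ln_minus)
  then show ?thesis using nz by (simp add: powr_def exp_add[symmetric] algebra_simps)
qed

lemma powr_times_ii_right_half:
  assumes "Re z > 0"
  shows "(\<i> * z) powr w = exp (of_real pi * \<i> * w / 2) * z powr w"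
    and "(- \<i> * z) powr w = exp (- (of_real pi * \<i> * w / 2)) * z powr w"
proof -
  have nz: "z \<noteq> 0" using assms by auto
  have b: "\<bar>Im (Ln z)\<bar> < pi / 2" by (rule Re_Ln_pos_lt_imp[OF assms])
  have 1: "Ln (\<i> * z) = Ln \<i> + Ln z"
    using nz b by (intro Ln_times_simple) auto
  show "(\<i> * z) powr w = exp (of_real pi * \<i> * w / 2) * z powr w"
    unfolding powr_def 1 using nz by (simp add: exp_add[symmetric] algebra_simps)
  have 2: "Ln (- \<i> * z) = Ln (- \<i>) + Ln z"
    using nz b by (intro Ln_times_simple) auto
  show "(- \<i> * z) powr w = exp (- (of_real pi * \<i> * w / 2)) * z powr w"
    unfolding powr_def 2 using nz by (simp add: exp_add[symmetric] algebra_simps)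
qed

section \<open>Values of the kernel terms for each sign pattern\<close>

definition quad_matrix :: "int \<times> int \<times> int \<times> int \<Rightarrow> int^2^2" where
  "quad_matrix = (\<lambda>(a, b, c, d). vector [vector [a, b], vector [c, d]])"

lemma kernel_term_quad_matrix:
  "kernel_term k s z (quad_matrix (a, b, c, d)) =
     (of_int c * z + of_int d) powi (- k) * ((of_int a * z + of_int b) / (of_int c * z + of_int d)) powr (- s)"
  by (simp add: kernel_term_def quad_matrix_def)

lemma Im_divide_less_0_iff:
  assumes "y \<noteq> 0"
  shows "Im (x / y) < 0 \<longleftrightarrow> Im x * Re y < Re x * Im y"
proof -
  have "(Re y)\<^sup>2 + (Im y)\<^sup>2 > 0"
    using assms by (simp add: complex_neq_0)
  then show ?thesis by (simp add: Im_divide divide_less_0_iff)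
qed

context
  fixes a b c d :: int and t :: real and k :: int and s :: complex
  assumes abcd: "a \<ge> 0" "b > 0" "c \<ge> 0" "d > 0" and t: "t > 0" and k: "even k"
begin

lemma kernel_quotient_aux:
  assumes "\<sigma> = 1 \<or> \<sigma> = (-1::real)"
  defines "x \<equiv> of_int b + \<i> * of_real (\<sigma> * of_int a * t)"
  defines "y \<equiv> of_int d + \<i> * of_real (\<sigma> * of_int c * t)"
  shows "y powi (- k) * (x / y) powr (- s) = quad_term \<sigma> s (of_int k) (a, b, c, d) t"
proof -
  have re: "Re x > 0" "Re y > 0" using abcd by (auto simp: x_def y_def)
  then have nz: "y \<noteq> 0" by auto
  have "y powi (- k) = y powr (of_int (- k))" 
    by (rule complex_powr_of_int[symmetric]) (use nz in auto)
  then have eq: "y powi (- k) / y powr (- s) = y powr (- (of_int k - s))"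
    using powr_diff[of y "of_int (- k)" "- s"] by simp
  show ?thesis
    unfolding powr_divide_right_half[OF re] quad_term_def prod.case x_def[symmetric] y_def[symmetric] eq[symmetric]
    by simp
qed

lemma kernel_term_pos:
  "kernel_term k s (\<i> * of_real t) (quad_matrix (a, b, c, d)) = quad_term 1 s (of_int k) (a, b, c, d) t"
  using kernel_quotient_aux[of 1] by (simp add: kernel_term_quad_matrix algebra_simps)

text \<open>Numerator and denominator change sign together, so the quotient is unaffected, and
  evenness of \<open>k\<close> absorbs the sign in the automorphy factor.\<close>

lemma kernel_term_alternating:
  "kernel_term k s (\<i> * of_real t) (quad_matrix (a, - b, c, - d)) = quad_term (-1) s (of_int k) (a, b, c, d) t"
proof -
  define x where "x = of_int b + \<i> * complex_of_real ((-1) * of_int a * t)"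
  define y where "y = of_int d + \<i> * complex_of_real ((-1) * of_int c * t)"
  have aux: "y powi (- k) * (x / y) powr (- s) = quad_term (-1) s (of_int k) (a, b, c, d) t"
    using kernel_quotient_aux[of "-1"] by (simp add: x_def y_def)
  have e: "of_int a * (\<i> * of_real t) + of_int (- b) = - x" "of_int c * (\<i> * of_real t) + of_int (- d) = - y"
    by (simp_all add: x_def y_def algebra_simps)
  show ?thesis
    unfolding kernel_term_quad_matrix e minus_divide_divide power_int_minus_left
    using aux k by simp
qed

text \<open>The signed matrix maps the upper half-plane to itself and its quotient is
  \<open>- (x / y)\<close>. Hence \<open>x / y\<close> lies below the real axis, and passing from
  \<open>x / y\<close> to its negative costs the branch factor.\<close>

lemma kernel_term_neg_antidiagonal:
  assumes det: "a * d - b * c = 1"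
  shows "kernel_term k s (\<i> * of_real t) (quad_matrix (a, - b, - c, d)) =
           exp (- (of_real pi * \<i> * s)) * quad_term (-1) s (of_int k) (a, b, c, d) t"
proof -
  define x where "x = of_int b + \<i> * complex_of_real ((-1) * of_int a * t)"
  define y where "y = of_int d + \<i> * complex_of_real ((-1) * of_int c * t)"
  have aux: "y powi (- k) * (x / y) powr (- s) = quad_term (-1) s (of_int k) (a, b, c, d) t"
    using kernel_quotient_aux[of "-1"] by (simp add: x_def y_def)
  have e: "of_int a * (\<i> * of_real t) + of_int (- b) = - x" "of_int (- c) * (\<i> * of_real t) + of_int d = y"
    by (simp_all add: x_def y_def algebra_simps)
  have nz: "y \<noteq> 0" using abcd by (auto simp: y_def complex_eq_iff)
  have "real_of_int (a * d - b * c) * t > 0" using det t by simp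
  then have "Im (x / y) < 0"
    unfolding Im_divide_less_0_iff[OF nz] by (simp add: x_def y_def algebra_simps)
  from powr_uminus_lower_half_plane[OF this, of s] show ?thesis
    unfolding kernel_term_quad_matrix e aux[symmetric] by (simp add: mult.left_commute)
qed

text \<open>Determinant -1 for the unsigned entries means 1 for the signed matrix, so the quotient
  \<open>- (x / y)\<close> again lies above the real axis.\<close>

lemma kernel_term_neg_lower_row:
  assumes det: "a * d - b * c = -1"
  shows "kernel_term k s (\<i> * of_real t) (quad_matrix (a, b, - c, - d)) =
           exp (- (of_real pi * \<i> * s)) * quad_term 1 s (of_int k) (a, b, c, d) t"
proof -
  define x where "x = of_int b + \<i> * complex_of_real (1 * of_int a * t)"
  define y where "y = of_int d + \<i> * complex_of_real (1 * of_int c * t)"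
  have aux: "y powi (- k) * (x / y) powr (- s) = quad_term 1 s (of_int k) (a, b, c, d) t"
    using kernel_quotient_aux[of 1] by (simp add: x_def y_def)
  have e: "of_int a * (\<i> * of_real t) + of_int b = x" "of_int (- c) * (\<i> * of_real t) + of_int (- d) = - y"
    by (simp_all add: x_def y_def algebra_simps)
  have nz: "y \<noteq> 0" using abcd by (auto simp: y_def complex_eq_iff)
  have "real_of_int (a * d - b * c) * t < 0" using det t by simp
  then have "Im (x / y) < 0"
    unfolding Im_divide_less_0_iff[OF nz] by (simp add: x_def y_def algebra_simps)
  from powr_uminus_lower_half_plane[OF this, of s] show ?thesis
    unfolding kernel_term_quad_matrix e power_int_minus_left aux[symmetric]
    using k by (simp add: mult.left_commute)
qed

end

text \<open>With \<open>w = 1 / t + \<i> c\<close>, the denominator \<open>c \<i> t + 1\<close> is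
  \<open>t w\<close> and the quotient is \<open>1 / (- \<i> w)\<close>. Thus
  \<open>u = 1 / t\<close> is the variable in which the sum over \<open>c\<close> is a Lipschitz
  series of exponent \<open>k - s\<close>.\<close>

lemma kernel_term_lower_unitriangular:
  assumes t: "t > 0" and k: "even k"
  shows "kernel_term k s (\<i> * of_real t) (quad_matrix (1, 0, c, 1)) =
     of_real t powr (- of_int k) * exp (- (of_real pi * \<i> * s / 2)) *
       (of_real (1 / t) + \<i> * of_int c) powr (- (of_int k - s))"
proof -
  define w where "w = of_real (1 / t) + \<i> * complex_of_int c"
  have re: "Re w > 0" using t by (simp add: w_def)
  then have nz: "w \<noteq> 0" by auto
  have d: "of_int c * (\<i> * of_real t) + of_int 1 = of_real t * w"
    using t by (simp add: w_def field_simps)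
  have q: "(of_int 1 * (\<i> * of_real t) + of_int 0) / (of_real t * w) = inverse (- \<i> * w)"
    using t nz by (simp add: field_simps)
  have nn: "- \<i> * w \<notin> \<real>\<^sub>\<le>\<^sub>0" using re by (auto simp: complex_nonpos_Reals_iff)
  have "inverse (- \<i> * w) powr (- s) = (- \<i> * w) powr s"
    using nz Ln_inverse[OF nn] by (simp add: powr_def)
  also have "\<dots> = exp (- (of_real pi * \<i> * s / 2)) * w powr s"
    by (rule powr_times_ii_right_half[OF re])
  finally have 1: "inverse (- \<i> * w) powr (- s) = exp (- (of_real pi * \<i> * s / 2)) * w powr s" .
  have "(of_real t * w) powi (- k) = (of_real t * w) powr of_int (- k)"
    using t nz by (subst complex_powr_of_int) auto
  also have "\<dots> = of_real t powr (- of_int k) * w powr (- of_int k)"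
    using t by (subst powr_times_real_left) auto
  finally have 2: "(of_real t * w) powi (- k) = of_real t powr (- of_int k) * w powr (- of_int k)" .
  have 3: "w powr (- (of_int k - s)) = w powr (- of_int k) * w powr s"
    by (subst powr_add[symmetric]) simp
  show ?thesis
    unfolding kernel_term_quad_matrix d q 1 2 w_def[symmetric] 3 by (simp only: mult_ac)
qed

text \<open>The quotient \<open>a + \<i> / t\<close> equals \<open>\<i> w\<close> with
  \<open>w = 1 / t - \<i> a\<close>, which gives a Lipschitz series of exponent \<open>s\<close>.
  The automorphy factor now contributes \<open>\<i> powi (- k)\<close>.\<close>

lemma kernel_term_zero_lower_right:
  assumes t: "t > 0" and k: "even k"
  shows "kernel_term k s (\<i> * of_real t) (quad_matrix (a, - 1, 1, 0)) =
     \<i> powi (- k) * of_real t powr (- of_int k) * exp (- (of_real pi * \<i> * s / 2)) *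
       (of_real (1 / t) + \<i> * of_int (- a)) powr (- s)"
proof -
  define w where "w = of_real (1 / t) + \<i> * complex_of_int (- a)"
  have re: "Re w > 0" using t by (simp add: w_def)
  have d: "of_int 1 * (\<i> * of_real t) + of_int 0 = \<i> * complex_of_real t" by simp
  have q: "(of_int a * (\<i> * of_real t) + of_int (- 1)) / (\<i> * of_real t) = \<i> * w"
    using t by (simp add: w_def field_simps)
  have 1: "(\<i> * w) powr (- s) = exp (- (of_real pi * \<i> * s / 2)) * w powr (- s)"
    using powr_times_ii_right_half(1)[OF re, of "- s"] by simp
  have "(\<i> * complex_of_real t) powi (- k) = \<i> powi (- k) * of_real t powi (- k)"
    by (rule power_int_mult_distrib)
  also have "complex_of_real t powi (- k) = of_real t powr of_int (- k)"
    using t by (subst complex_powr_of_int) auto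
  finally show ?thesis
    unfolding kernel_term_quad_matrix d q 1 w_def[symmetric] by (simp add: mult_ac)
qed

text \<open>Under \<open>u = 1 / t\<close> the measure contributes \<open>1 / t ^ 2\<close>, and
  \<open>t powr (p - 1 - \<kappa>)\<close> corresponds to \<open>u powr (\<kappa> - p - 1)\<close>;
  hence the Mellin variable \<open>\<kappa> - p\<close>.\<close>

lemma has_ray_integral_Lipschitz_inverse:
  assumes q: "Re q > 1" and p: "Re (\<kappa> - p) > Re q"
  shows "has_ray_integral
           (\<lambda>t. of_real t powr (p - 1) * (of_real t powr (- \<kappa>) *
              (\<Sum>\<^sub>\<infinity>n::int. (of_real (1 / t) + \<i> * of_int n) powr (- q))))
           ((2 * of_real pi) powr (q - (\<kappa> - p)) * (Gamma (\<kappa> - p) / Gamma q) * riemann_zeta (\<kappa> - p - q + 1))"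
proof (rule has_ray_integral_cong[THEN iffD1, rotated,
    OF has_ray_integral_inverse[OF has_ray_integral_Lipschitz[OF q p]]])
  fix t :: real assume t: "t > 0"
  let ?S = "\<Sum>\<^sub>\<infinity>n::int. (of_real (1 / t) + \<i> * of_int n) powr (- q)"
  have "complex_of_real (1 / t) powr (\<kappa> - p - 1) = of_real t powr (- (\<kappa> - p - 1))"
  proof -
    have "of_real t powr (\<kappa> - p - 1) * complex_of_real (1 / t) powr (\<kappa> - p - 1) = 1"
      using t by (subst powr_times_real[symmetric]) auto
    then show ?thesis unfolding powr_minus by (rule inverse_unique[symmetric])
  qed
  moreover have "of_real (1 / t\<^sup>2) = complex_of_real t powr (- 2)"
    using t by (simp add: powr_minus divide_inverse)
  moreover have "complex_of_real t powr (- 2) * of_real t powr (- (\<kappa> - p - 1)) = of_real t powr (p - 1) * of_real t powr (- \<kappa>)"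
    unfolding powr_add[symmetric] by (simp add: algebra_simps)
  ultimately show "(1 / t\<^sup>2) *\<^sub>R (of_real (1 / t) powr (\<kappa> - p - 1) * ?S) =
      of_real t powr (p - 1) * (of_real t powr (- \<kappa>) * ?S)"
    unfolding scaleR_conv_of_real by (simp add: mult.assoc[symmetric])
qed

text \<open>Covers the sum over \<open>\<bar>b\<bar>\<close> when \<open>c = 0\<close>, with
  \<open>\<alpha> = s\<close>, and the sum over \<open>\<bar>d\<bar>\<close> when
  \<open>a = 0\<close>, with \<open>\<alpha> = k - s\<close>. The \<open>n\<close>-th Beta value is
  a constant times \<open>n powr (p - \<alpha>)\<close>, whence the zeta value at
  \<open>\<alpha> - p\<close>.\<close>

lemma has_ray_integral_pos_int_sum:
  assumes \<sigma>: "\<sigma> = 1 \<or> \<sigma> = (-1::real)" and p: "Re p > 0" "Re \<alpha> - Re p > 1"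
  shows "has_ray_integral
           (\<lambda>t. of_real t powr (p - 1) * (\<Sum>\<^sub>\<infinity>n\<in>{0<..}. (of_int n + \<i> * of_real (\<sigma> * t)) powr (- \<alpha>)))
           (exp (- (of_real \<sigma> * \<i> * of_real pi * p / 2)) *
              (riemann_zeta (\<alpha> - p) * (Gamma p * Gamma (\<alpha> - p) / Gamma \<alpha>)))"
    and "\<And>t. t > 0 \<Longrightarrow> (\<lambda>n. (of_int n + \<i> * of_real (\<sigma> * t)) powr (- \<alpha>)) summable_on {0<..}"
proof -
  define P A where "P = Re p" and "A = Re \<alpha>"
  have PA: "0 < P" "P < A" "A - P > 1" using p by (auto simp: P_def A_def)
  define E where "E = exp (- (of_real \<sigma> * \<i> * of_real pi * p / 2))"
  define B where "B = Gamma p * Gamma (\<alpha> - p) / Gamma \<alpha>"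
  define B' where "B' = Gamma P * Gamma (A - P) / Gamma A"
  define C where "C = exp (pi * \<bar>Im \<alpha>\<bar>) * 2 powr \<bar>A\<bar>"
  have C0: "C \<ge> 0" by (simp add: C_def)
  define f where "f n t = of_real t powr (p - 1) * (of_int n + \<i> * of_real (\<sigma> * t)) powr (- \<alpha>)" for n and t :: real
  define g where "g n t = C * (t powr (P - 1) * (1 * t + of_int n) powr (- A))" for n and t :: real
  have cnt: "countable {0 :: int <..}" by simp
  have f: "has_ray_integral (f n) (E * (of_int n powr (p - \<alpha>) * B))" if "n \<in> {0<..}" for n
    using has_ray_integral_affine_imaginary[of "of_int n" \<sigma> p \<alpha>] that \<sigma> p
    by (simp add: f_def[abs_def] E_def B_def)
  have g: "has_ray_integral (g n) (C * (1 powr (- P) * of_int n powr (P - A) * B'))" if "n \<in> {0<..}" for n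
    unfolding g_def B'_def using PA that
    by (intro has_ray_integral_cmult has_ray_integral_Beta_affine_real) auto
  have le: "norm (f n t) \<le> g n t" if "n \<in> {0<..}" "t > 0" for n t
  proof -
    have "norm ((of_int n + \<i> * of_real (\<sigma> * t)) powr (- \<alpha>)) \<le> C * (t + of_int n) powr (- A)"
      using norm_powr_shift_le[of "of_int n" "\<sigma> * t" \<alpha>] \<sigma> that
      by (auto simp: C_def A_def abs_mult add.commute)
    then have "t powr (P - 1) * norm ((of_int n + \<i> * of_real (\<sigma> * t)) powr (- \<alpha>)) \<le>
        t powr (P - 1) * (C * (t + of_int n) powr (- A))"
      by (intro mult_left_mono) auto
    moreover have "norm (f n t) = t powr (P - 1) * norm ((of_int n + \<i> * of_real (\<sigma> * t)) powr (- \<alpha>))"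
      using that by (simp add: f_def norm_mult norm_powr_real_powr P_def)
    ultimately show ?thesis by (simp add: g_def mult_ac)
  qed
  have sum: "(\<lambda>n. C * (1 powr (- P) * of_int n powr (P - A) * B')) summable_on {0<..}"
    using summable_on_pos_int_powr[OF PA(3)]
    by (intro summable_on_cmult_right summable_on_cmult_left) simp
  have pt: "(\<lambda>n. g n t) summable_on {0<..}" if "t > 0" for t
  proof (rule summable_on_comparison_test)
    have "A > 1" using PA by simp
    then show "(\<lambda>n. C * (t powr (P - 1) * of_int n powr (- A))) summable_on {0<..}"
      by (intro summable_on_cmult_right summable_on_pos_int_powr)
    show "g n t \<le> C * (t powr (P - 1) * of_int n powr (- A))" if "n \<in> {0<..}" for n
      unfolding g_def using that \<open>t > 0\<close> PA C0 by (intro mult_left_mono powr_mono2') auto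
    show "0 \<le> g n t" for n using C0 by (simp add: g_def)
  qed
  show "(\<lambda>n. (of_int n + \<i> * of_real (\<sigma> * t)) powr (- \<alpha>)) summable_on {0<..}" if "t > 0" for t
  proof -
    have "(\<lambda>n. norm (f n t)) summable_on {0<..}"
      by (rule summable_on_comparison_test[OF pt[OF that]]) (use le that in auto)
    from abs_summable_summable[OF this] show ?thesis
      using that unfolding f_def by (subst (asm) summable_on_cmult_right') auto
  qed
  have h: "has_ray_integral (\<lambda>t. \<Sum>\<^sub>\<infinity>n\<in>{0<..}. f n t) (\<Sum>\<^sub>\<infinity>n\<in>{0<..}. E * (of_int n powr (p - \<alpha>) * B))"
    by (rule has_ray_integral_infsum(1)[OF cnt f g le sum pt])
  have "(\<Sum>\<^sub>\<infinity>n\<in>{0<..}. complex_of_int n powr (p - \<alpha>)) = (\<Sum>\<^sub>\<infinity>n. of_nat (Suc n) powr (- (\<alpha> - p)))"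
    unfolding greaterThan_0_int_eq by (subst infsum_reindex) (auto simp: o_def inj_def)
  also have "\<dots> = riemann_zeta (\<alpha> - p)"
  proof -
    have "(\<lambda>n. norm (complex_of_nat (Suc n) powr (- (\<alpha> - p)))) = (\<lambda>n. real (Suc n) powr - (A - P))"
      by (simp add: norm_powr_real_powr A_def P_def del: of_nat_Suc)
    then have "(\<lambda>n. norm (complex_of_nat (Suc n) powr (- (\<alpha> - p)))) summable_on UNIV"
      using summable_on_Suc_powr[OF PA(3)] by (simp only:)
    from has_sum_imp_sums[OF has_sum_infsum[OF abs_summable_summable[OF this]]]
    show ?thesis by (simp add: riemann_zeta_def sums_iff)
  qed
  finally show "has_ray_integral
           (\<lambda>t. of_real t powr (p - 1) * (\<Sum>\<^sub>\<infinity>n\<in>{0<..}. (of_int n + \<i> * of_real (\<sigma> * t)) powr (- \<alpha>)))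
           (exp (- (of_real \<sigma> * \<i> * of_real pi * p / 2)) *
              (riemann_zeta (\<alpha> - p) * (Gamma p * Gamma (\<alpha> - p) / Gamma \<alpha>)))"
    using h unfolding f_def infsum_cmult_right' infsum_cmult_left' E_def B_def by simp
qed

section \<open>Representatives of the classes modulo sign\<close>

lemma quad_matrix_nth [simp]:
  "quad_matrix (a, b, c, d) $ 1 $ 1 = a" "quad_matrix (a, b, c, d) $ 1 $ 2 = b"
  "quad_matrix (a, b, c, d) $ 2 $ 1 = c" "quad_matrix (a, b, c, d) $ 2 $ 2 = d"
  by (simp_all add: quad_matrix_def)

lemma quad_matrix_eta: "quad_matrix (A$1$1, A$1$2, A$2$1, A$2$2) = A"
  by (simp add: vec_eq_iff forall_2)

lemma quad_matrix_eq_iff: "quad_matrix q = quad_matrix q' \<longleftrightarrow> q = q'"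
  by (cases q; cases q') (auto simp: vec_eq_iff forall_2)

lemma uminus_quad_matrix: "- quad_matrix (a, b, c, d) = quad_matrix (- a, - b, - c, - d)"
  by (simp add: vec_eq_iff forall_2)

lemma quad_matrix_in_SL2Z_iff: "quad_matrix (a, b, c, d) \<in> SL2Z \<longleftrightarrow> a * d - b * c = 1"
  by (simp add: SL2Z_def det_2)

lemma uminus_in_SL2Z: "A \<in> SL2Z \<Longrightarrow> - A \<in> SL2Z"
  by (simp add: SL2Z_def det_2)

lemma PSL2Z_eq: "PSL2Z = (\<lambda>A. {A, - A}) ` SL2Z"
proof -
  have "{(A, B). A \<in> SL2Z \<and> B \<in> SL2Z \<and> (B = A \<or> B = - A)} `` {A} = {A, - A}" if "A \<in> SL2Z" for A
    using that uminus_in_SL2Z[OF that] by auto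
  then show ?thesis
    unfolding PSL2Z_def quotient_def by auto
qed

text \<open>The sign in each class is chosen to fit the evaluated patterns. The choice
  \<open>d < 0\<close> at \<open>a = 0\<close> makes these matrices the limiting case
  \<open>a = 0\<close> of two patterns with negative diagonal product.\<close>

definition psl_reps :: "(int \<times> int \<times> int \<times> int) set" where
  "psl_reps = {(a, b, c, d). a * d - b * c = 1 \<and> (if d = 0 then c = 1 else a > 0 \<or> a = 0 \<and> d < 0)}"

lemma bij_betw_psl_reps: "bij_betw (\<lambda>q. {quad_matrix q, - quad_matrix q}) psl_reps PSL2Z"
proof -
  let ?h = "\<lambda>q. {quad_matrix q, - quad_matrix q}"
  have inj: "inj_on ?h psl_reps"
  proof (rule inj_onI)
    fix q q' assume q: "q \<in> psl_reps" "q' \<in> psl_reps" and e: "?h q = ?h q'"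
    obtain a b c d where q1: "q = (a, b, c, d)" by (cases q)
    obtain a' b' c' d' where q2: "q' = (a', b', c', d')" by (cases q')
    from e have "quad_matrix q = quad_matrix q' \<or> quad_matrix q = - quad_matrix q'" by blast
    then show "q = q'"
      using q by (auto simp: q1 q2 uminus_quad_matrix quad_matrix_eq_iff psl_reps_def split: if_splits)
  qed
  have 1: "?h ` psl_reps \<subseteq> PSL2Z"
    unfolding PSL2Z_eq by (auto simp: psl_reps_def quad_matrix_in_SL2Z_iff)
  have 2: "PSL2Z \<subseteq> ?h ` psl_reps"
  proof
    fix V assume "V \<in> PSL2Z"
    then obtain A where A: "A \<in> SL2Z" "V = {A, - A}" by (auto simp: PSL2Z_eq)
    define a b c d where "a = A$1$1" and "b = A$1$2" and "c = A$2$1" and "d = A$2$2"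
    have Aq: "A = quad_matrix (a, b, c, d)" by (simp add: a_def b_def c_def d_def quad_matrix_eta)
    have det: "a * d - b * c = 1" using A(1) by (simp add: Aq quad_matrix_in_SL2Z_iff)
    have "(a, b, c, d) \<in> psl_reps \<or> (- a, - b, - c, - d) \<in> psl_reps"
    proof (cases "d = 0")
      case True
      then have "b * c = -1" using det by simp
      then have "c dvd 1" by (metis dvd_minus_iff dvd_triv_right)
      then have "c = 1 \<or> c = -1" by (simp add: zdvd1_eq abs_if split: if_splits)
      then show ?thesis using True det by (auto simp: psl_reps_def)
    next
      case False
      then show ?thesis using det by (auto simp: psl_reps_def)
    qed
    then show "V \<in> ?h ` psl_reps"
    proof
      assume "(a, b, c, d) \<in> psl_reps"
      then show ?thesis using A(2) Aq by blast
    next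
      assume r: "(- a, - b, - c, - d) \<in> psl_reps"
      have "V = ?h (- a, - b, - c, - d)"
        using A(2) Aq by (auto simp: uminus_quad_matrix)
      then show ?thesis using r by blast
    qed
  qed
  show ?thesis using inj 1 2 by (auto simp: bij_betw_def)
qed

lemma kernel_R_eq_psl_reps:
  assumes "even k"
  shows "kernel_R k s z = gamma_factor k s * (\<Sum>\<^sub>\<infinity>q\<in>psl_reps. kernel_term k s z (quad_matrix q))"
proof -
  have "(\<Sum>\<^sub>\<infinity>V\<in>PSL2Z. the_elem (kernel_term k s z ` V)) =
     (\<Sum>\<^sub>\<infinity>q\<in>psl_reps. the_elem (kernel_term k s z ` {quad_matrix q, - quad_matrix q}))"
    by (rule infsum_reindex_bij_betw[OF bij_betw_psl_reps, symmetric])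
  also have "\<dots> = (\<Sum>\<^sub>\<infinity>q\<in>psl_reps. kernel_term k s z (quad_matrix q))"
    by (simp add: kernel_term_uminus[OF assms])
  finally show ?thesis by (simp add: kernel_R_def)
qed

text \<open>The ten families: \<open>b = 0\<close>; \<open>d = 0\<close>; \<open>c = 0\<close> with
  \<open>b\<close> positive or negative; \<open>a = 0\<close> with \<open>c = - 1\<close> or
  \<open>c = 1\<close>; and without zero entries the sign patterns of \<open>(b, c, d)\<close> in
  the order +++, --+, +--, -+-. A zero entry forces the diagonal or the antidiagonal to consist of
  units. The matrices with two zero entries belong to the first two families.\<close>

lemma psl_reps_eq:
  "psl_reps =
     range (\<lambda>c. (1, 0, c, 1)) \<union> (range (\<lambda>a. (a, - 1, 1, 0)) \<union>
     ((\<lambda>b. (1, b, 0, 1)) ` {0<..} \<union> ((\<lambda>b. (1, - b, 0, 1)) ` {0<..} \<union>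
     ((\<lambda>d. (0, 1, - 1, - d)) ` {0<..} \<union> ((\<lambda>d. (0, - 1, 1, - d)) ` {0<..} \<union>
     (pos_quads 1 \<union> ((\<lambda>(a, b, c, d). (a, - b, - c, d)) ` pos_quads 1 \<union>
     ((\<lambda>(a, b, c, d). (a, b, - c, - d)) ` pos_quads (- 1) \<union>
      (\<lambda>(a, b, c, d). (a, - b, c, - d)) ` pos_quads (- 1)))))))))" (is "_ = ?U")
proof
  show "?U \<subseteq> psl_reps"
    by (auto simp: psl_reps_def pos_quads_def)
  show "psl_reps \<subseteq> ?U"
  proof
    fix q assume "q \<in> psl_reps"
    then obtain a b c d where q: "q = (a, b, c, d)" and det: "a * d - b * c = 1"
      and r: "if d = 0 then c = 1 else a > 0 \<or> a = 0 \<and> d < 0" by (auto simp: psl_reps_def)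
    consider "d = 0" | "d < 0" "a = 0" | "d \<noteq> 0" "a > 0" "b = 0" | "d \<noteq> 0" "a > 0" "b \<noteq> 0" "c = 0"
      | "d > 0" "a > 0" "b \<noteq> 0" "c \<noteq> 0" | "d < 0" "a > 0" "b \<noteq> 0" "c \<noteq> 0"
      using r by (cases "d = 0") force+
    then show "q \<in> ?U"
    proof cases
      case 1
      then have "q = (a, - 1, 1, 0)" using q r det by simp
      then show ?thesis by blast
    next
      case 2
      then have "(- b) * c = 1" using det by simp
      then have "- b = 1 \<and> c = 1 \<or> - b = -1 \<and> c = -1" by (simp only: zmult_eq_1_iff)
      then have "q = (0, 1, - 1, - (- d)) \<or> q = (0, - 1, 1, - (- d))" using q 2 by auto
      moreover have "- d \<in> {0<..}" using 2 by simp
      ultimately show ?thesis by blast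
    next
      case 3
      then have "a * d = 1" using det by simp
      then have "a = 1" "d = 1" using 3 by (auto simp: zmult_eq_1_iff)
      then have "q = (1, 0, c, 1)" using q 3 by simp
      then show ?thesis by blast
    next
      case 4
      then have "a * d = 1" using det by simp
      then have "a = 1" "d = 1" using 4 by (auto simp: zmult_eq_1_iff)
      then have q': "q = (1, b, 0, 1)" using q 4 by simp
      show ?thesis
      proof (cases "b > 0")
        case True
        then have "b \<in> {0<..}" by simp
        then show ?thesis using q' by blast
      next
        case False
        then have "q = (1, - (- b), 0, 1)" "- b \<in> {0<..}" using q' 4 by auto
        then show ?thesis by blast
      qed
    next
      case 5
      have "a * d > 0" using 5 by simp
      then have "b * c \<ge> 0" using det by linarith
      then have "b > 0 \<and> c > 0 \<or> b < 0 \<and> c < 0" using 5 by (auto simp: zero_le_mult_iff)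
      then show ?thesis
      proof
        assume "b > 0 \<and> c > 0"
        then have "q \<in> pos_quads 1" using q 5 det by (simp add: pos_quads_def)
        then show ?thesis by blast
      next
        assume "b < 0 \<and> c < 0"
        then have m: "(a, - b, - c, d) \<in> pos_quads 1" using 5 det by (simp add: pos_quads_def)
        have "q \<in> (\<lambda>(a, b, c, d). (a, - b, - c, d)) ` pos_quads 1"
          by (rule image_eqI[OF _ m]) (simp add: q)
        then show ?thesis by blast
      qed
    next
      case 6
      have "a * d < 0" using 6 by (simp add: mult_pos_neg)
      then have "b * c < 0" using det by linarith
      then have "b > 0 \<and> c < 0 \<or> b < 0 \<and> c > 0" by (auto simp: mult_less_0_iff)
      then show ?thesis
      proof
        assume "b > 0 \<and> c < 0"
        then have m: "(a, b, - c, - d) \<in> pos_quads (- 1)" using 6 det by (simp add: pos_quads_def)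
        have "q \<in> (\<lambda>(a, b, c, d). (a, b, - c, - d)) ` pos_quads (- 1)"
          by (rule image_eqI[OF _ m]) (simp add: q)
        then show ?thesis by blast
      next
        assume "b < 0 \<and> c > 0"
        then have m: "(a, - b, c, - d) \<in> pos_quads (- 1)" using 6 det by (simp add: pos_quads_def)
        have "q \<in> (\<lambda>(a, b, c, d). (a, - b, c, - d)) ` pos_quads (- 1)"
          by (rule image_eqI[OF _ m]) (simp add: q)
        then show ?thesis by blast
      qed
    qed
  qed
qed

lemma has_sum_psl_reps:
  fixes f :: "int \<times> int \<times> int \<times> int \<Rightarrow> complex"
  assumes "((\<lambda>c. f (1, 0, c, 1)) has_sum S1) UNIV" "((\<lambda>a. f (a, - 1, 1, 0)) has_sum S2) UNIV"
    and "((\<lambda>b. f (1, b, 0, 1)) has_sum S3) {0<..}" "((\<lambda>b. f (1, - b, 0, 1)) has_sum S4) {0<..}"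
    and "((\<lambda>d. f (0, 1, - 1, - d)) has_sum S5) {0<..}" "((\<lambda>d. f (0, - 1, 1, - d)) has_sum S6) {0<..}"
    and "(f has_sum S7) (pos_quads 1)"
    and "((\<lambda>(a, b, c, d). f (a, - b, - c, d)) has_sum S8) (pos_quads 1)"
    and "((\<lambda>(a, b, c, d). f (a, b, - c, - d)) has_sum S9) (pos_quads (- 1))"
    and "((\<lambda>(a, b, c, d). f (a, - b, c, - d)) has_sum S10) (pos_quads (- 1))"
  shows "(f has_sum (S1 + (S2 + (S3 + (S4 + (S5 + (S6 + (S7 + (S8 + (S9 + S10)))))))))) psl_reps"
proof -
  have im: "(f has_sum S) (h ` I)" if "inj_on h I" "((\<lambda>i. f (h i)) has_sum S) I"
    for h :: "'i \<Rightarrow> int \<times> int \<times> int \<times> int" and I S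
    using that by (subst has_sum_reindex) (auto simp: o_def)
  have im': "(f has_sum S) ((\<lambda>(a, b, c, d). h a b c d) ` I)"
    if "inj (\<lambda>(a, b, c, d). h a b c d)" "((\<lambda>(a, b, c, d). f (h a b c d)) has_sum S) I"
    for h :: "int \<Rightarrow> int \<Rightarrow> int \<Rightarrow> int \<Rightarrow> int \<times> int \<times> int \<times> int" and I S
    by (rule im) (use that in \<open>auto simp: case_prod_unfold inj_on_def\<close>)
  have s1: "(f has_sum S1) (range (\<lambda>c. (1, 0, c, 1)))"
    by (rule im[OF _ assms(1)]) (simp add: inj_on_def)
  have s2: "(f has_sum S2) (range (\<lambda>a. (a, - 1, 1, 0)))"
    by (rule im[OF _ assms(2)]) (simp add: inj_on_def)
  have s3: "(f has_sum S3) ((\<lambda>b. (1, b, 0, 1)) ` {0<..})"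
    by (rule im[OF _ assms(3)]) (simp add: inj_on_def)
  have s4: "(f has_sum S4) ((\<lambda>b. (1, - b, 0, 1)) ` {0<..})"
    by (rule im[OF _ assms(4)]) (simp add: inj_on_def)
  have s5: "(f has_sum S5) ((\<lambda>d. (0, 1, - 1, - d)) ` {0<..})"
    by (rule im[OF _ assms(5)]) (simp add: inj_on_def)
  have s6: "(f has_sum S6) ((\<lambda>d. (0, - 1, 1, - d)) ` {0<..})"
    by (rule im[OF _ assms(6)]) (simp add: inj_on_def)
  have s8: "(f has_sum S8) ((\<lambda>(a, b, c, d). (a, - b, - c, d)) ` pos_quads 1)"
    by (rule im'[OF _ assms(8)]) (auto simp: inj_on_def)
  have s9: "(f has_sum S9) ((\<lambda>(a, b, c, d). (a, b, - c, - d)) ` pos_quads (- 1))"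
    by (rule im'[OF _ assms(9)]) (auto simp: inj_on_def)
  have s10: "(f has_sum S10) ((\<lambda>(a, b, c, d). (a, - b, c, - d)) ` pos_quads (- 1))"
    by (rule im'[OF _ assms(10)]) (auto simp: inj_on_def)
  \<comment> \<open>The number of the family to which a representative belongs. Each family is
    disjoint from the union of the later ones by comparing numbers, which avoids 45 pairwise
    disjointness proofs.\<close>
  define key :: "int \<times> int \<times> int \<times> int \<Rightarrow> nat" where
    "key = (\<lambda>(a, b, c, d). if d = 0 then 2 else if a = 0 then (if b > 0 then 5 else 6)
       else if b = 0 then 1 else if c = 0 then (if b > 0 then 3 else 4)
       else if c > 0 then (if b > 0 then 7 else 10) else (if b < 0 then 8 else 9))"
  define hs where "hs n T B \<longleftrightarrow> (f has_sum T) B \<and> (\<forall>q\<in>B. key q \<ge> n)" for n T B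
  have step: "hs n (S + T) (A \<union> B)"
    if "(f has_sum S) A" "\<And>q. q \<in> A \<Longrightarrow> key q = n" "hs (Suc n) T B" for n S T A B
  proof -
    have "A \<inter> B = {}" using that(2,3) unfolding hs_def by fastforce
    then have "(f has_sum (S + T)) (A \<union> B)"
      using that(1,3) unfolding hs_def by (intro has_sum_Un_disjoint) auto
    then show ?thesis using that(2,3) unfolding hs_def by fastforce
  qed
  have h10: "hs 10 S10 ((\<lambda>(a, b, c, d). (a, - b, c, - d)) ` pos_quads (- 1))"
    using s10 by (auto simp: hs_def key_def pos_quads_def)
  have suc1: "Suc 1 = 2" by simp
  have suc2: "Suc 2 = 3" by simp
  have suc3: "Suc 3 = 4" by simp
  have suc4: "Suc 4 = 5" by simp
  have suc5: "Suc 5 = 6" by simp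
  have suc6: "Suc 6 = 7" by simp
  have suc7: "Suc 7 = 8" by simp
  have suc8: "Suc 8 = 9" by simp
  have suc9: "Suc 9 = 10" by simp
  note kd = key_def pos_quads_def
  have k9: "key q = 9" if "q \<in> (\<lambda>(a, b, c, d). (a, b, - c, - d)) ` pos_quads (- 1)" for q
    using that by (auto simp: kd)
  have k8: "key q = 8" if "q \<in> (\<lambda>(a, b, c, d). (a, - b, - c, d)) ` pos_quads 1" for q
    using that by (auto simp: kd)
  have k7: "key q = 7" if "q \<in> pos_quads 1" for q
    using that by (auto simp: kd)
  have k6: "key q = 6" if "q \<in> (\<lambda>d. (0, - 1, 1, - d)) ` {0<..}" for q
    using that by (auto simp: kd)
  have k5: "key q = 5" if "q \<in> (\<lambda>d. (0, 1, - 1, - d)) ` {0<..}" for q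
    using that by (auto simp: kd)
  have k4: "key q = 4" if "q \<in> (\<lambda>b. (1, - b, 0, 1)) ` {0<..}" for q
    using that by (auto simp: kd)
  have k3: "key q = 3" if "q \<in> (\<lambda>b. (1, b, 0, 1)) ` {0<..}" for q
    using that by (auto simp: kd)
  have k2: "key q = 2" if "q \<in> range (\<lambda>a. (a, - 1, 1, 0))" for q
    using that by (auto simp: kd)
  have k1: "key q = 1" if "q \<in> range (\<lambda>c. (1, 0, c, 1))" for q
    using that by (auto simp: kd)
  note h9 = step[OF s9 k9 h10[folded suc9]]
  note h8 = step[OF s8 k8 h9[folded suc8]]
  note h7 = step[OF assms(7) k7 h8[folded suc7]]
  note h6 = step[OF s6 k6 h7[folded suc6]]
  note h5 = step[OF s5 k5 h6[folded suc5]]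
  note h4 = step[OF s4 k4 h5[folded suc4]]
  note h3 = step[OF s3 k3 h4[folded suc3]]
  note h2 = step[OF s2 k2 h3[folded suc2]]
  note h1 = step[OF s1 k1 h2[folded suc1]]
  show ?thesis using h1 unfolding psl_reps_eq by (simp add: hs_def)
qed

section \<open>The integral of the kernel\<close>

text \<open>For \<open>1 - z\<close> away from the poles this is the reflection formula together
  with \<open>Gamma (1 - z + m) = pochhammer (1 - z) m * Gamma (1 - z)\<close>. At
  \<open>z = 1, ..., m\<close>, where \<open>Gamma (1 - z)\<close> has a pole, the sine and the
  Pochhammer symbol both vanish.\<close>

lemma sin_Gamma_eq_pochhammer:
  fixes z :: complex
  assumes z: "0 < Re z" "Re z < real m + 1"
  shows "sin (of_real pi * z) * (Gamma z * Gamma (1 - z + of_nat m)) = of_real pi * pochhammer (1 - z) m"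
proof (cases "1 - z \<in> \<int>\<^sub>\<le>\<^sub>0")
  case False
  have s: "sin (of_real pi * z) \<noteq> 0"
  proof
    assume "sin (of_real pi * z) = 0"
    then obtain n where n: "z = of_int n"
      unfolding sin_eq_0 by (auto simp: mult.commute)
    with z have "1 - n \<le> 0" by simp
    then have "of_int (1 - n) \<in> (\<int>\<^sub>\<le>\<^sub>0 :: complex set)" by (rule of_int_in_nonpos_Ints_iff[THEN iffD2])
    with False n show False by simp
  qed
  have "Gamma (1 - z) \<noteq> 0" using False by (simp add: Gamma_eq_zero_iff)
  then have "Gamma (1 - z + of_nat m) = pochhammer (1 - z) m * Gamma (1 - z)"
    using pochhammer_Gamma[OF False, of m] by simp
  then have "sin (of_real pi * z) * (Gamma z * Gamma (1 - z + of_nat m)) =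
      sin (of_real pi * z) * (Gamma z * Gamma (1 - z)) * pochhammer (1 - z) m"
    by simp
  also have "\<dots> = of_real pi * pochhammer (1 - z) m"
    unfolding Gamma_reflection_complex using s by simp
  finally show ?thesis .
next
  case True
  then obtain n where n: "1 - z = - of_nat n" by (auto elim: nonpos_Ints_cases')
  then have zn: "z = of_nat (Suc n)" by (simp add: algebra_simps)
  then have "n < m" using z by simp
  then have "pochhammer (1 - z) m = 0" unfolding n by (simp add: pochhammer_of_nat_eq_0_iff)
  moreover have "sin (of_real pi * z) = 0"
    unfolding sin_eq_0 by (intro exI[of _ "int (Suc n)"]) (simp add: zn mult.commute)
  ultimately show ?thesis by simp
qed

lemma exp_odd_multiple_pi:
  assumes "odd n"
  shows "exp (- (of_real pi * \<i> * of_int n)) = - 1"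
proof -
  obtain m where "n = 2 * m + 1" using assms by (rule oddE)
  then have "exp (- (of_real pi * \<i> * of_int n)) = exp (2 * of_int (- m) * of_real pi * \<i>) * exp (- (of_real pi * \<i>))"
    by (simp add: exp_add[symmetric] algebra_simps)
  also have "exp (2 * of_int (- m) * of_real pi * \<i>) = 1"
    unfolding exp_eq_1 by (auto intro!: exI[of _ "- m"])
  also have "1 * exp (- (complex_of_real pi * \<i>)) = - 1"
    by (simp add: exp_minus)
  finally show ?thesis .
qed

text \<open>With \<open>u = exp (pi \<i> z / 2)\<close> both sides equal
  \<open>1 / u - u ^ 3\<close>. The shift by -1 in the exponential supplies the
  \<open>- \<i>\<close> that cancels the denominator of the sine.\<close>

lemma exp_difference_eq_sin:
  "exp (- of_real pi * \<i> * z / 2) - exp (3 * of_real pi * \<i> * z / 2) =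
     2 * exp (of_real pi * \<i> * (z - 1) / 2) * sin (of_real pi * z)"
proof -
  define u where "u = exp (of_real pi * \<i> * z / 2)"
  have u: "u \<noteq> 0" by (simp add: u_def)
  have 1: "exp (- of_real pi * \<i> * z / 2) = 1 / u"
  proof -
    have "exp (- of_real pi * \<i> * z / 2) * u = 1"
      unfolding u_def exp_add[symmetric] by (subst exp_eq_1) simp
    then show ?thesis using u by (simp add: eq_divide_eq)
  qed
  have 2: "exp (3 * of_real pi * \<i> * z / 2) = u ^ 3"
    unfolding u_def exp_of_nat_mult[symmetric] by (simp add: mult_ac)
  have 3: "exp (of_real pi * \<i> * (z - 1) / 2) = - \<i> * u"
  proof -
    have "of_real pi * \<i> * (z - 1) / 2 = of_real pi * \<i> * z / 2 + - (of_real pi / 2 * \<i>)"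
      by (simp add: field_simps)
    then have "exp (of_real pi * \<i> * (z - 1) / 2) = u * exp (- (of_real pi / 2 * \<i>))"
      by (simp only: exp_add u_def)
    also have "exp (- (of_real pi / 2 * \<i>)) = - \<i>"
      using exp_Ln[of "- \<i>"] by (simp add: mult.commute)
    finally show ?thesis by simp
  qed
  have 4: "exp (\<i> * (of_real pi * z)) = u ^ 2" "exp (- (\<i> * (of_real pi * z))) = 1 / u ^ 2"
  proof -
    show a: "exp (\<i> * (of_real pi * z)) = u ^ 2"
      unfolding u_def exp_of_nat_mult[symmetric] by (simp add: mult_ac)
    show "exp (- (\<i> * (of_real pi * z))) = 1 / u ^ 2"
      unfolding exp_minus a by (simp add: divide_inverse)
  qed
  have "sin (of_real pi * z) = (u ^ 2 - 1 / u ^ 2) / (2 * \<i>)"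
    unfolding sin_exp_eq using 4 by (simp add: field_simps)
  then show ?thesis unfolding 1 2 3 using u by (simp add: field_simps power2_eq_square power3_eq_cube)
qed

lemma ii_powi_mult_exp:
  "\<i> powi (- k) * exp (of_real pi * \<i> * of_int k / 2) = 1"
proof -
  have "\<i> powi k = exp (of_real pi * \<i> * of_int k / 2)"
    using complex_powr_of_int[of \<i> k] by (simp add: powr_def mult_ac)
  then show ?thesis by (simp add: power_int_minus)
qed

theorem mainTheorem1:
  fixes k :: int and s s' :: complex
  assumes "even k"
    and "s + s' \<in> complex_of_int ` {n. odd n}"
    and "Re s > Re s' + 1"
    and "1 < Re (s + s')" and "Re (s + s') < of_int k - 1"
    and "1 < Re s" and "Re s < of_int k - 1"
    and "1 < Re s'" and "Re s' < of_int k - 1"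
  shows "set_integrable lborel {0<..}
           (\<lambda>t. kernel_R k s (\<i> * of_real t) * of_real t powr (s' - 1)) \<and>
         hypergeo_term k s s' summable_on pos_det1 \<and>
         inverse (gamma_factor k s) *
           (LBINT t:{0<..}. kernel_R k s (\<i> * of_real t) * of_real t powr (s' - 1)) =
         \<i> powi (- k) * ((2 * of_real pi * \<i>) powr (of_int k - s) / (2 * of_real pi) powr (of_int k - s'))
           * riemann_zeta (s - s' + 1) * (Gamma (of_int k - s') / Gamma (of_int k - s))
       + \<i> powi (- k) * ((- 2 * of_real pi * \<i>) powr s / (2 * of_real pi) powr (of_int k - s'))
           * riemann_zeta (of_int k - s' - s + 1) * (Gamma (of_int k - s') / Gamma s)
       + 2 * of_real pi * exp (of_real pi * \<i> * (s' - 1) / 2)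
           * (pochhammer (- s' + 1) (nat (k - 1)) / fact (nat (k - 1)))
           * (\<Sum>\<^sub>\<infinity>q\<in>pos_det1. hypergeo_term k s s' q)
       + riemann_zeta (s - s')
           * (exp (- of_real pi * \<i> * s' / 2) - exp (3 * of_real pi * \<i> * s' / 2))
           * (Gamma s' * Gamma (s - s') / Gamma s)"
proof -
  note even = assms(1)
  define \<kappa> :: complex where "\<kappa> = of_int k"
  have re: "Re s' > 1" "Re s - Re s' > 1" "Re \<kappa> - Re s > 1" "Re \<kappa> - Re s - Re s' > 1"
    using assms by (auto simp: \<kappa>_def)
  obtain n where n: "odd n" "s + s' = of_int n" using assms(2) by auto
  \<comment> \<open>\<open>E\<close> is the branch factor, \<open>ep\<close> and \<open>em\<close>
    are the rotation factors for \<open>\<sigma> = 1\<close> and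
    \<open>\<sigma> = - 1\<close>.\<close>
  define E where "E = exp (- (of_real pi * \<i> * s))"
  define ep where "ep = exp (- of_real pi * \<i> * s' / 2)"
  define em where "em = exp (of_real pi * \<i> * s' / 2)"
  have E: "E = - exp (of_real pi * \<i> * s')"
  proof -
    have "- (of_real pi * \<i> * s) = - (of_real pi * \<i> * of_int n) + of_real pi * \<i> * s'"
      unfolding n(2)[symmetric] by (simp add: algebra_simps)
    then show ?thesis unfolding E_def by (simp only: exp_add exp_odd_multiple_pi[OF n(1)]) simp
  qed
  have pe: "ep * em = 1"
    unfolding ep_def em_def exp_add[symmetric] by (subst exp_eq_1) simp
  have E2: "E = - (em * em)"
    unfolding E em_def exp_add[symmetric] by (rule arg_cong[of _ _ "\<lambda>x. - exp x"]) simp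
  have e3: "exp (3 * of_real pi * \<i> * s' / 2) = em * em * em"
    unfolding em_def exp_add[symmetric] by (rule arg_cong[of _ _ exp]) simp
  \<comment> \<open>The common coefficient of the families with \<open>a = 0\<close> and of those
    with negative diagonal product. It vanishes because \<open>s + s'\<close> is odd.\<close>
  have Ep: "E * ep + em = 0"
    unfolding E2 using pe by (simp add: mult.assoc mult.commute[of em ep])
  have Em: "ep + E * em = exp (- of_real pi * \<i> * s' / 2) - exp (3 * of_real pi * \<i> * s' / 2)"
    unfolding e3 E2 by (simp add: ep_def)
  have \<sigma>: "1 = 1 \<or> 1 = (-1::real)" "-1 = 1 \<or> -1 = (-1::real)" by simp_all
  have sgn_exp: "exp (- (of_real 1 * \<i> * of_real pi * s' / 2)) = ep"
    "exp (- (of_real (-1) * \<i> * of_real pi * s' / 2)) = em"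
    by (simp_all add: ep_def em_def mult_ac)

  define H where "H = Gamma s' * Gamma (\<kappa> - s') / Gamma \<kappa>"
  have J1: "has_ray_integral (\<lambda>t. lin_kernel s' s (\<kappa> - s) (of_int a) (of_int b) (of_int c) (of_int d) (of_real t))
      (H * hypergeo_term k s s' (a, b, c, d))" if "(a, b, c, d) \<in> pos_quads 1" for a b c d
  proof -
    have pos: "a > 0" "b > 0" "c > 0" "d > 0" and det: "a * d - b * c = 1"
      using that by (auto simp: pos_quads_def)
    have "real_of_int a * of_int d - of_int b * of_int c = of_int (a * d - b * c)" by simp
    then have "real_of_int a * of_int d - of_int b * of_int c = 1" unfolding det by simp
    from has_ray_integral_hypergeo[OF _ _ _ _ this, of s' \<kappa> s] show ?thesis
      using pos re by (simp add: hypergeo_term_def H_def \<kappa>_def mult_ac)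
  qed
  \<comment> \<open>For determinant -1 the integrals only have to exist, since their total
    cancels.\<close>
  have "\<exists>J. \<forall>a b c d. (a, b, c, d) \<in> pos_quads (- 1) \<longrightarrow> has_ray_integral
      (\<lambda>t. lin_kernel s' s (\<kappa> - s) (of_int a) (of_int b) (of_int c) (of_int d) (of_real t)) (J (a, b, c, d))"
  proof (intro exI allI impI)
    fix a b c d assume "(a, b, c, d) \<in> pos_quads (- 1)"
    then have "set_integrable lborel {0<..}
       (\<lambda>t. lin_kernel s' s (\<kappa> - s) (of_int a) (of_int b) (of_int c) (of_int d) (of_real t * 1))"
      using re by (intro set_integrable_lin_kernel) (auto simp: pos_quads_def)
    then show "has_ray_integral
      (\<lambda>t. lin_kernel s' s (\<kappa> - s) (of_int a) (of_int b) (of_int c) (of_int d) (of_real t))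
      ((\<lambda>(a, b, c, d). LBINT t:{0<..}. lin_kernel s' s (\<kappa> - s) (of_int a) (of_int b) (of_int c) (of_int d) (of_real t))
         (a, b, c, d))"
      by (simp add: has_ray_integral_def)
  qed
  then obtain J2 where J2: "\<And>a b c d. (a, b, c, d) \<in> pos_quads (- 1) \<Longrightarrow> has_ray_integral
      (\<lambda>t. lin_kernel s' s (\<kappa> - s) (of_int a) (of_int b) (of_int c) (of_int d) (of_real t)) (J2 (a, b, c, d))"
    by blast
  have \<epsilon>: "1 = 1 \<or> 1 = (-1::int)" "-1 = 1 \<or> -1 = (-1::int)" by simp_all

  have pd: "pos_det1 = pos_quads 1" by (simp add: pos_det1_def pos_quads_def)
  have Gp: "Gamma s' \<noteq> 0" "Gamma (\<kappa> - s') \<noteq> 0" "Gamma \<kappa> \<noteq> 0" "Gamma s \<noteq> 0" "Gamma (\<kappa> - s) \<noteq> 0"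
    using re by (auto intro!: Gamma_nonzero_right_half)
  then have H0: "H \<noteq> 0" by (simp add: H_def)
  \<comment> \<open>Summability of the integrals \<open>H * hypergeo_term\<close> is a by-product of
    the interchange, and the nonzero \<open>H\<close> can be divided out.\<close>
  have hyp_summable: "hypergeo_term k s s' summable_on pos_det1"
  proof -
    have "(\<lambda>q. H * hypergeo_term k s s' q) summable_on pos_quads 1"
      by (rule has_ray_integral_pos_quads(2)[OF \<epsilon>(1) \<sigma>(1) re(1,2,3), of "\<lambda>q. H * hypergeo_term k s s' q", OF J1])
    then show ?thesis unfolding pd using H0 by (subst (asm) summable_on_cmult_right') auto
  qed

  \<comment> \<open>\<open>L\<close> collects the matrices with \<open>b = 0\<close> or
    \<open>d = 0\<close>, \<open>Z\<close> the remaining ones with \<open>c = 0\<close> or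
    \<open>a = 0\<close>, and \<open>Q\<close> those without zero entries.\<close>
  define L where "L q t = (\<Sum>\<^sub>\<infinity>n::int. (of_real (1 / t) + \<i> * of_int n) powr (- q))" for q and t :: real
  define Z where "Z \<sigma> q t = (\<Sum>\<^sub>\<infinity>n\<in>{0::int<..}. (of_int n + \<i> * of_real (\<sigma> * t)) powr (- q))" for \<sigma> q and t :: real
  define Q where "Q \<epsilon> \<sigma> t = (\<Sum>\<^sub>\<infinity>q\<in>pos_quads \<epsilon>. quad_term \<sigma> s \<kappa> q t)" for \<epsilon> \<sigma> t
  define es where "es = exp (- (of_real pi * \<i> * s / 2))"
  define f where "f t q = kernel_term k s (\<i> * of_real t) (quad_matrix q)" for t q

  have sum: "(f t has_sum (es * (of_real t powr (- \<kappa>) * L (\<kappa> - s) t) +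
     (\<i> powi (- k) * es * (of_real t powr (- \<kappa>) * L s t) +
     (Z 1 s t + (E * Z (-1) s t + (E * Z 1 (\<kappa> - s) t + (Z (-1) (\<kappa> - s) t +
     (Q 1 1 t + (E * Q 1 (-1) t + (E * Q (-1) 1 t + Q (-1) (-1) t)))))))))) psl_reps"
    if t: "t > 0" for t
  proof (rule has_sum_psl_reps)
    have u: "1 / t > 0" using t by simp
    have Lsum: "((\<lambda>n::int. (of_real (1 / t) + \<i> * of_int n) powr (- q)) has_sum L q t) UNIV" if "Re q > 1" for q
      unfolding L_def by (rule has_sum_infsum[OF abs_summable_summable[OF abs_summable_on_int_shift[OF u that]]])
    have "((\<lambda>c. of_real t powr (- \<kappa>) * es * (of_real (1 / t) + \<i> * of_int c) powr (- (\<kappa> - s)))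
        has_sum of_real t powr (- \<kappa>) * es * L (\<kappa> - s) t) UNIV"
      using re by (intro has_sum_cmult_right Lsum) auto
    then show "((\<lambda>c. f t (1, 0, c, 1)) has_sum es * (of_real t powr (- \<kappa>) * L (\<kappa> - s) t)) UNIV"
      unfolding f_def kernel_term_lower_unitriangular[OF t even] es_def[symmetric] \<kappa>_def[symmetric]
      by (simp add: mult_ac)
    have "((\<lambda>n::int. (of_real (1 / t) + \<i> * of_int (- n)) powr (- s)) has_sum L s t) UNIV"
      using Lsum[of s] assms(6)
      by (subst has_sum_reindex_bij_witness[of UNIV uminus uminus UNIV "\<lambda>n. (of_real (1 / t) + \<i> * of_int n) powr (- s)"]) auto
    then have "((\<lambda>a. \<i> powi (- k) * of_real t powr (- \<kappa>) * es * (of_real (1 / t) + \<i> * of_int (- a)) powr (- s))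
        has_sum \<i> powi (- k) * of_real t powr (- \<kappa>) * es * L s t) UNIV"
      by (rule has_sum_cmult_right)
    then show "((\<lambda>a. f t (a, - 1, 1, 0)) has_sum \<i> powi (- k) * es * (of_real t powr (- \<kappa>) * L s t)) UNIV"
      unfolding f_def kernel_term_zero_lower_right[OF t even] es_def[symmetric] \<kappa>_def[symmetric]
      by (simp add: mult_ac)
    have Zsum: "((\<lambda>n. (of_int n + \<i> * of_real (\<sigma> * t)) powr (- q)) has_sum Z \<sigma> q t) {0<..}"
      if "\<sigma> = 1 \<or> \<sigma> = -1" "Re q - Re s' > 1" for \<sigma> q
      unfolding Z_def using has_ray_integral_pos_int_sum(2)[OF that(1) _ that(2) t] re by auto
    have qt3: "quad_term \<sigma> s \<kappa> (1, b, 0, 1) t = (of_int b + \<i> * of_real (\<sigma> * t)) powr (- s)" for \<sigma> b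
      by (simp add: quad_term_def)
    have qt5: "quad_term \<sigma> s \<kappa> (0, 1, 1, d) t = (of_int d + \<i> * of_real (\<sigma> * t)) powr (- (\<kappa> - s))" for \<sigma> d
      by (simp add: quad_term_def)
    show "((\<lambda>b. f t (1, b, 0, 1)) has_sum Z 1 s t) {0<..}"
      using Zsum[OF \<sigma>(1) re(2)]
      by (subst has_sum_cong[OF _]) (auto simp: f_def kernel_term_pos[OF _ _ _ _ t even] \<kappa>_def[symmetric] qt3)
    show "((\<lambda>b. f t (1, - b, 0, 1)) has_sum E * Z (-1) s t) {0<..}"
    proof (subst has_sum_cong)
      show "f t (1, - b, 0, 1) = E * (of_int b + \<i> * of_real (-1 * t)) powr (- s)" if "b \<in> {0<..}" for b
        using kernel_term_neg_antidiagonal[of 1 b 0 1 t k s] that t even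
        by (simp add: f_def \<kappa>_def[symmetric] qt3 E_def)
      show "((\<lambda>b. E * (of_int b + \<i> * of_real (-1 * t)) powr (- s)) has_sum E * Z (-1) s t) {0<..}"
        by (intro has_sum_cmult_right Zsum \<sigma> re)
    qed
    show "((\<lambda>d. f t (0, 1, - 1, - d)) has_sum E * Z 1 (\<kappa> - s) t) {0<..}"
    proof (subst has_sum_cong)
      show "f t (0, 1, - 1, - d) = E * (of_int d + \<i> * of_real (1 * t)) powr (- (\<kappa> - s))" if "d \<in> {0<..}" for d
        using kernel_term_neg_lower_row[of 0 1 1 d t k s] that t even
        by (simp add: f_def \<kappa>_def[symmetric] qt5 E_def)
      show "((\<lambda>d. E * (of_int d + \<i> * of_real (1 * t)) powr (- (\<kappa> - s))) has_sum E * Z 1 (\<kappa> - s) t) {0<..}"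
        using re by (intro has_sum_cmult_right Zsum \<sigma>) auto
    qed
    show "((\<lambda>d. f t (0, - 1, 1, - d)) has_sum Z (-1) (\<kappa> - s) t) {0<..}"
    proof (subst has_sum_cong)
      show "f t (0, - 1, 1, - d) = (of_int d + \<i> * of_real (-1 * t)) powr (- (\<kappa> - s))" if "d \<in> {0<..}" for d
        using kernel_term_alternating[of 0 1 1 d t k s] that t even
        by (simp add: f_def \<kappa>_def[symmetric] qt5)
      show "((\<lambda>d. (of_int d + \<i> * of_real (-1 * t)) powr (- (\<kappa> - s))) has_sum Z (-1) (\<kappa> - s) t) {0<..}"
        using re by (intro Zsum \<sigma>) auto
    qed
    have Qsum: "((\<lambda>q. quad_term \<sigma> s \<kappa> q t) has_sum Q 1 \<sigma> t) (pos_quads 1)"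
      "((\<lambda>q. quad_term \<sigma> s \<kappa> q t) has_sum Q (-1) \<sigma> t) (pos_quads (-1))" if "\<sigma> = 1 \<or> \<sigma> = -1" for \<sigma>
      unfolding Q_def
      using has_ray_integral_pos_quads(3)[OF \<epsilon>(1) that re(1,2,3), of "\<lambda>q. H * hypergeo_term k s s' q", OF J1 t]
        has_ray_integral_pos_quads(3)[OF \<epsilon>(2) that re(1,2,3), of J2, OF J2 t]
      by (simp_all add: has_sum_infsum)
    show "(f t has_sum Q 1 1 t) (pos_quads 1)"
    proof (subst has_sum_cong)
      show "f t q = quad_term 1 s \<kappa> q t" if "q \<in> pos_quads 1" for q
        using that kernel_term_pos[OF _ _ _ _ t even]
        by (cases q) (auto simp: f_def \<kappa>_def[symmetric] pos_quads_def)
    qed (rule Qsum[OF \<sigma>(1)])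
    show "((\<lambda>(a, b, c, d). f t (a, - b, - c, d)) has_sum E * Q 1 (-1) t) (pos_quads 1)"
    proof (subst has_sum_cong)
      show "(case q of (a, b, c, d) \<Rightarrow> f t (a, - b, - c, d)) = E * quad_term (-1) s \<kappa> q t" if "q \<in> pos_quads 1" for q
        using that kernel_term_neg_antidiagonal[OF _ _ _ _ t even]
        by (cases q) (auto simp: f_def \<kappa>_def[symmetric] pos_quads_def E_def)
    qed (intro has_sum_cmult_right Qsum \<sigma>)
    show "((\<lambda>(a, b, c, d). f t (a, b, - c, - d)) has_sum E * Q (-1) 1 t) (pos_quads (- 1))"
    proof (subst has_sum_cong)
      show "(case q of (a, b, c, d) \<Rightarrow> f t (a, b, - c, - d)) = E * quad_term 1 s \<kappa> q t" if "q \<in> pos_quads (- 1)" for q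
        using that kernel_term_neg_lower_row[OF _ _ _ _ t even]
        by (cases q) (auto simp: f_def \<kappa>_def[symmetric] pos_quads_def E_def)
    qed (intro has_sum_cmult_right Qsum \<sigma>)
    show "((\<lambda>(a, b, c, d). f t (a, - b, c, - d)) has_sum Q (-1) (-1) t) (pos_quads (- 1))"
    proof (subst has_sum_cong)
      show "(case q of (a, b, c, d) \<Rightarrow> f t (a, - b, c, - d)) = quad_term (-1) s \<kappa> q t" if "q \<in> pos_quads (- 1)" for q
        using that kernel_term_alternating[OF _ _ _ _ t even]
        by (cases q) (auto simp: f_def \<kappa>_def[symmetric] pos_quads_def)
    qed (intro Qsum \<sigma>)
  qed

  \<comment> \<open>Integrals of the families: \<open>A\<close> for \<open>L\<close>;
    \<open>B\<close> for \<open>Z\<close>, \<open>X\<close> and \<open>X'\<close> for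
    \<open>Q\<close> with determinant 1 and -1, these three before the rotation factors.\<close>
  define A where "A q = (2 * of_real pi) powr (q - (\<kappa> - s')) * (Gamma (\<kappa> - s') / Gamma q) * riemann_zeta (\<kappa> - s' - q + 1)" for q
  define B where "B q = riemann_zeta (q - s') * (Gamma s' * Gamma (q - s') / Gamma q)" for q
  define X where "X = H * (\<Sum>\<^sub>\<infinity>q\<in>pos_det1. hypergeo_term k s s' q)"
  define X' where "X' = (\<Sum>\<^sub>\<infinity>q\<in>pos_quads (-1). J2 q)"
  define V where "V = es * A (\<kappa> - s) + (\<i> powi (- k) * es * A s + (ep * B s + (E * (em * B s) +
     (E * (ep * B (\<kappa> - s)) + (em * B (\<kappa> - s) + (ep * X + (E * (em * X) + (E * (ep * X') + em * X'))))))))"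
  define T where "T t = of_real t powr (s' - 1)" for t :: real
  have IL: "has_ray_integral (\<lambda>t. T t * (of_real t powr (- \<kappa>) * L q t)) (A q)"
    if "Re q > 1" "Re (\<kappa> - s') > Re q" for q
    unfolding T_def L_def A_def by (rule has_ray_integral_Lipschitz_inverse[OF that])
  have IZ: "has_ray_integral (\<lambda>t. T t * Z 1 q t) (ep * B q)"
    "has_ray_integral (\<lambda>t. T t * Z (-1) q t) (em * B q)" if "Re q - Re s' > 1" for q
    using has_ray_integral_pos_int_sum(1)[OF \<sigma>(1) _ that] has_ray_integral_pos_int_sum(1)[OF \<sigma>(2) _ that] re
    unfolding T_def Z_def B_def sgn_exp by simp_all
  have X: "(\<Sum>\<^sub>\<infinity>q\<in>pos_quads 1. H * hypergeo_term k s s' q) = X"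
    unfolding X_def pd by (rule infsum_cmult_right')
  have IQ1: "has_ray_integral (\<lambda>t. T t * Q 1 1 t) (ep * X)"
    "has_ray_integral (\<lambda>t. T t * Q 1 (-1) t) (em * X)"
    using has_ray_integral_pos_quads(1)[OF \<epsilon>(1) \<sigma>(1) re(1,2,3), of "\<lambda>q. H * hypergeo_term k s s' q", OF J1]
      has_ray_integral_pos_quads(1)[OF \<epsilon>(1) \<sigma>(2) re(1,2,3), of "\<lambda>q. H * hypergeo_term k s s' q", OF J1]
    unfolding T_def Q_def X sgn_exp by simp_all
  have IQ2: "has_ray_integral (\<lambda>t. T t * Q (-1) 1 t) (ep * X')"
    "has_ray_integral (\<lambda>t. T t * Q (-1) (-1) t) (em * X')"
    using has_ray_integral_pos_quads(1)[OF \<epsilon>(2) \<sigma>(1) re(1,2,3), of J2, OF J2]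
      has_ray_integral_pos_quads(1)[OF \<epsilon>(2) \<sigma>(2) re(1,2,3), of J2, OF J2]
    unfolding T_def Q_def X'_def sgn_exp by simp_all
  define \<gamma> where "\<gamma> = gamma_factor k s"
  have \<gamma>0: "\<gamma> \<noteq> 0" using Gp by (simp add: \<gamma>_def gamma_factor_def \<kappa>_def)
  let ?I = "\<lambda>t. \<gamma> * (es * (T t * (of_real t powr (- \<kappa>) * L (\<kappa> - s) t)) +
     (\<i> powi (- k) * es * (T t * (of_real t powr (- \<kappa>) * L s t)) +
     (T t * Z 1 s t + (E * (T t * Z (-1) s t) + (E * (T t * Z 1 (\<kappa> - s) t) + (T t * Z (-1) (\<kappa> - s) t +
     (T t * Q 1 1 t + (E * (T t * Q 1 (-1) t) + (E * (T t * Q (-1) 1 t) + T t * Q (-1) (-1) t)))))))))"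
  have "has_ray_integral ?I (\<gamma> * V)"
    unfolding V_def using re assms(6)
    by (intro has_ray_integral_cmult has_ray_integral_add IL IZ IQ1 IQ2) auto
  also have "?this \<longleftrightarrow> has_ray_integral (\<lambda>t. kernel_R k s (\<i> * of_real t) * of_real t powr (s' - 1)) (\<gamma> * V)"
  proof (rule has_ray_integral_cong)
    fix t :: real assume t: "t > 0"
    have "kernel_R k s (\<i> * of_real t) = \<gamma> * infsum (f t) psl_reps"
      unfolding kernel_R_eq_psl_reps[OF even] f_def \<gamma>_def ..
    then show "?I t =
       kernel_R k s (\<i> * of_real t) * of_real t powr (s' - 1)"
      unfolding infsumI[OF sum[OF t]] T_def[symmetric] by (simp add: distrib_left distrib_right mult_ac)
  qed
  finally have main: "has_ray_integral (\<lambda>t. kernel_R k s (\<i> * of_real t) * of_real t powr (s' - 1)) (\<gamma> * V)" .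

  \<comment> \<open>The ten contributions are regrouped by integral: \<open>B (\<kappa> - s)\<close>
    and \<open>X'\<close> share the coefficient \<open>E * ep + em = 0\<close>.\<close>
  have V_eq: "V = es * A (\<kappa> - s) + \<i> powi (- k) * es * A s + (ep + E * em) * X + (ep + E * em) * B s"
  proof -
    have "V = es * A (\<kappa> - s) + \<i> powi (- k) * es * A s + (ep + E * em) * X + (ep + E * em) * B s +
        (E * ep + em) * (B (\<kappa> - s) + X')"
      unfolding V_def by (simp add: algebra_simps)
    then show ?thesis unfolding Ep by simp
  qed
  have re2pi: "Re (2 * complex_of_real pi) > 0" by simp
  \<comment> \<open>The family \<open>b = 0\<close> carries no factor
    \<open>\<i> powi (- k)\<close>. In the stated form this factor cancels the
    \<open>exp (pi \<i> k / 2)\<close> contained in the principal power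
    \<open>(2 pi \<i>) powr (k - s)\<close>.\<close>
  have t1: "es * A (\<kappa> - s) = \<i> powi (- k) * ((2 * of_real pi * \<i>) powr (\<kappa> - s) / (2 * of_real pi) powr (\<kappa> - s'))
           * riemann_zeta (s - s' + 1) * (Gamma (\<kappa> - s') / Gamma (\<kappa> - s))"
  proof -
    have "(2 * of_real pi * \<i>) powr (\<kappa> - s) = exp (of_real pi * \<i> * (\<kappa> - s) / 2) * (2 * of_real pi) powr (\<kappa> - s)"
      using powr_times_ii_right_half(1)[OF re2pi, of "\<kappa> - s"] by (simp only: mult.commute[of \<i>])
    also have "exp (of_real pi * \<i> * (\<kappa> - s) / 2) = exp (of_real pi * \<i> * \<kappa> / 2) * es"
      unfolding es_def exp_add[symmetric] by (simp add: algebra_simps diff_divide_distrib)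
    finally have "\<i> powi (- k) * (2 * of_real pi * \<i>) powr (\<kappa> - s) =
        (\<i> powi (- k) * exp (of_real pi * \<i> * \<kappa> / 2)) * (es * (2 * of_real pi) powr (\<kappa> - s))"
      by (simp only: mult.assoc)
    then have i: "\<i> powi (- k) * (2 * of_real pi * \<i>) powr (\<kappa> - s) = es * (2 * of_real pi) powr (\<kappa> - s)"
      unfolding \<kappa>_def ii_powi_mult_exp by simp
    have "\<kappa> - s' - (\<kappa> - s) + 1 = s - s' + 1" by simp
    then have "es * A (\<kappa> - s) = (es * (2 * of_real pi) powr (\<kappa> - s)) / (2 * of_real pi) powr (\<kappa> - s')
           * riemann_zeta (s - s' + 1) * (Gamma (\<kappa> - s') / Gamma (\<kappa> - s))"
      unfolding A_def by (simp only: powr_diff) (simp add: mult_ac)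
    then show ?thesis unfolding i[symmetric] by simp
  qed
  \<comment> \<open>Here \<open>\<i> powi (- k)\<close> comes from the kernel terms, and the
    principal argument -\<pi>/2 of \<open>- 2 pi \<i>\<close> accounts for
    \<open>es\<close>.\<close>
  have t2: "\<i> powi (- k) * es * A s = \<i> powi (- k) * ((- 2 * of_real pi * \<i>) powr s / (2 * of_real pi) powr (\<kappa> - s'))
           * riemann_zeta (\<kappa> - s' - s + 1) * (Gamma (\<kappa> - s') / Gamma s)"
  proof -
    have "- 2 * of_real pi * \<i> = - \<i> * (2 * complex_of_real pi)" by simp
    then have "(- 2 * of_real pi * \<i>) powr s = es * (2 * of_real pi) powr s"
      unfolding es_def using powr_times_ii_right_half(2)[OF re2pi, of s] by (simp only:)
    then show ?thesis unfolding A_def powr_diff[of _ s] by (simp add: mult_ac)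
  qed
  define m where "m = nat (k - 1)"
  have "of_int k > (1::real)" using assms by linarith
  then have k1: "k > 1" by simp
  then have km: "\<kappa> = 1 + of_nat m" by (simp add: m_def \<kappa>_def of_nat_nat)
  have fact: "Gamma \<kappa> = fact m" unfolding km using Gamma_fact[of m, where 'a = complex] by simp
  have "real m = of_int k - 1" using k1 by (simp add: m_def)
  then have "sin (of_real pi * s') * (Gamma s' * Gamma (1 - s' + of_nat m)) = of_real pi * pochhammer (1 - s') m"
    using re assms(9) by (intro sin_Gamma_eq_pochhammer) auto
  then have sG: "sin (of_real pi * s') * H = of_real pi * (pochhammer (- s' + 1) m / fact m)"
  proof -
    have "\<kappa> - s' = 1 - s' + of_nat m" "- s' + 1 = 1 - s'" by (simp_all add: km)
    then show ?thesis
      using \<open>sin _ * _ = _\<close> unfolding H_def fact by (simp only: times_divide_eq_right)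
  qed
  have t3: "(ep + E * em) * X = 2 * of_real pi * exp (of_real pi * \<i> * (s' - 1) / 2)
           * (pochhammer (- s' + 1) m / fact m) * (\<Sum>\<^sub>\<infinity>q\<in>pos_det1. hypergeo_term k s s' q)"
  proof -
    have "(ep + E * em) * X = 2 * exp (of_real pi * \<i> * (s' - 1) / 2) * (sin (of_real pi * s') * H)
        * (\<Sum>\<^sub>\<infinity>q\<in>pos_det1. hypergeo_term k s s' q)"
      unfolding Em exp_difference_eq_sin X_def by (simp only: mult_ac)
    then show ?thesis unfolding sG by (simp only: mult_ac)
  qed
  have t4: "(ep + E * em) * B s = riemann_zeta (s - s')
           * (exp (- of_real pi * \<i> * s' / 2) - exp (3 * of_real pi * \<i> * s' / 2))
           * (Gamma s' * Gamma (s - s') / Gamma s)"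
    unfolding Em B_def by (simp only: mult_ac)
  have "inverse \<gamma> * (LBINT t:{0<..}. kernel_R k s (\<i> * of_real t) * of_real t powr (s' - 1)) = V"
    using main \<gamma>0 by (simp add: has_ray_integral_def)
  moreover have "set_integrable lborel {0<..} (\<lambda>t. kernel_R k s (\<i> * of_real t) * of_real t powr (s' - 1))"
    using main by (simp add: has_ray_integral_def)
  ultimately show ?thesis
    using hyp_summable unfolding V_eq t1 t2 t3 t4 unfolding \<gamma>_def \<kappa>_def m_def by blast
qed

end
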